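(* Let $W \in \mathcal{P}(\mathcal{Y}|\mathcal{X})$ be a symmetric and nonsingular discrete memoryless channel with $R_{\mathrm{cr}} < C(W)$. (i) For every $R$ with $R_{\mathrm{cr}} < R < C(W)$ there is a constant $K_1>0$ (depending on $W$ and $R$) such that for every blocklength $N$, $$\mathrm{P}_{\mathrm{e}}(N,R) \le \frac{K_1}{N^{\frac12(1+|\mathrm{E}_{\mathrm{r}}'(R)|)}}\exp\{-N\,\mathrm{E}_{\mathrm{r}}(R)\}.$$ (ii) For every $R$ with $R_\infty < R < C(W)$ there is a constant $\tilde K_1>0$ (depending on $W$ and $R$) such that for every blocklength $N$, $$\bar{\mathrm{P}}_{\mathrm{e,fb}}(N,R) \ge \frac{\tilde K_1}{N^{\frac12(1+|\mathrm{E}_{\mathrm{SP}}'(R)|)}}\exp\{-N\,\mathrm{E}_{\mathrm{SP}}(R)\}.$$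
   Context: $\mathcal{X},\mathcal{Y}$ are finite sets; $\mathcal{P}(\mathcal{A})$ is the set of probability measures on $\mathcal{A}$, $\mathcal{P}(\mathcal{Y}|\mathcal{X})$ the set of stochastic matrices (channels) from $\mathcal{X}$ to $\mathcal{Y}$, $U_{\mathcal{X}}$ the uniform distribution on $\mathcal{X}$. The channel is used memorylessly: $W(\mathbf{y}^N|\mathbf{x}^N)=\prod_n W(y_n|x_n)$. A channel is symmetric (in Gallager's sense) if its output set can be partitioned into subsets such that, within each subset, in the submatrix of transition probabilities each row is a permutation of each other row and each column is a permutation of each other column. A symmetric channel is singular if for all $(x,y,z)\in\mathcal{X}\times\mathcal{Y}\times\mathcal{X}$ with $W(y|x)W(y|z)>0$ we have $W(y|x)=W(y|z)$; otherwise it is nonsingular. An $(N,R)$ code consists of an encoder $f:\mathcal{M}\to\mathcal{X}^N$, $\mathcal{M}=\{1,\dots,\lceil e^{NR}\rceil\}$, and a decoder $\varphi:\mathcal{Y}^N\to\mathcal{M}$. $\mathrm{P}_{\mathrm{e}}(N,R)$ is the minimum over $(N,R)$ codes of the maximal (over messages) error probability. An $(N,R)$ code with ideal feedback consists of encoding maps $f_n:\mathcal{M}\times\mathcal{Y}^{n-1}\to\mathcal{X}$, $n=1,\dots,N$, and a decoder $\varphi:\mathcal{Y}^N\to\mathcal{M}$; given message $m$ the output law is $\prod_{n=1}^N W(y_n|f_n(m,\mathbf{y}^{n-1}))$. Its average error probability is $\frac{1}{|\mathcal{M}|}\sum_m \Pr[\varphi(\mathbf{Y}^N)\neq m\mid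 m]$, and $\bar{\mathrm{P}}_{\mathrm{e,fb}}(N,R)$ is the minimum of this over all $(N,R)$ codes with ideal feedback. Exponents: $\mathrm{E}_{\mathrm{o}}(\rho,Q)=-\ln\sum_y\big(\sum_x Q(x)W(y|x)^{1/(1+\rho)}\big)^{1+\rho}$; $\mathrm{E}_{\mathrm{r}}(R)=\max_Q\max_{0\le\rho\le1}\{\mathrm{E}_{\mathrm{o}}(\rho,Q)-\rho R\}$; $\mathrm{E}_{\mathrm{SP}}(R)=\max_Q\min_{V: I(Q;V)\le R} D(V\|W|Q)$, where $D(V\|W|Q)=\sum_x Q(x)D(V(\cdot|x)\|W(\cdot|x))$. $R_\infty$ is the largest rate such that $\mathrm{E}_{\mathrm{SP}}(R)=\infty$ for all rates below it; $R_{\mathrm{cr}}$ is the critical rate, i.e. $\mathrm{E}_{\mathrm{r}}(R)=\mathrm{E}_{\mathrm{SP}}(R)$ iff $R\ge R_{\mathrm{cr}}$. $C(W)$ is the capacity; $\mathrm{E}'$ denotes derivative in $R$. *)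

theory Defs
  imports "HOL-Analysis.Analysis" "HOL-Library.Extended_Real"
begin

definition is_dist :: "('a::finite \<Rightarrow> real) \<Rightarrow> bool" where
  "is_dist Q \<longleftrightarrow> (\<forall>x. Q x \<ge> 0) \<and> (\<Sum>x\<in>UNIV. Q x) = 1"

definition is_channel :: "('x::finite \<Rightarrow> 'y::finite \<Rightarrow> real) \<Rightarrow> bool" where
  "is_channel W \<longleftrightarrow> (\<forall>x. is_dist (W x))"

definition is_partition :: "'a set set \<Rightarrow> bool" where
  "is_partition P \<longleftrightarrow> (\<forall>A\<in>P. A \<noteq> {}) \<and> \<Union>P = UNIV \<and>
     (\<forall>A\<in>P. \<forall>B\<in>P. A \<noteq> B \<longrightarrow> A \<inter> B = {})"

definition gallager_symmetric :: "('x::finite \<Rightarrow> 'y::finite \<Rightarrow> real) \<Rightarrow> bool" where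
  "gallager_symmetric W \<longleftrightarrow> (\<exists>P. is_partition P \<and> (\<forall>A\<in>P.
     (\<forall>x x'. \<exists>\<pi>. bij_betw \<pi> A A \<and> (\<forall>y\<in>A. W x' y = W x (\<pi> y))) \<and>
     (\<forall>y\<in>A. \<forall>y'\<in>A. \<exists>\<sigma>. bij \<sigma> \<and> (\<forall>x. W x y' = W (\<sigma> x) y))))"

definition singular_channel :: "('x::finite \<Rightarrow> 'y::finite \<Rightarrow> real) \<Rightarrow> bool" where
  "singular_channel W \<longleftrightarrow> (\<forall>x y z. W x y * W z y > 0 \<longrightarrow> W x y = W z y)"

definition out_dist :: "('x::finite \<Rightarrow> real) \<Rightarrow> ('x \<Rightarrow> 'y::finite \<Rightarrow> real) \<Rightarrow> 'y \<Rightarrow> real" where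
  "out_dist Q V y = (\<Sum>x\<in>UNIV. Q x * V x y)"

definition mutual_info :: "('x::finite \<Rightarrow> real) \<Rightarrow> ('x \<Rightarrow> 'y::finite \<Rightarrow> real) \<Rightarrow> real" where
  "mutual_info Q V = (\<Sum>x\<in>UNIV. \<Sum>y\<in>UNIV.
      if Q x * V x y = 0 then 0 else Q x * V x y * ln (V x y / out_dist Q V y))"

definition cond_div :: "('x::finite \<Rightarrow> 'y::finite \<Rightarrow> real) \<Rightarrow> ('x \<Rightarrow> 'y \<Rightarrow> real) \<Rightarrow> ('x \<Rightarrow> real) \<Rightarrow> ereal" where
  "cond_div V W Q = (if \<exists>x y. Q x > 0 \<and> V x y > 0 \<and> W x y = 0 then \<infinity>
     else ereal (\<Sum>x\<in>UNIV. Q x * (\<Sum>y\<in>UNIV. if V x y = 0 then 0 else V x y * ln (V x y / W x y))))"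

definition capacity :: "('x::finite \<Rightarrow> 'y::finite \<Rightarrow> real) \<Rightarrow> real" where
  "capacity W = (SUP Q\<in>{Q. is_dist Q}. mutual_info Q W)"

definition E0 :: "('x::finite \<Rightarrow> 'y::finite \<Rightarrow> real) \<Rightarrow> real \<Rightarrow> ('x \<Rightarrow> real) \<Rightarrow> real" where
  "E0 W \<rho> Q = - ln (\<Sum>y\<in>UNIV. (\<Sum>x\<in>UNIV. Q x * W x y powr (1 / (1 + \<rho>))) powr (1 + \<rho>))"

definition Er :: "('x::finite \<Rightarrow> 'y::finite \<Rightarrow> real) \<Rightarrow> real \<Rightarrow> real" where
  "Er W R = (SUP p\<in>{Q. is_dist Q} \<times> {0..1}. E0 W (snd p) (fst p) - snd p * R)"

definition Esp :: "('x::finite \<Rightarrow> 'y::finite \<Rightarrow> real) \<Rightarrow> real \<Rightarrow> ereal" where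
  "Esp W R = (SUP Q\<in>{Q. is_dist Q}.
      INF V\<in>{V. is_channel V \<and> mutual_info Q V \<le> R}. cond_div V W Q)"

text \<open>Real-valued version of E_SP (meaningful where E_SP is finite, e.g. R > R_inf).\<close>
definition Esp_real :: "('x::finite \<Rightarrow> 'y::finite \<Rightarrow> real) \<Rightarrow> real \<Rightarrow> real" where
  "Esp_real W R = real_of_ereal (Esp W R)"

definition R_inf :: "('x::finite \<Rightarrow> 'y::finite \<Rightarrow> real) \<Rightarrow> real" where
  "R_inf W = Sup {r. \<forall>R<r. Esp W R = \<infinity>}"

definition R_cr :: "('x::finite \<Rightarrow> 'y::finite \<Rightarrow> real) \<Rightarrow> real" where
  "R_cr W = Inf {R. ereal (Er W R) = Esp W R}"

definition messages :: "nat \<Rightarrow> real \<Rightarrow> nat set" where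
  "messages N R = {1..nat \<lceil>exp (real N * R)\<rceil>}"

definition words :: "nat \<Rightarrow> 'a list set" where
  "words N = {xs. length xs = N}"

definition prodW :: "('x \<Rightarrow> 'y \<Rightarrow> real) \<Rightarrow> 'x list \<Rightarrow> 'y list \<Rightarrow> real" where
  "prodW W xs ys = (\<Prod>n<length xs. W (xs ! n) (ys ! n))"

definition err_msg :: "('x::finite \<Rightarrow> 'y::finite \<Rightarrow> real) \<Rightarrow> nat \<Rightarrow> (nat \<Rightarrow> 'x list) \<Rightarrow> ('y list \<Rightarrow> nat) \<Rightarrow> nat \<Rightarrow> real" where
  "err_msg W N f dec m = (\<Sum>ys\<in>words N. if dec ys \<noteq> m then prodW W (f m) ys else 0)"

definition is_code :: "nat \<Rightarrow> real \<Rightarrow> (nat \<Rightarrow> 'x list) \<Rightarrow> ('y list \<Rightarrow> nat) \<Rightarrow> bool" where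
  "is_code N R f dec \<longleftrightarrow> (\<forall>m\<in>messages N R. length (f m) = N) \<and>
     (\<forall>ys\<in>words N. dec ys \<in> messages N R)"

definition Pe :: "('x::finite \<Rightarrow> 'y::finite \<Rightarrow> real) \<Rightarrow> nat \<Rightarrow> real \<Rightarrow> real" where
  "Pe W N R = Inf {Max ((err_msg W N f dec) ` messages N R) | f dec. is_code N R f dec}"

text \<open>Feedback codes: enc n m ys is the n-th channel input (1 \<le> n \<le> N) given message m and
  past outputs ys (of length n-1).\<close>
definition fb_law :: "('x \<Rightarrow> 'y \<Rightarrow> real) \<Rightarrow> nat \<Rightarrow> (nat \<Rightarrow> nat \<Rightarrow> 'y list \<Rightarrow> 'x) \<Rightarrow> nat \<Rightarrow> 'y list \<Rightarrow> real" where
  "fb_law W N enc m ys = (\<Prod>n\<in>{1..N}. W (enc n m (take (n - 1) ys)) (ys ! (n - 1)))"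

definition fb_avg_err :: "('x::finite \<Rightarrow> 'y::finite \<Rightarrow> real) \<Rightarrow> nat \<Rightarrow> real \<Rightarrow> (nat \<Rightarrow> nat \<Rightarrow> 'y list \<Rightarrow> 'x) \<Rightarrow> ('y list \<Rightarrow> nat) \<Rightarrow> real" where
  "fb_avg_err W N R enc dec = (1 / real (card (messages N R))) *
     (\<Sum>m\<in>messages N R. \<Sum>ys\<in>words N. if dec ys \<noteq> m then fb_law W N enc m ys else 0)"

definition Pe_fb_avg :: "('x::finite \<Rightarrow> 'y::finite \<Rightarrow> real) \<Rightarrow> nat \<Rightarrow> real \<Rightarrow> real" where
  "Pe_fb_avg W N R = Inf {fb_avg_err W N R enc dec | enc dec.
      \<forall>ys\<in>words N. dec ys \<in> messages N R}"

end

theory Submission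
  imports Defs
begin

text \<open>
  Write \<open>U\<close> for the uniform input law, \<open>\<alpha> y = (\<Sum>x. U x * W x y powr (1/(1+\<rho>)))\<close> and
  \<open>q y = \<alpha> y powr (1+\<rho>) / Z\<close>. For a symmetric channel the tilted channel
  \<open>V\<^sub>\<rho> x y = W x y powr (1/(1+\<rho>)) * \<alpha> y powr \<rho> / Z\<close> satisfies, with \<open>J \<rho> = I(U;V\<^sub>\<rho>)\<close>,
  \<open>D(V\<^sub>\<rho>\<parallel>W|Q) = E\<^sub>0(\<rho>) - \<rho> J(\<rho>)\<close> for every input law \<open>Q\<close>, and \<open>J \<rho>\<close> is a strict supergradient of \<open>E\<^sub>0\<close> at
  \<open>\<rho>\<close> by nonsingularity. Hence at \<open>R = J \<rho>\<close> the exponents equal \<open>E\<^sub>0(\<rho>) - \<rho> R\<close> and have slope \<open>-\<rho>\<close>.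

  Converse: a code yields a test between \<open>W\<close> and \<open>q\<close> of size at most \<open>exp (-N R)\<close>, and symmetry makes
  the log-likelihood ratio an i.i.d. sum whatever the feedback encoder does. After tilting to \<open>V\<^sub>\<rho>\<close>,
  it is enough that such a sum hits a given window near its mean with probability at least \<open>c / sqrt N\<close>.

  Achievability: the random coding union bound \<open>E (min 1 (M p(X,Y)))\<close>. Nonsingularity provides
  a letter \<open>y\<^sub>0\<close> with two different positive likelihoods, so anti-concentration gains a factor \<open>1 / sqrt N\<close>
  in \<open>p\<close>, which enters to the power \<open>\<rho>\<close>, and another \<open>1 / sqrt N\<close> in the outer expectation.

  Both anti-concentration bounds come from splitting off a fair coin between two letters and conditioning
  on everything else, which reduces them to bounds on binomial coefficients.
\<close>

section \<open>Sums over words and the fair-coin decomposition\<close>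

text \<open>In the converse the factor N powr (- (1+\<rho>)/2) is a shift of the test threshold.
  Beyond a level \<open>a\<close> near its mean, the log-likelihood ratio has
  \<open>q \<rho>\<close>-probability of order at least exp (- (a + N E0u) / (1+\<rho>)) / sqrt N,
  and this must exceed exp (- N R); so \<open>a\<close> is put (1+\<rho>)/2 * ln N below the mean,
  up to a constant. The shift is o(sqrt N), so a window placed there still has probability of order
  1 / sqrt N. In the random coding bound, min 1 t is dominated by t powr \<rho> times a kernel
  decaying exponentially in |ln t|. The kernel requires 0 < \<rho> < 1, which R >
  \<open>R_cr\<close> provides. The obstacle is that the i.i.d. sums may or may not live on a
  lattice, while the constants must be uniform in the threshold. The coin treats both cases alike:
  given all the rest, the sum is a walk on a lattice of known spacing. Upper bounds become sums over
  that lattice, and lower bounds use a window exactly as long as the spacing.\<close>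

lemma finite_words [simp]: "finite (words N :: 'a::finite list set)"
proof -
  have "words N = {xs :: 'a list. set xs \<subseteq> UNIV \<and> length xs = N}"
    by (auto simp: words_def)
  then show ?thesis
    using finite_lists_length_eq[of "UNIV :: 'a set" N] by simp
qed

lemma words_0 [simp]: "words 0 = {[]}"
  by (auto simp: words_def)

lemma sum_words_Suc:
  fixes F :: "'a::finite list \<Rightarrow> real"
  shows "(\<Sum>xs\<in>words (Suc N). F xs) = (\<Sum>x\<in>UNIV. \<Sum>xs\<in>words N. F (x # xs))"
proof -
  have *: "words (Suc N) = (\<lambda>(x, xs). x # xs) ` (UNIV \<times> words N)"
    by (auto simp: words_def image_iff length_Suc_conv)
  have "inj_on (\<lambda>(x, xs). x # xs) (UNIV \<times> words N)"
    by (auto simp: inj_on_def)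
  then show ?thesis
    unfolding * by (subst sum.reindex) (auto simp: sum.cartesian_product split_def)
qed

lemma sum_words_Suc_snoc:
  fixes F :: "'a::finite list \<Rightarrow> real"
  shows "(\<Sum>xs\<in>words (Suc N). F xs) = (\<Sum>xs\<in>words N. \<Sum>x\<in>UNIV. F (xs @ [x]))"
proof -
  have *: "words (Suc N) = (\<lambda>(xs, x). xs @ [x]) ` (words N \<times> UNIV)"
    by (auto simp: words_def image_iff length_Suc_conv_rev)
  have "inj_on (\<lambda>(xs, x). xs @ [x]) (words N \<times> UNIV)"
    by (auto simp: inj_on_def)
  then show ?thesis
    unfolding * by (subst sum.reindex) (auto simp: sum.cartesian_product split_def)
qed

text \<open>For a law \<open>p\<close> this is the expectation of \<open>F\<close> over an i.i.d.
  word of length \<open>N\<close>; recursion on the first letter (\<open>wsum_Suc\<close>) or on the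
  last (\<open>wsum_snoc\<close>) takes the place of product measures.\<close>

definition wsum :: "('a::finite \<Rightarrow> real) \<Rightarrow> nat \<Rightarrow> ('a list \<Rightarrow> real) \<Rightarrow> real" where
  "wsum p N F = (\<Sum>xs\<in>words N. prod_list (map p xs) * F xs)"

lemma wsum_0 [simp]: "wsum p 0 F = F []"
  by (simp add: wsum_def)

lemma wsum_Suc: "wsum p (Suc N) F = (\<Sum>x\<in>UNIV. p x * wsum p N (\<lambda>xs. F (x # xs)))"
  by (simp add: wsum_def sum_words_Suc sum_distrib_left mult.assoc)

lemma prod_list_map_nonneg: "(\<And>x. 0 \<le> p x) \<Longrightarrow> 0 \<le> prod_list (map p xs)" for p :: "'a \<Rightarrow> real"
  by (induction xs) auto

lemma wsum_mono:
  assumes "\<And>x. 0 \<le> p x" "\<And>xs. length xs = N \<Longrightarrow> F xs \<le> G xs"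
  shows "wsum p N F \<le> wsum p N G"
  unfolding wsum_def
  by (intro sum_mono mult_left_mono prod_list_map_nonneg) (auto simp: assms words_def)

lemma wsum_cong: "(\<And>xs. length xs = N \<Longrightarrow> F xs = G xs) \<Longrightarrow> wsum p N F = wsum p N G"
  unfolding wsum_def by (intro sum.cong) (auto simp: words_def)

lemma wsum_add: "wsum p N (\<lambda>xs. F xs + G xs) = wsum p N F + wsum p N G"
  by (simp add: wsum_def distrib_left sum.distrib)

lemma wsum_cmult: "wsum p N (\<lambda>xs. c * F xs) = c * wsum p N F"
  by (simp add: wsum_def sum_distrib_left mult.left_commute)

lemma wsum_const:
  assumes "(\<Sum>x\<in>UNIV. p x) = 1"
  shows "wsum p N (\<lambda>xs. c) = c"
  by (induction N) (simp_all add: wsum_Suc sum_distrib_right[symmetric] assms)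

text \<open>The offset \<open>s\<close> absorbs the first letter in the induction; centring kills
  the cross term, so variances add.\<close>

lemma wsum_square:
  assumes p: "(\<Sum>x\<in>UNIV. p x) = 1" and f: "(\<Sum>x\<in>UNIV. p x * f x) = 0"
  shows "wsum p N (\<lambda>xs. (s + sum_list (map f xs))\<^sup>2) = s\<^sup>2 + real N * (\<Sum>x\<in>UNIV. p x * (f x)\<^sup>2)"
proof (induction N arbitrary: s)
  case (Suc N)
  let ?v = "\<Sum>x\<in>UNIV. p x * (f x)\<^sup>2"
  have "wsum p (Suc N) (\<lambda>xs. (s + sum_list (map f xs))\<^sup>2)
      = (\<Sum>x\<in>UNIV. p x * wsum p N (\<lambda>xs. ((s + f x) + sum_list (map f xs))\<^sup>2))"
    by (simp add: wsum_Suc add.assoc)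
  also have "\<dots> = (\<Sum>x\<in>UNIV. p x * ((s + f x)\<^sup>2 + real N * ?v))"
    using Suc by simp
  also have "\<dots> = (\<Sum>x\<in>UNIV. (s\<^sup>2 + real N * ?v) * p x + 2 * s * (p x * f x) + p x * (f x)\<^sup>2)"
    by (intro sum.cong) (auto simp: algebra_simps power2_eq_square)
  also have "\<dots> = (s\<^sup>2 + real N * ?v) * 1 + 2 * s * 0 + ?v"
    by (simp add: sum.distrib sum_distrib_left[symmetric] p f)
  finally show ?case by (simp add: algebra_simps)
qed simp

lemma sum_list_map_diff_const:
  "sum_list (map (\<lambda>x. g x - \<mu>) xs) = sum_list (map g xs) - real (length xs) * \<mu>"
  by (induction xs) (auto simp: algebra_simps)

lemma wsum_chebyshev:
  fixes p g :: "'a::finite \<Rightarrow> real"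
  assumes p: "(\<Sum>x\<in>UNIV. p x) = 1" and p0: "\<And>x. 0 \<le> p x" and "T > 0"
  defines "\<mu> \<equiv> \<Sum>x\<in>UNIV. p x * g x"
  shows "wsum p N (\<lambda>xs. if T \<le> \<bar>sum_list (map g xs) - real N * \<mu>\<bar> then 1 else 0)
     \<le> real N * (\<Sum>x\<in>UNIV. p x * (g x - \<mu>)\<^sup>2) / T\<^sup>2"
proof -
  let ?f = "\<lambda>x. g x - \<mu>"
  have f: "(\<Sum>x\<in>UNIV. p x * ?f x) = 0"
    using p by (simp add: \<mu>_def right_diff_distrib sum_subtractf sum_distrib_right[symmetric])
  have "wsum p N (\<lambda>xs. if T \<le> \<bar>sum_list (map g xs) - real N * \<mu>\<bar> then 1 else 0)
     \<le> wsum p N (\<lambda>xs. (1 / T\<^sup>2) * (0 + sum_list (map ?f xs))\<^sup>2)"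
  proof (intro wsum_mono p0)
    fix xs :: "'a list" assume len: "length xs = N"
    have "T\<^sup>2 \<le> (sum_list (map g xs) - real N * \<mu>)\<^sup>2" if "T \<le> \<bar>sum_list (map g xs) - real N * \<mu>\<bar>"
      using power_mono[OF that, of 2] \<open>T > 0\<close> by simp
    then show "(if T \<le> \<bar>sum_list (map g xs) - real N * \<mu>\<bar> then 1 else 0)
       \<le> (1 / T\<^sup>2) * (0 + sum_list (map ?f xs))\<^sup>2"
      using \<open>T > 0\<close> len by (auto simp: sum_list_map_diff_const)
  qed
  also have "\<dots> = real N * (\<Sum>x\<in>UNIV. p x * (?f x)\<^sup>2) / T\<^sup>2"
    by (simp only: wsum_cmult wsum_square[OF p f]) simp
  finally show ?thesis .
qed

text \<open>The expectation of \<open>F\<close> at the endpoint of a simple random walk: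
  \<open>n\<close> fair steps of size \<open>d\<close>, started at \<open>c\<close>.\<close>

fun coin :: "real \<Rightarrow> nat \<Rightarrow> (real \<Rightarrow> real) \<Rightarrow> real \<Rightarrow> real" where
  "coin d 0 F c = F c"
| "coin d (Suc n) F c = (coin d n F (c + d) + coin d n F (c - d)) / 2"

lemma coin_eq_sum:
  "coin d n F c = (\<Sum>j\<le>n. real (n choose j) / 2 ^ n * F (c + d * (2 * real j - real n)))"
proof (induction n arbitrary: c)
  case (Suc n)
  let ?g = "\<lambda>j. F (c + d * (2 * real j - real (Suc n)))"
  have 1: "coin d n F (c - d) = (\<Sum>j\<le>n. real (n choose j) / 2 ^ n * ?g j)"
    unfolding Suc by (intro sum.cong refl arg_cong2[where f="(*)"] arg_cong[where f=F])
      (simp add: algebra_simps)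
  have 2: "coin d n F (c + d) = (\<Sum>j\<le>n. real (n choose j) / 2 ^ n * ?g (Suc j))"
    unfolding Suc by (intro sum.cong refl arg_cong2[where f="(*)"] arg_cong[where f=F])
      (simp add: algebra_simps)
  have 3: "(\<Sum>j\<le>n. real (n choose j) * ?g j)
      = ?g 0 + (\<Sum>j\<le>n. real (n choose Suc j) * ?g (Suc j))"
  proof -
    have "(\<Sum>j\<le>n. real (n choose j) * ?g j) = (\<Sum>j\<le>Suc n. real (n choose j) * ?g j)"
      by simp
    also have "\<dots> = ?g 0 + (\<Sum>j\<le>n. real (n choose Suc j) * ?g (Suc j))"
      by (subst sum.atMost_Suc_shift) simp
    finally show ?thesis .
  qed
  have "(\<Sum>j\<le>Suc n. real (Suc n choose j) * ?g j)
      = ?g 0 + (\<Sum>j\<le>n. real (n choose Suc j) * ?g (Suc j)) + (\<Sum>j\<le>n. real (n choose j) * ?g (Suc j))"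
    by (subst sum.atMost_Suc_shift) (simp add: sum.distrib algebra_simps)
  also have "\<dots> = (\<Sum>j\<le>n. real (n choose j) * ?g j) + (\<Sum>j\<le>n. real (n choose j) * ?g (Suc j))"
    using 3 by simp
  finally have 4: "(\<Sum>j\<le>Suc n. real (Suc n choose j) * ?g j)
     = (\<Sum>j\<le>n. real (n choose j) * ?g j) + (\<Sum>j\<le>n. real (n choose j) * ?g (Suc j))" .
  have "(\<Sum>j\<le>Suc n. real (Suc n choose j) / 2 ^ Suc n * ?g j)
     = (\<Sum>j\<le>Suc n. real (Suc n choose j) * ?g j) / 2 ^ Suc n"
    by (simp only: sum_divide_distrib times_divide_eq_left)
  also have "\<dots> = coin d (Suc n) F c"
    unfolding 4 coin.simps 1 2 by (simp add: sum_divide_distrib add_divide_distrib field_simps)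
  finally show ?case by simp
qed simp

text \<open>\<open>None\<close> stands for a fair coin between the letters \<open>u\<close> and \<open>v\<close>, split off with weight \<open>m\<close> from each.\<close>

definition mix_weight :: "('a \<Rightarrow> real) \<Rightarrow> 'a \<Rightarrow> 'a \<Rightarrow> real \<Rightarrow> 'a option \<Rightarrow> real" where
  "mix_weight p u v m z = (case z of None \<Rightarrow> 2 * m
     | Some a \<Rightarrow> p a - (if a = u then m else 0) - (if a = v then m else 0))"

text \<open>Placing the coin at the midpoint puts its two outcomes at distance
  \<open>d = (h v - h u) / 2\<close> on either side and keeps the mean of \<open>h\<close> unchanged
  (\<open>mean_mix_value\<close>).\<close>

definition mix_value :: "('a \<Rightarrow> real) \<Rightarrow> 'a \<Rightarrow> 'a \<Rightarrow> 'a option \<Rightarrow> real" where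
  "mix_value h u v z = (case z of None \<Rightarrow> (h u + h v) / 2 | Some a \<Rightarrow> h a)"

lemma mix_value_simps [simp]:
  "mix_value h u v None = (h u + h v) / 2" "mix_value h u v (Some a) = h a"
  by (simp_all add: mix_value_def)

lemma sum_UNIV_option:
  "(\<Sum>z\<in>UNIV. f z) = f None + (\<Sum>a\<in>UNIV. f (Some a))" for f :: "'a::finite option \<Rightarrow> real"
  by (simp add: UNIV_option_conv sum.reindex)

lemma mix_sum:
  fixes p :: "'a::finite \<Rightarrow> real"
  shows "(\<Sum>a\<in>UNIV. p a * g (h a))
    = (\<Sum>a\<in>UNIV. mix_weight p u v m (Some a) * g (h a)) + m * (g (h u) + g (h v))"
proof -
  have "(\<Sum>a\<in>UNIV. mix_weight p u v m (Some a) * g (h a))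
     = (\<Sum>a\<in>UNIV. p a * g (h a) - (if a = u then m * g (h u) else 0) - (if a = v then m * g (h v) else 0))"
    by (intro sum.cong) (auto simp: mix_weight_def algebra_simps)
  also have "\<dots> = (\<Sum>a\<in>UNIV. p a * g (h a)) - m * g (h u) - m * g (h v)"
    by (simp add: sum_subtractf)
  finally show ?thesis by (simp add: algebra_simps)
qed

text \<open>Conditioning on everything except the outcomes of the coins: given \<open>zs\<close>,
  the sum is the walk of \<open>coin\<close> started at the value of \<open>zs\<close>, with one
  step per \<open>None\<close>. The offset \<open>s\<close> lets the induction move the first letter
  into the starting point.\<close>

lemma mix_identity:
  fixes p :: "'a::finite \<Rightarrow> real"
  assumes d: "d = (h v - h u) / 2"
  shows "wsum p N (\<lambda>xs. F (s + sum_list (map h xs))) =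
    wsum (mix_weight p u v m) N
      (\<lambda>zs. coin d (count_list zs None) F (s + sum_list (map (mix_value h u v) zs)))"
proof (induction N arbitrary: s)
  case (Suc N)
  let ?r = "mix_weight p u v m" and ?h = "mix_value h u v"
  let ?A = "\<lambda>t. wsum ?r N (\<lambda>zs. coin d (count_list zs None) F (s + t + sum_list (map ?h zs)))"
  have "wsum p (Suc N) (\<lambda>xs. F (s + sum_list (map h xs)))
     = (\<Sum>a\<in>UNIV. p a * wsum p N (\<lambda>xs. F ((s + h a) + sum_list (map h xs))))"
    by (simp add: wsum_Suc add.assoc)
  also have "\<dots> = (\<Sum>a\<in>UNIV. p a * ?A (h a))"
    using Suc by simp
  also have "\<dots> = (\<Sum>a\<in>UNIV. ?r (Some a) * ?A (h a)) + m * (?A (h u) + ?A (h v))"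
    by (rule mix_sum)
  also have "m * (?A (h u) + ?A (h v)) = ?r None * wsum ?r N (\<lambda>zs.
      coin d (Suc (count_list zs None)) F (s + ?h None + sum_list (map ?h zs)))"
  proof -
    have e: "s + (h u + h v) / 2 + t + d = s + h v + t" "s + (h u + h v) / 2 + t - d = s + h u + t" for t
      by (auto simp: d field_simps)
    have "wsum ?r N (\<lambda>zs. coin d (Suc (count_list zs None)) F (s + ?h None + sum_list (map ?h zs)))
        = wsum ?r N (\<lambda>zs. (1/2) * (coin d (count_list zs None) F (s + h v + sum_list (map ?h zs))
            + coin d (count_list zs None) F (s + h u + sum_list (map ?h zs))))"
      by (intro wsum_cong) (simp add: e)
    then show ?thesis
      by (simp only: wsum_cmult wsum_add) (simp add: mix_weight_def)
  qed
  finally show ?case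
    by (simp add: wsum_Suc sum_UNIV_option add.assoc del: coin.simps)
qed simp

section \<open>Binomial probabilities\<close>

lemma central_binomial_Suc:
  "real (2 * Suc m choose Suc m) / 4 ^ Suc m
     = real (2 * m choose m) / 4 ^ m * ((2 * real m + 1) / (2 * real m + 2))"
proof -
  have 1: "Suc m * (2 * Suc m choose Suc m) = (2 * m + 2) * (2 * m + 1 choose m)"
    using Suc_times_binomial[of m "2 * m + 1"] by simp
  have "(2 * m + 1 choose m) = (2 * m + 1 choose Suc m)"
    using binomial_symmetric[of m "2 * m + 1"] by simp
  then have 2: "Suc m * (2 * m + 1 choose m) = (2 * m + 1) * (2 * m choose m)"
    using Suc_times_binomial[of m "2 * m"] by simp
  have "real (Suc m) * (real (Suc m) * real (2 * Suc m choose Suc m))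
      = real (2 * m + 2) * (real (2 * m + 1) * real (2 * m choose m))"
    using 1 2 by (metis (no_types, opaque_lifting) mult.left_commute of_nat_mult)
  then have "real (Suc m) * (real (Suc m) * real (2 * Suc m choose Suc m))
      = real (Suc m) * (2 * ((2 * real m + 1) * real (2 * m choose m)))"
    by (simp add: algebra_simps del: binomial_Suc_Suc)
  then have "real (Suc m) * (real (2 * Suc m choose Suc m))
      = 2 * ((2 * real m + 1) * real (2 * m choose m))"
    by (subst (asm) mult_left_cancel) auto
  then have "real (2 * Suc m choose Suc m)
      = 2 * ((2 * real m + 1) * real (2 * m choose m)) / (real m + 1)"
    by (simp add: eq_divide_eq algebra_simps del: binomial_Suc_Suc)
  moreover have "2 * real m + 2 = 2 * (real m + 1)" by simp
  ultimately show ?thesis by (simp add: ac_simps del: binomial_Suc_Suc distrib_left_numeral)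
qed

text \<open>A Wallis-type argument: by \<open>central_binomial_Suc\<close>, the square of the
  normalised central coefficient times 2m+1 is nonincreasing in m. In
  \<open>central_binomial_lower\<close> the same square times m is nondecreasing and starts at
  1/4.\<close>

lemma central_binomial_upper: "(real (2 * m choose m) / 4 ^ m)\<^sup>2 * (2 * real m + 1) \<le> 1"
proof (induction m)
  case (Suc m)
  let ?b = "real (2 * m choose m) / 4 ^ m"
  have pos: "0 < (2 * real m + 2)\<^sup>2" by simp
  have "((2 * real m + 1) / (2 * real m + 2))\<^sup>2 * (2 * real m + 3) \<le> 2 * real m + 1"
    unfolding power_divide times_divide_eq_left
    by (subst pos_divide_le_eq[OF pos]) (simp add: power2_eq_square algebra_simps)
  then have "?b\<^sup>2 * (((2 * real m + 1) / (2 * real m + 2))\<^sup>2 * (2 * real m + 3)) \<le> ?b\<^sup>2 * (2 * real m + 1)"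
    by (intro mult_left_mono) auto
  with Suc have "?b\<^sup>2 * (((2 * real m + 1) / (2 * real m + 2))\<^sup>2 * (2 * real m + 3)) \<le> 1"
    by linarith
  then show ?case
    unfolding central_binomial_Suc power_mult_distrib by (simp add: mult.assoc add.commute)
qed simp

lemma central_binomial_lower:
  assumes "m \<ge> 1"
  shows "1 / 4 \<le> (real (2 * m choose m) / 4 ^ m)\<^sup>2 * real m"
  using assms
proof (induction m rule: dec_induct)
  case base
  then show ?case by (simp add: power2_eq_square)
next
  case (step m)
  let ?b = "real (2 * m choose m) / 4 ^ m"
  have pos: "0 < (2 * real m + 2)\<^sup>2" by simp
  have "real m \<le> ((2 * real m + 1) / (2 * real m + 2))\<^sup>2 * (real m + 1)"
    unfolding power_divide times_divide_eq_left
    by (subst pos_le_divide_eq[OF pos]) (simp add: power2_eq_square algebra_simps)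
  then have "?b\<^sup>2 * real m \<le> ?b\<^sup>2 * (((2 * real m + 1) / (2 * real m + 2))\<^sup>2 * (real m + 1))"
    by (intro mult_left_mono) auto
  with step.IH have "1 / 4 \<le> ?b\<^sup>2 * (((2 * real m + 1) / (2 * real m + 2))\<^sup>2 * (real m + 1))"
    by linarith
  then show ?case
    unfolding central_binomial_Suc power_mult_distrib by (simp add: mult.assoc add.commute)
qed

lemma central_binomial_le_sqrt: "real (2 * m choose m) / 4 ^ m \<le> 1 / sqrt (2 * real m + 1)"
proof (rule power2_le_imp_le)
  show "(real (2 * m choose m) / 4 ^ m)\<^sup>2 \<le> (1 / sqrt (2 * real m + 1))\<^sup>2"
    using central_binomial_upper[of m] by (simp add: power_divide pos_le_divide_eq del: of_nat_mult)
qed auto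

lemma central_binomial_ge_sqrt:
  assumes "m \<ge> 1"
  shows "1 / (2 * sqrt (real m)) \<le> real (2 * m choose m) / 4 ^ m"
proof (rule power2_le_imp_le)
  have "1 / 4 / real m \<le> (real (2 * m choose m) / 4 ^ m)\<^sup>2"
    using central_binomial_lower[OF assms] assms by (subst pos_divide_le_eq) auto
  then show "(1 / (2 * sqrt (real m)))\<^sup>2 \<le> (real (2 * m choose m) / 4 ^ m)\<^sup>2"
    by (simp add: power_divide power_mult_distrib)
qed auto

lemma binomial_upper: "real (n choose k) / 2 ^ n \<le> 1 / sqrt (real n + 1)"
proof -
  have "real (n choose k) / 2 ^ n \<le> real (n choose (n div 2)) / 2 ^ n"
    using binomial_maximum[of n k] by (intro divide_right_mono) auto
  also have "\<dots> \<le> 1 / sqrt (real n + 1)"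
  proof (cases "even n")
    case True
    then obtain m where "n = 2 * m" by blast
    then show ?thesis
      using central_binomial_le_sqrt[of m] by (simp add: power_mult)
  next
    case False
    then obtain m where n: "n = 2 * m + 1" using oddE by blast
    have p4: "(2::real) ^ (2 * m) = 4 ^ m" by (simp add: power_mult)
    \<comment> \<open>The middle coefficient of row 2m+1 occurs twice in Pascal's rule for the
      central one of row 2m+2, so the normalised values agree and the even bound applies.\<close>
    have "(2 * Suc m choose Suc m) = (2 * m + 1 choose m) + (2 * m + 1 choose Suc m)"
      by simp
    also have "(2 * m + 1 choose Suc m) = (2 * m + 1 choose m)"
      using binomial_symmetric[of m "2 * m + 1"] by simp
    finally have "real (2 * Suc m choose Suc m) = 2 * real (2 * m + 1 choose m)"
      by linarith
    then have "real (n choose (n div 2)) / 2 ^ n = real (2 * Suc m choose Suc m) / 4 ^ Suc m"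
      using n p4 by (simp add: field_simps del: binomial_Suc_Suc)
    also have "\<dots> \<le> 1 / sqrt (2 * real (Suc m) + 1)"
      by (rule central_binomial_le_sqrt)
    also have "\<dots> \<le> 1 / sqrt (real n + 1)"
      using n by (intro divide_left_mono) auto
    finally show ?thesis .
  qed
  finally show ?thesis .
qed

text \<open>Moving one place away from the centre multiplies the coefficient by (m-i)/(m+i+1), which
  is at least 1 - 2j/m for all i < j. For j of order sqrt m the accumulated loss is a constant
  factor.\<close>

lemma binomial_off_center:
  assumes "m \<ge> 1" "4 * j \<le> m" "i \<le> j"
  shows "real (2 * m choose m) * (1 - 2 * real j / real m) ^ i \<le> real (2 * m choose (m + i))"
  using assms(3)
proof (induction i)
  case (Suc i)
  let ?x = "1 - 2 * real j / real m"
  have x0: "0 \<le> ?x" using assms by (simp add: field_simps)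
  have "Suc (m + i) * (2 * m choose Suc (m + i)) = (2 * m choose (m + i)) * (2 * m - (m + i))"
    by (metis binomial_absorb_comp binomial_absorption mult.commute)
  then have "real (m + i + 1) * real (2 * m choose (m + Suc i)) = real (2 * m choose (m + i)) * real (m - i)"
    by (metis (no_types, lifting) Suc_eq_plus1 add_Suc_right diff_diff_left mult_2 of_nat_mult add_diff_cancel_left')
  then have eq: "real (2 * m choose (m + Suc i)) = real (2 * m choose (m + i)) * ((real m - real i) / (real m + real i + 1))"
    using Suc.prems assms by (simp add: field_simps of_nat_diff)
  have "?x \<le> (real m - real i) / (real m + real i + 1)"
  proof -
    have "(real m - 2 * real j) * (real m + real i + 1) \<le> (real m - real i) * real m"
    proof -
      have "real i + 1 \<le> real j" using Suc.prems by simp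
      then have "real m * (2 * real i + 1) \<le> real m * (2 * real j)"
        by (intro mult_left_mono) auto
      moreover have "0 \<le> 2 * real j * (real i + 1)" by simp
      moreover have "(real m - real i) * real m - (real m - 2 * real j) * (real m + real i + 1)
         = (real m * (2 * real j) - real m * (2 * real i + 1)) + 2 * real j * (real i + 1)"
        by (simp add: algebra_simps)
      ultimately show ?thesis by linarith
    qed
    moreover have "?x = (real m - 2 * real j) / real m"
      using assms by (simp add: field_simps)
    ultimately show ?thesis
      using assms by (simp add: frac_le_eq field_simps)
  qed
  then have "real (2 * m choose m) * ?x ^ i * ?x
      \<le> real (2 * m choose (m + i)) * ((real m - real i) / (real m + real i + 1))"
    using Suc x0 by (intro mult_mono) auto
  then show ?case unfolding eq by (simp only: power_Suc2 mult.assoc)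
qed simp

lemma exp_neg_le_one_minus:
  fixes x :: real
  assumes "0 \<le> x" "x \<le> 1 / 2"
  shows "exp (- 2 * x) \<le> 1 - x"
proof -
  have "(1 - x) * exp (2 * x) \<ge> (1 - x) * (1 + 2 * x)"
    using assms exp_ge_add_one_self[of "2 * x"] by (intro mult_left_mono) auto
  moreover have "(1 - x) * (1 + 2 * x) = 1 + x * (1 - 2 * x)" by (simp add: algebra_simps)
  moreover have "0 \<le> x * (1 - 2 * x)" using assms by (intro mult_nonneg_nonneg) auto
  ultimately have "1 \<le> (1 - x) * exp (2 * x)" by linarith
  then show ?thesis by (simp add: exp_minus field_simps)
qed

text \<open>Measured from the centre of row 2m, m = n div 2, the offset j is at most (D+1) sqrt m,
  so \<open>binomial_off_center\<close> loses a factor (1-x)^j \<ge> exp (- 2 x j) \<ge> exp (- 4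
  (D+1)^2) with x = 2j/m. The remaining 1/4 is 1/2 from the central coefficient and 1/2 for passing
  to an odd row. The size condition on \<open>n\<close> gives 16 (D+1)^2 \<le> m, hence 4j \<le>
  m.\<close>

lemma binomial_lower_upper_half:
  assumes D: "0 < D" and n: "32 * (D + 1)\<^sup>2 + 4 \<le> real n"
    and k: "n \<le> 2 * k" "real (2 * k - n) \<le> D * sqrt (real n)"
  shows "k \<le> n \<and> exp (- 4 * (D + 1)\<^sup>2) / 4 / sqrt (real n) \<le> real (n choose k) / 2 ^ n"
proof -
  define m where "m = n div 2"
  define j where "j = k - m"
  have n4: "real n \<ge> 4" using n by (smt (verit) zero_le_power2)
  then have m1: "m \<ge> 1" by (simp add: m_def)
  have kj: "k = m + j" using k by (auto simp: j_def m_def)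
  have mn: "real n \<le> 2 * real m + 1" "2 * real m \<le> real n" unfolding m_def by linarith+
  have "16 * (D + 1)\<^sup>2 \<le> real m" using n mn by linarith
  then have "sqrt (16 * (D + 1)\<^sup>2) \<le> sqrt (real m)" by simp
  then have sm: "4 * (D + 1) \<le> sqrt (real m)" using D by (simp add: real_sqrt_mult)
  have sq: "sqrt (real m) * sqrt (real m) = real m" by simp
  have "sqrt (real n) \<le> 2 * sqrt (real m)"
    using mn m1 by (intro real_le_lsqrt) (auto simp: power_mult_distrib)
  then have "D * sqrt (real n) \<le> D * (2 * sqrt (real m))" using D by (intro mult_left_mono) auto
  moreover have "2 * real j \<le> real (2 * k - n) + 1"
    using k mn unfolding kj by (simp add: of_nat_diff)
  moreover have "1 \<le> sqrt (real m)" using m1 by simp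
  ultimately have "2 * real j \<le> 2 * D * sqrt (real m) + sqrt (real m)"
    using k(2) by linarith
  then have j: "real j \<le> (D + 1) * sqrt (real m)"
  proof -
    define T where "T = D * sqrt (real m)"
    have "(D + 1) * sqrt (real m) = T + sqrt (real m)" by (simp add: T_def algebra_simps)
    moreover have "2 * real j \<le> 2 * T + sqrt (real m)"
      using \<open>2 * real j \<le> 2 * D * sqrt (real m) + sqrt (real m)\<close> by (simp add: T_def)
    ultimately show ?thesis using \<open>1 \<le> sqrt (real m)\<close> by linarith
  qed
  have "4 * real j \<le> (4 * (D + 1)) * sqrt (real m)"
    unfolding mult.assoc by (intro mult_left_mono j) simp
  also have "\<dots> \<le> sqrt (real m) * sqrt (real m)" using sm by (intro mult_right_mono) auto
  finally have j4: "4 * real j \<le> real m" by simp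
  then have j4': "4 * j \<le> m" by linarith
  have kn: "k \<le> n" using j4' m1 unfolding kj m_def by linarith
  define x where "x = 2 * real j / real m"
  have x: "0 \<le> x" "x \<le> 1 / 2" using j4 m1 by (auto simp: x_def field_simps)
  have "x * real j = 2 * (real j)\<^sup>2 / real m" by (simp add: x_def power2_eq_square)
  also have "\<dots> \<le> 2 * ((D + 1) * sqrt (real m))\<^sup>2 / real m"
    using j by (intro divide_right_mono mult_left_mono power_mono) auto
  also have "\<dots> = 2 * (D + 1)\<^sup>2" using m1 by (simp add: power_mult_distrib)
  finally have xj: "x * real j \<le> 2 * (D + 1)\<^sup>2" .
  have "exp (- 4 * (D + 1)\<^sup>2) \<le> exp (- 2 * x) ^ j"
    using xj by (simp add: exp_of_nat_mult[symmetric] mult.commute mult.left_commute)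
  also have "\<dots> \<le> (1 - x) ^ j" using exp_neg_le_one_minus[OF x] by (intro power_mono) auto
  finally have e: "exp (- 4 * (D + 1)\<^sup>2) \<le> (1 - x) ^ j" .
  have "1 / (2 * sqrt (real m)) * exp (- 4 * (D + 1)\<^sup>2) \<le> real (2 * m choose m) / 4 ^ m * (1 - x) ^ j"
    using e central_binomial_ge_sqrt[OF m1] by (intro mult_mono) auto
  also have "\<dots> \<le> real (2 * m choose (m + j)) / 4 ^ m"
    using binomial_off_center[OF m1 j4' order_refl] by (simp add: x_def divide_right_mono)
  finally have b: "1 / (2 * sqrt (real m)) * exp (- 4 * (D + 1)\<^sup>2) \<le> real (2 * m choose k) / 4 ^ m"
    by (simp add: kj)
  have c: "real (2 * m choose k) / 4 ^ m / 2 \<le> real (n choose k) / 2 ^ n"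
  proof (cases "even n")
    case True
    then have "n = 2 * m" by (simp add: m_def)
    then have "real (n choose k) / 2 ^ n = real (2 * m choose k) / 4 ^ m"
      by (simp add: power_mult)
    moreover have half: "y / 2 \<le> y" if "0 \<le> y" for y :: real using that by simp
    have "real (2 * m choose k) / 4 ^ m / 2 \<le> real (2 * m choose k) / 4 ^ m"
      by (rule half) simp
    ultimately show ?thesis by (simp only:)
  next
    case False
    then have nm: "n = Suc (2 * m)" by (simp add: m_def)
    have "(2 * m choose k) \<le> (n choose k)"
      unfolding nm by (cases k) auto
    then have "real (2 * m choose k) / (2 * 4 ^ m) \<le> real (n choose k) / (2 * 4 ^ m)"
      by (intro divide_right_mono) auto
    moreover have "(2::real) ^ n = 2 * 4 ^ m" unfolding nm by (simp add: power_mult)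
    ultimately show ?thesis by (simp add: mult.commute)
  qed
  have "exp (- 4 * (D + 1)\<^sup>2) / 4 / sqrt (real n) \<le> exp (- 4 * (D + 1)\<^sup>2) / 4 / sqrt (real m)"
    using m1 mn by (intro divide_left_mono) auto
  also have "\<dots> = 1 / (2 * sqrt (real m)) * exp (- 4 * (D + 1)\<^sup>2) / 2" by simp
  also have "\<dots> \<le> real (2 * m choose k) / 4 ^ m / 2" using b by (intro divide_right_mono) auto
  also note c
  finally show ?thesis using kn by simp
qed

text \<open>The lower half of the row is reflected onto the upper half. The index is an integer
  because it will be a ceiling; that it lies inside the row is part of the result.\<close>

lemma binomial_lower:
  assumes D: "0 < D" and n: "32 * (D + 1)\<^sup>2 + 4 \<le> real n"
    and k: "\<bar>2 * real_of_int k - real n\<bar> \<le> D * sqrt (real n)"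
  shows "0 \<le> k \<and> nat k \<le> n
    \<and> exp (- 4 * (D + 1)\<^sup>2) / 4 / sqrt (real n) \<le> real (n choose nat k) / 2 ^ n"
proof (cases "int n \<le> 2 * k")
  case True
  then have "n \<le> 2 * nat k" "real (2 * nat k - n) \<le> D * sqrt (real n)"
    using k by (auto simp: of_nat_diff)
  from binomial_lower_upper_half[OF D n this] True show ?thesis by auto
next
  case False
  let ?k = "nat (int n - k)"
  have "n \<le> 2 * ?k" "real (2 * ?k - n) \<le> D * sqrt (real n)"
    using False k by (auto simp: of_nat_diff)
  note * = binomial_lower_upper_half[OF D n this]
  then have "0 \<le> k" using False by auto
  then have kn: "nat k \<le> n" "?k = n - nat k" using False by auto
  with * \<open>0 \<le> k\<close> binomial_symmetric[OF kn(1)] show ?thesis by auto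
qed

section \<open>Concentration functions of i.i.d. sums\<close>

lemma sum_power_le_geometric:
  fixes r :: real
  assumes "0 \<le> r" "r < 1" "finite S"
  shows "(\<Sum>i\<in>S. r ^ i) \<le> 1 / (1 - r)"
proof -
  have "(\<Sum>i\<in>S. r ^ i) \<le> (\<Sum>i. r ^ i)"
    using assms by (intro sum_le_suminf) (auto intro: summable_geometric)
  then show ?thesis using assms by (simp add: suminf_geometric)
qed

text \<open>Split the points at the sign change of a + b j. On each side the distance from 0 grows
  by \<open>b\<close> per step, which leaves a geometric series; so the bound depends neither on the
  shift \<open>a\<close> nor on the index set.\<close>

lemma sum_exp_lattice_pos:
  fixes a b \<kappa> :: real
  assumes "\<kappa> > 0" "b > 0" "finite A"
  shows "(\<Sum>j\<in>A. exp (- \<kappa> * \<bar>a + b * real j\<bar>)) \<le> 2 / (1 - exp (- \<kappa> * b))"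
proof -
  let ?r = "exp (- \<kappa> * b)"
  have r: "0 \<le> ?r" "?r < 1" using assms by auto
  define j0 where "j0 = \<lfloor>- a / b\<rfloor>"
  have "of_int j0 \<le> - a / b" "- a / b < of_int j0 + 1" unfolding j0_def by linarith+
  then have j0: "b * of_int j0 \<le> - a" "- a \<le> b * (of_int j0 + 1)"
    using assms by (auto simp: field_simps)
  let ?A1 = "{j\<in>A. int j \<le> j0}" and ?A2 = "{j\<in>A. \<not> int j \<le> j0}"
  have pw: "exp (- \<kappa> * (b * real k)) = ?r ^ k" for k
    by (simp add: exp_of_nat_mult[symmetric] algebra_simps)
  have 1: "(\<Sum>j\<in>?A1. exp (- \<kappa> * \<bar>a + b * real j\<bar>)) \<le> 1 / (1 - ?r)"
  proof -
    have "(\<Sum>j\<in>?A1. exp (- \<kappa> * \<bar>a + b * real j\<bar>)) \<le> (\<Sum>j\<in>?A1. ?r ^ nat (j0 - int j))"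
    proof (intro sum_mono)
      fix j assume "j \<in> ?A1"
      then have "real (nat (j0 - int j)) = of_int j0 - real j" by simp
      then have "b * real (nat (j0 - int j)) = b * of_int j0 - b * real j" by (simp add: algebra_simps)
      then have "b * real (nat (j0 - int j)) \<le> \<bar>a + b * real j\<bar>" using j0 by linarith
      then have "exp (- \<kappa> * \<bar>a + b * real j\<bar>) \<le> exp (- \<kappa> * (b * real (nat (j0 - int j))))"
        using assms by simp
      then show "exp (- \<kappa> * \<bar>a + b * real j\<bar>) \<le> ?r ^ nat (j0 - int j)" unfolding pw .
    qed
    also have "\<dots> = (\<Sum>i\<in>(\<lambda>j. nat (j0 - int j)) ` ?A1. ?r ^ i)"
      by (subst sum.reindex) (auto simp: inj_on_def)
    also have "\<dots> \<le> 1 / (1 - ?r)" using r assms by (intro sum_power_le_geometric) auto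
    finally show ?thesis .
  qed
  have 2: "(\<Sum>j\<in>?A2. exp (- \<kappa> * \<bar>a + b * real j\<bar>)) \<le> 1 / (1 - ?r)"
  proof -
    have "(\<Sum>j\<in>?A2. exp (- \<kappa> * \<bar>a + b * real j\<bar>)) \<le> (\<Sum>j\<in>?A2. ?r ^ nat (int j - j0 - 1))"
    proof (intro sum_mono)
      fix j assume "j \<in> ?A2"
      then have "real (nat (int j - j0 - 1)) = real j - (of_int j0 + 1)" by simp
      then have "b * real (nat (int j - j0 - 1)) = b * real j - b * (of_int j0 + 1)"
        by (simp add: right_diff_distrib)
      then have "b * real (nat (int j - j0 - 1)) \<le> \<bar>a + b * real j\<bar>" using j0 by linarith
      then have "exp (- \<kappa> * \<bar>a + b * real j\<bar>) \<le> exp (- \<kappa> * (b * real (nat (int j - j0 - 1))))"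
        using assms by simp
      then show "exp (- \<kappa> * \<bar>a + b * real j\<bar>) \<le> ?r ^ nat (int j - j0 - 1)" unfolding pw .
    qed
    also have "\<dots> = (\<Sum>i\<in>(\<lambda>j. nat (int j - j0 - 1)) ` ?A2. ?r ^ i)"
      by (subst sum.reindex) (auto simp: inj_on_def)
    also have "\<dots> \<le> 1 / (1 - ?r)" using r assms by (intro sum_power_le_geometric) auto
    finally show ?thesis .
  qed
  have "(\<Sum>j\<in>A. exp (- \<kappa> * \<bar>a + b * real j\<bar>))
     = (\<Sum>j\<in>?A1 \<union> ?A2. exp (- \<kappa> * \<bar>a + b * real j\<bar>))"
    by (intro sum.cong) auto
  also have "\<dots> = (\<Sum>j\<in>?A1. exp (- \<kappa> * \<bar>a + b * real j\<bar>)) + (\<Sum>j\<in>?A2. exp (- \<kappa> * \<bar>a + b * real j\<bar>))"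
    using assms by (intro sum.union_disjoint) auto
  also have "\<dots> \<le> 2 / (1 - ?r)" using 1 2 by simp
  finally show ?thesis .
qed

lemma sum_exp_lattice:
  fixes a b \<kappa> :: real
  assumes "\<kappa> > 0" "b \<noteq> 0" "finite A"
  shows "(\<Sum>j\<in>A. exp (- \<kappa> * \<bar>a + b * real j\<bar>)) \<le> 2 / (1 - exp (- \<kappa> * \<bar>b\<bar>))"
proof (cases "b > 0")
  case True
  with sum_exp_lattice_pos[OF assms(1) True assms(3), of a] show ?thesis by simp
next
  case False
  then have "- b > 0" using assms by simp
  have "\<bar>- a + - b * real j\<bar> = \<bar>a + b * real j\<bar>" for j by simp
  with sum_exp_lattice_pos[OF assms(1) \<open>- b > 0\<close> assms(3), of "- a"] False show ?thesis
    by simp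
qed

text \<open>Each atom of the walk weighs at most 1 / sqrt (n+1), and the atoms lie on a lattice of
  spacing 2|d|, over which the kernel has a bounded sum whatever its centre
  \<open>t\<close>.\<close>

lemma coin_upper:
  assumes "\<kappa> > 0" "d \<noteq> 0"
  shows "coin d n (\<lambda>x. exp (- \<kappa> * \<bar>x - t\<bar>)) c
     \<le> 2 / (1 - exp (- \<kappa> * \<bar>2 * d\<bar>)) / sqrt (real n + 1)"
proof -
  have "coin d n (\<lambda>x. exp (- \<kappa> * \<bar>x - t\<bar>)) c
     = (\<Sum>j\<le>n. real (n choose j) / 2 ^ n * exp (- \<kappa> * \<bar>(c - d * real n - t) + (2 * d) * real j\<bar>))"
    unfolding coin_eq_sum
    by (intro sum.cong refl arg_cong2[where f="(*)"] arg_cong[where f=exp] arg_cong[where f=abs])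
      (simp add: algebra_simps)
  also have "\<dots> \<le> (\<Sum>j\<le>n. 1 / sqrt (real n + 1) * exp (- \<kappa> * \<bar>(c - d * real n - t) + (2 * d) * real j\<bar>))"
    using binomial_upper[of n] by (intro sum_mono mult_right_mono) auto
  also have "\<dots> = 1 / sqrt (real n + 1) * (\<Sum>j\<le>n. exp (- \<kappa> * \<bar>(c - d * real n - t) + (2 * d) * real j\<bar>))"
    by (simp add: sum_distrib_left)
  also have "\<dots> \<le> 1 / sqrt (real n + 1) * (2 / (1 - exp (- \<kappa> * \<bar>2 * d\<bar>)))"
    using assms by (intro mult_left_mono sum_exp_lattice) auto
  finally show ?thesis by (simp add: mult.commute)
qed

lemma coin_nonneg: "(\<And>x. 0 \<le> F x) \<Longrightarrow> 0 \<le> coin d n F c"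
  by (induction n arbitrary: c) auto

lemma sum_mix_weight:
  fixes p :: "'a::finite \<Rightarrow> real"
  assumes "(\<Sum>x\<in>UNIV. p x) = 1"
  shows "(\<Sum>z\<in>UNIV. mix_weight p u v m z) = 1"
  using mix_sum[of p "\<lambda>_. 1" undefined u v m] assms
  by (simp add: sum_UNIV_option mix_weight_def)

lemma mean_mix_value:
  fixes p :: "'a::finite \<Rightarrow> real"
  shows "(\<Sum>z\<in>UNIV. mix_weight p u v m z * mix_value h u v z) = (\<Sum>x\<in>UNIV. p x * h x)"
  using mix_sum[of p "\<lambda>x. x" h u v m]
  by (simp add: sum_UNIV_option) (simp add: mix_weight_def algebra_simps)

lemma mix_weight_nonneg:
  assumes "\<And>x. 0 \<le> p x" "m \<le> p u" "m \<le> p v" "u \<noteq> v" "0 \<le> m"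
  shows "0 \<le> mix_weight p u v m z"
  using assms by (cases z) (auto simp: mix_weight_def)

lemma count_list_eq_sum:
  "real (count_list zs a) = sum_list (map (\<lambda>z. if z = a then 1 else 0) zs)"
  by (induction zs) auto

lemma wsum_count_lower_tail:
  fixes r :: "'a::finite \<Rightarrow> real"
  assumes r: "(\<Sum>x\<in>UNIV. r x) = 1" "\<And>x. 0 \<le> r x" and "r a > 0" "N \<ge> 1"
  shows "wsum r N (\<lambda>zs. if real (count_list zs a) < r a / 2 * real N then 1 else 0)
    \<le> 4 / (r a)\<^sup>2 / real N"
proof -
  let ?g = "\<lambda>z. if z = a then 1 else (0::real)"
  have mu: "(\<Sum>z\<in>UNIV. r z * ?g z) = r a"
    by (simp add: if_distrib cong: if_cong)
  have ra1: "r a \<le> 1"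
    using member_le_sum[of a UNIV r] r by simp
  have "(\<Sum>z\<in>UNIV. r z * (?g z - r a)\<^sup>2) \<le> (\<Sum>z\<in>UNIV. r z * 1)"
    using ra1 \<open>r a > 0\<close> by (intro sum_mono mult_left_mono r) (auto simp: power_le_one_iff abs_square_le_1[symmetric])
  then have var: "(\<Sum>z\<in>UNIV. r z * (?g z - r a)\<^sup>2) \<le> 1" using r by simp
  have T: "0 < r a / 2 * real N" using assms by simp
  have "wsum r N (\<lambda>zs. if real (count_list zs a) < r a / 2 * real N then 1 else 0)
     \<le> wsum r N (\<lambda>zs. if r a / 2 * real N \<le> \<bar>sum_list (map ?g zs) - real N * r a\<bar> then 1 else 0)"
    using T by (intro wsum_mono r) (auto simp: count_list_eq_sum abs_if algebra_simps)
  also have "\<dots> \<le> real N * (\<Sum>z\<in>UNIV. r z * (?g z - r a)\<^sup>2) / (r a / 2 * real N)\<^sup>2"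
    using wsum_chebyshev[OF r T, where g = ?g and N = N] unfolding mu by simp
  also have "\<dots> \<le> real N * 1 / (r a / 2 * real N)\<^sup>2"
    using var by (intro divide_right_mono mult_left_mono) auto
  also have "\<dots> = 4 / (r a)\<^sup>2 / real N"
    using assms by (simp add: power2_eq_square field_simps)
  finally show ?thesis .
qed

text \<open>Typically the word contains at least m N coins, and then \<open>coin_upper\<close> gives
  the rate. Fewer coins have probability O(1/N) by Chebyshev, which is absorbed. The kernel plays
  the part of a smooth indicator of a bounded interval around \<open>t\<close>.\<close>

proposition concentration_upper:
  fixes p h :: "'a::finite \<Rightarrow> real"
  assumes p: "(\<Sum>x\<in>UNIV. p x) = 1" "\<And>x. 0 \<le> p x"
    and uv: "p u > 0" "p v > 0" "h u \<noteq> h v" and "\<kappa> > 0"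
  shows "\<exists>C>0. \<forall>N t. wsum p N (\<lambda>xs. exp (- \<kappa> * \<bar>sum_list (map h xs) - t\<bar>)) \<le> C / sqrt (real N + 1)"
proof -
  \<comment> \<open>The largest weight that can be taken from both letters; the coin then has
    probability 2m.\<close>
  define m where "m = min (p u) (p v)"
  have m: "0 < m" "m \<le> p u" "m \<le> p v" using uv by (auto simp: m_def)
  have "u \<noteq> v" using uv by auto
  define r where "r = mix_weight p u v m"
  have r: "(\<Sum>z\<in>UNIV. r z) = 1" "\<And>z. 0 \<le> r z"
    using m p \<open>u \<noteq> v\<close> by (auto simp: r_def sum_mix_weight intro: mix_weight_nonneg)
  have rN: "r None = 2 * m" by (simp add: r_def mix_weight_def)
  have m1: "m \<le> 1" using member_le_sum[of None UNIV r] r rN m by simp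
  define d where "d = (h v - h u) / 2"
  have "d \<noteq> 0" using uv by (simp add: d_def)
  define B where "B = 2 / (1 - exp (- \<kappa> * \<bar>2 * d\<bar>))"
  have B: "0 < B" using \<open>\<kappa> > 0\<close> \<open>d \<noteq> 0\<close> by (simp add: B_def)
  \<comment> \<open>The three summands pay for N = 0, for words with at least m N coins, and for the
    remaining words.\<close>
  define C where "C = B * (1 + 1 / sqrt m + 2 / m\<^sup>2)"
  have "wsum p N (\<lambda>xs. exp (- \<kappa> * \<bar>sum_list (map h xs) - t\<bar>)) \<le> C / sqrt (real N + 1)" for N t
  proof -
    let ?F = "\<lambda>x. exp (- \<kappa> * \<bar>x - t\<bar>)"
    let ?n = "\<lambda>zs. count_list zs None"
    let ?bad = "\<lambda>zs. if real (?n zs) < r None / 2 * real N then 1 else (0::real)"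
    have "wsum p N (\<lambda>xs. ?F (0 + sum_list (map h xs)))
        = wsum r N (\<lambda>zs. coin d (?n zs) ?F (0 + sum_list (map (mix_value h u v) zs)))"
      unfolding r_def by (rule mix_identity[OF d_def])
    also have "\<dots> \<le> wsum r N (\<lambda>zs. B / sqrt (m * real N + 1) + B * ?bad zs)"
    proof (intro wsum_mono r)
      fix zs :: "'a option list"
      have "coin d (?n zs) ?F (0 + sum_list (map (mix_value h u v) zs)) \<le> B / sqrt (real (?n zs) + 1)"
        unfolding B_def by (rule coin_upper[OF \<open>\<kappa> > 0\<close> \<open>d \<noteq> 0\<close>])
      also have "\<dots> \<le> B / sqrt (m * real N + 1) + B * ?bad zs"
      proof (cases "real (?n zs) < m * real N")
        case True
        have "B / sqrt (real (?n zs) + 1) \<le> B / 1" using B by (intro divide_left_mono) auto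
        moreover have "0 \<le> B / sqrt (m * real N + 1)" using B m by simp
        ultimately show ?thesis using True by (simp add: rN)
      next
        case False
        then have "B / sqrt (real (?n zs) + 1) \<le> B / sqrt (m * real N + 1)"
          using B m by (intro divide_left_mono) (auto intro!: mult_pos_pos add_nonneg_pos)
        then show ?thesis using False by (simp add: rN)
      qed
      finally show "coin d (?n zs) ?F (0 + sum_list (map (mix_value h u v) zs))
        \<le> B / sqrt (m * real N + 1) + B * ?bad zs" .
    qed
    also have "\<dots> = B / sqrt (m * real N + 1) + B * wsum r N ?bad"
      by (simp only: wsum_add wsum_cmult wsum_const[OF r(1)])
    also have "\<dots> \<le> C / sqrt (real N + 1)"
    proof (cases "N = 0")
      case True
      then show ?thesis using B m by (simp add: C_def algebra_simps)
    next
      case False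
      then have N: "N \<ge> 1" by simp
      have "wsum r N ?bad \<le> 4 / (r None)\<^sup>2 / real N"
        using m rN N by (intro wsum_count_lower_tail r) auto
      also have "\<dots> = 1 / m\<^sup>2 * (1 / real N)" using m by (simp add: rN power2_eq_square)
      also have "1 / real N \<le> 2 / (real N + 1)" using N by (simp add: field_simps)
      also have "2 / (real N + 1) \<le> 2 / sqrt (real N + 1)"
      proof (intro divide_left_mono)
        show "sqrt (real N + 1) \<le> real N + 1"
          by (intro real_le_lsqrt) (auto simp: power2_eq_square)
      qed (auto intro!: mult_pos_pos)
      finally have 1: "wsum r N ?bad \<le> 2 / m\<^sup>2 / sqrt (real N + 1)"
        using m by (simp add: mult_left_mono divide_right_mono)
      have "sqrt m * sqrt (real N + 1) \<le> sqrt (m * real N + 1)"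
        using m1 m by (simp add: real_sqrt_mult[symmetric] algebra_simps)
      then have 2: "1 / sqrt (m * real N + 1) \<le> 1 / sqrt m / sqrt (real N + 1)"
        using m by (simp add: divide_simps mult.commute add_pos_nonneg add_nonneg_pos)
      have "B / sqrt (m * real N + 1) + B * wsum r N ?bad
         = B * (1 / sqrt (m * real N + 1) + wsum r N ?bad)" by (simp add: algebra_simps)
      also have "\<dots> \<le> B * (1 / sqrt m / sqrt (real N + 1) + 2 / m\<^sup>2 / sqrt (real N + 1))"
        using 1 2 B by (intro mult_left_mono add_mono) auto
      also have "\<dots> = B * (1 / sqrt m + 2 / m\<^sup>2) / sqrt (real N + 1)"
        by (simp add: add_divide_distrib distrib_left)
      also have "\<dots> \<le> C / sqrt (real N + 1)"
        unfolding C_def using B by (intro divide_right_mono mult_left_mono) auto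
      finally show ?thesis .
    qed
    finally show ?thesis by simp
  qed
  moreover have "C > 0" using B m by (simp add: C_def add_pos_nonneg)
  ultimately show ?thesis by blast
qed

text \<open>The half-open window is exactly as long as the lattice spacing 2d, so it catches a
  lattice point wherever it lies; that single atom already has the required weight.\<close>

lemma coin_window_lower:
  assumes d: "d > 0" and D: "D > 0" and n: "32 * (D + 1)\<^sup>2 + 4 \<le> real n"
    and dist: "\<bar>a - c\<bar> / d + 2 \<le> D * sqrt (real n)"
  shows "exp (- 4 * (D + 1)\<^sup>2) / 4 / sqrt (real n)
    \<le> coin d n (\<lambda>x. if a \<le> x \<and> x < a + 2 * d then 1 else 0) c"
proof -
  let ?F = "\<lambda>x. if a \<le> x \<and> x < a + 2 * d then 1 else (0::real)"
  \<comment> \<open>The number of up-steps that leads to the first lattice point at or above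
    \<open>a\<close>; \<open>binomial_lower\<close> then shows that it lies between 0 and
    \<open>n\<close>.\<close>
  define k where "k = \<lceil>(a - c + d * real n) / (2 * d)\<rceil>"
  have "(a - c + d * real n) / (2 * d) \<le> of_int k" "of_int k - 1 < (a - c + d * real n) / (2 * d)"
    unfolding k_def by linarith+
  then have k: "a - c + d * real n \<le> of_int k * (2 * d)" "(of_int k - 1) * (2 * d) < a - c + d * real n"
    using d by (auto simp: pos_divide_le_eq pos_less_divide_eq)
  then have w: "a \<le> c + d * (2 * of_int k - real n)" "c + d * (2 * of_int k - real n) < a + 2 * d"
    by (auto simp: algebra_simps)
  have "d * \<bar>2 * of_int k - real n\<bar> = \<bar>d * (2 * of_int k - real n)\<bar>"
    using d by (simp add: abs_mult)
  also have "\<dots> \<le> \<bar>a - c\<bar> + 2 * d" using w d by linarith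
  finally have "\<bar>2 * of_int k - real n\<bar> \<le> \<bar>a - c\<bar> / d + 2"
    using d by (simp add: field_simps)
  with dist have kk: "\<bar>2 * real_of_int k - real n\<bar> \<le> D * sqrt (real n)" by linarith
  note b = binomial_lower[OF D n kk]
  then have k0: "0 \<le> k" "nat k \<le> n" by auto
  have "exp (- 4 * (D + 1)\<^sup>2) / 4 / sqrt (real n) \<le> real (n choose nat k) / 2 ^ n * ?F (c + d * (2 * real (nat k) - real n))"
    using b w k0 by simp
  also have "\<dots> \<le> coin d n ?F c"
    unfolding coin_eq_sum using k0
    by (intro member_le_sum[where f = "\<lambda>j. real (n choose j) / 2 ^ n * ?F (c + d * (2 * real j - real n))"]) auto
  finally show ?thesis .
qed

text \<open>Two events can spoil the bound: fewer than m N coins, or a starting point of the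
  conditional walk far from N \<mu>. Chebyshev gives each a probability of at most 1/4, so half of
  the mass keeps the bound of \<open>coin_window_lower\<close>.\<close>

lemma concentration_lower_aux:
  fixes p h :: "'a::finite \<Rightarrow> real"
  assumes p: "(\<Sum>x\<in>UNIV. p x) = 1" "\<And>x. 0 \<le> p x"
    and uv: "p u > 0" "p v > 0" "h u < h v" and D: "D > 0"
  defines "\<mu> \<equiv> \<Sum>x\<in>UNIV. p x * h x"
  shows "\<exists>c>0. \<exists>N0. \<forall>N\<ge>N0. \<forall>a. \<bar>a - real N * \<mu>\<bar> \<le> D * sqrt (real N) \<longrightarrow>
    c / sqrt (real N) \<le> wsum p N (\<lambda>xs. if a \<le> sum_list (map h xs) \<and> sum_list (map h xs) < a + (h v - h u) then 1 else 0)"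
proof -
  define m where "m = min (p u) (p v)"
  have m: "0 < m" "m \<le> p u" "m \<le> p v" using uv by (auto simp: m_def)
  have "u \<noteq> v" using uv by auto
  define r where "r = mix_weight p u v m"
  define g where "g = mix_value h u v"
  have r: "(\<Sum>z\<in>UNIV. r z) = 1" "\<And>z. 0 \<le> r z"
    using m p \<open>u \<noteq> v\<close> by (auto simp: r_def sum_mix_weight intro: mix_weight_nonneg)
  have rN: "r None = 2 * m" by (simp add: r_def mix_weight_def)
  have m1: "m \<le> 1" using member_le_sum[of None UNIV r] r rN m by simp
  have mu: "(\<Sum>z\<in>UNIV. r z * g z) = \<mu>"
    by (simp add: r_def g_def \<mu>_def mean_mix_value)
  define d where "d = (h v - h u) / 2"
  have d: "d > 0" using uv by (simp add: d_def)
  define V where "V = (\<Sum>z\<in>UNIV. r z * (g z - \<mu>)\<^sup>2)"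
  have V: "0 \<le> V" unfolding V_def by (intro sum_nonneg mult_nonneg_nonneg r) auto
  \<comment> \<open>Large enough that a deviation of L sqrt N has Chebyshev bound V / L^2 \<le>
    1/4.\<close>
  define L where "L = 2 * (V + 1)"
  have L: "0 < L" "V / L\<^sup>2 \<le> 1 / 4"
  proof -
    show "0 < L" using V by (simp add: L_def)
    have "V * 4 \<le> L\<^sup>2" using V by (simp add: L_def power2_eq_square algebra_simps)
    then show "V / L\<^sup>2 \<le> 1 / 4" using \<open>0 < L\<close> by (simp add: divide_simps)
  qed
  \<comment> \<open>The window may be (D+L) sqrt N away from the start of the walk. Dividing by the
    step \<open>d\<close> and by sqrt m expresses this through the square root of the number of
    coins; the 2 is the rounding allowance of \<open>coin_window_lower\<close>.\<close>
  define D2 where "D2 = ((D + L) / d + 2) / sqrt m"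
  have D2: "0 < D2" using D L d m by (simp add: D2_def add_pos_pos)
  define e where "e = exp (- 4 * (D2 + 1)\<^sup>2) / 4"
  have e: "e > 0" by (simp add: e_def)
  \<comment> \<open>The first bound makes too few coins improbable, the second makes m N coins
    enough for \<open>coin_window_lower\<close>.\<close>
  define N0 where "N0 = nat \<lceil>max (4 / m\<^sup>2) ((32 * (D2 + 1)\<^sup>2 + 4) / m)\<rceil> + 1"
  have "e / 2 / sqrt (real N) \<le> wsum p N (\<lambda>xs. if a \<le> sum_list (map h xs) \<and> sum_list (map h xs) < a + (h v - h u) then 1 else 0)"
    if N: "N \<ge> N0" and a: "\<bar>a - real N * \<mu>\<bar> \<le> D * sqrt (real N)" for N a
  proof -
    have N1: "N \<ge> 1" using N by (simp add: N0_def)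
    have "max (4 / m\<^sup>2) ((32 * (D2 + 1)\<^sup>2 + 4) / m) \<le> real N"
      using N unfolding N0_def by linarith
    then have N2: "4 / m\<^sup>2 \<le> real N" "(32 * (D2 + 1)\<^sup>2 + 4) / m \<le> real N" by auto
    then have N3: "32 * (D2 + 1)\<^sup>2 + 4 \<le> m * real N" using m by (simp add: field_simps)
    have N4: "1 / m\<^sup>2 / real N \<le> 1 / 4" using N2(1) m N1 by (simp add: field_simps)
    let ?F = "\<lambda>x. if a \<le> x \<and> x < a + 2 * d then 1 else (0::real)"
    let ?n = "\<lambda>zs. count_list zs None"
    let ?bad1 = "\<lambda>zs. if real (?n zs) < r None / 2 * real N then 1 else (0::real)"
    let ?bad2 = "\<lambda>zs. if L * sqrt (real N) \<le> \<bar>sum_list (map g zs) - real N * \<mu>\<bar> then 1 else (0::real)"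
    have "wsum r N ?bad1 \<le> 4 / (r None)\<^sup>2 / real N"
      using m rN N1 by (intro wsum_count_lower_tail r) auto
    then have b1: "wsum r N ?bad1 \<le> 1 / 4"
      using N4 m by (simp add: rN power2_eq_square)
    have "wsum r N ?bad2 \<le> real N * V / (L * sqrt (real N))\<^sup>2"
      unfolding V_def mu[symmetric] using L N1 by (intro wsum_chebyshev r) auto
    also have "\<dots> = V / L\<^sup>2" using N1 by (simp add: power_mult_distrib)
    finally have b2: "wsum r N ?bad2 \<le> 1 / 4" using L by linarith
    have pt: "e / sqrt (real N) + (- (e / sqrt (real N)) * ?bad1 zs + - (e / sqrt (real N)) * ?bad2 zs)
        \<le> coin d (?n zs) ?F (0 + sum_list (map g zs))" if len: "length zs = N" for zs
    proof (cases "real (?n zs) < m * real N \<or> L * sqrt (real N) \<le> \<bar>sum_list (map g zs) - real N * \<mu>\<bar>")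
      case True
      have "0 \<le> coin d (?n zs) ?F (0 + sum_list (map g zs))" by (intro coin_nonneg) auto
      moreover have "0 \<le> e / sqrt (real N)" using e by simp
      ultimately show ?thesis using True by (auto simp: rN)
    next
      case False
      let ?k = "real (?n zs)" and ?c = "sum_list (map g zs)"
      have k: "m * real N \<le> ?k" and c: "\<bar>?c - real N * \<mu>\<bar> \<le> L * sqrt (real N)" using False by auto
      have kN: "?k \<le> real N" using count_le_length[of zs None] len by simp
      have k0: "0 < ?k" using k m N1 by (smt (verit) mult_pos_pos of_nat_0_less_iff of_nat_le_0_iff not_one_le_zero)
      have "sqrt m * sqrt (real N) \<le> sqrt ?k" using k by (simp add: real_sqrt_mult[symmetric])
      then have sN: "sqrt (real N) \<le> sqrt ?k / sqrt m" using m by (simp add: field_simps)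
      have "\<bar>a - ?c\<bar> \<le> (D + L) * sqrt (real N)" using a c by (simp add: distrib_right)
      then have "\<bar>a - ?c\<bar> / d \<le> (D + L) / d * sqrt (real N)" using d by (simp add: divide_right_mono)
      moreover have "2 * 1 \<le> 2 * sqrt (real N)" using N1 by simp
      ultimately have "\<bar>a - ?c\<bar> / d + 2 \<le> ((D + L) / d + 2) * sqrt (real N)"
        unfolding distrib_right by linarith
      also have "\<dots> \<le> ((D + L) / d + 2) * (sqrt ?k / sqrt m)"
        using sN D L d by (intro mult_left_mono) auto
      finally have dist: "\<bar>a - ?c\<bar> / d + 2 \<le> D2 * sqrt ?k" by (simp add: D2_def)
      have "32 * (D2 + 1)\<^sup>2 + 4 \<le> ?k" using N3 k by linarith
      note coin_window_lower[OF d D2 this dist]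
      moreover have "e / sqrt (real N) \<le> e / sqrt ?k"
        using kN k0 e by (intro divide_left_mono) auto
      ultimately show ?thesis using False by (simp add: rN e_def)
    qed
    have "e / 2 / sqrt (real N) = e / sqrt (real N) + (- (e / sqrt (real N)) * (1 / 4) + - (e / sqrt (real N)) * (1 / 4))"
      by (simp add: field_simps)
    also have "\<dots> \<le> e / sqrt (real N) + (- (e / sqrt (real N)) * wsum r N ?bad1 + - (e / sqrt (real N)) * wsum r N ?bad2)"
      using b1 b2 e by (intro add_mono order_refl mult_left_mono_neg) auto
    also have "\<dots> = wsum r N (\<lambda>zs. e / sqrt (real N) + (- (e / sqrt (real N)) * ?bad1 zs + - (e / sqrt (real N)) * ?bad2 zs))"
      by (simp only: wsum_add wsum_cmult wsum_const[OF r(1)])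
    also have "\<dots> \<le> wsum r N (\<lambda>zs. coin d (?n zs) ?F (0 + sum_list (map g zs)))"
      by (intro wsum_mono r pt)
    also have "\<dots> = wsum p N (\<lambda>xs. ?F (0 + sum_list (map h xs)))"
      unfolding r_def g_def by (rule mix_identity[OF d_def, symmetric])
    also have "2 * d = h v - h u" by (simp add: d_def)
    finally show ?thesis by (simp only: add_0)
  qed
  moreover have "e / 2 > 0" using e by simp
  ultimately show ?thesis by blast
qed

proposition concentration_lower:
  fixes p h :: "'a::finite \<Rightarrow> real"
  assumes p: "(\<Sum>x\<in>UNIV. p x) = 1" "\<And>x. 0 \<le> p x"
    and uv: "p u > 0" "p v > 0" "h u \<noteq> h v" and D: "D > 0"
  shows "\<exists>c>0. \<exists>N0. \<forall>N\<ge>N0. \<forall>a. \<bar>a - real N * (\<Sum>x\<in>UNIV. p x * h x)\<bar> \<le> D * sqrt (real N) \<longrightarrow>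
    c / sqrt (real N) \<le> wsum p N (\<lambda>xs. if a \<le> sum_list (map h xs) \<and> sum_list (map h xs) < a + \<bar>h v - h u\<bar> then 1 else 0)"
proof (cases "h u < h v")
  case True
  with concentration_lower_aux[OF p uv(1,2) True D] show ?thesis by simp
next
  case False
  then have "h v < h u" using uv by simp
  with concentration_lower_aux[OF p uv(2,1) this D] show ?thesis by simp
qed

section \<open>Tilted channels and the error exponents\<close>

text \<open>This is ln t \<le> t - 1 in the form whose sum over all letters yields nonnegativity of
  divergence; the third condition is absolute continuity.\<close>

lemma mult_ln_ratio_ge:
  fixes a b :: real
  assumes "0 \<le> a" "0 \<le> b" "b = 0 \<Longrightarrow> a = 0"
  shows "a - b \<le> a * ln (a / b)"
proof (cases "a = 0")
  case False
  then have a: "0 < a" "0 < b" using assms by (auto simp: less_le)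
  then have "ln (b / a) \<le> b / a - 1" by (intro ln_le_minus_one) auto
  then have "a * (1 - b / a) \<le> a * ln (a / b)"
    using a by (intro mult_left_mono) (auto simp: ln_div)
  then show ?thesis using a by (simp add: right_diff_distrib)
qed (use assms in auto)

lemma mult_ln_ratio_gt:
  fixes a b :: real
  assumes "0 < a" "0 < b" "a \<noteq> b"
  shows "a - b < a * ln (a / b)"
proof -
  have "ln (b / a) < b / a - 1"
    using assms ln_eq_minus_one[of "b / a"] ln_le_minus_one[of "b / a"] by fastforce
  then have "a * (1 - b / a) < a * ln (a / b)"
    using assms by (intro mult_strict_left_mono) (auto simp: ln_div)
  then show ?thesis using assms by (simp add: right_diff_distrib)
qed

section \<open>Tilting a symmetric channel\<close>

locale nonsingular_symmetric_channel =
  fixes W :: "'x::finite \<Rightarrow> 'y::finite \<Rightarrow> real"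
  assumes channel: "is_channel W"
    and symmetric: "gallager_symmetric W"
    and nonsingular: "\<not> singular_channel W"
begin

definition \<alpha> :: "real \<Rightarrow> 'y \<Rightarrow> real" where
  "\<alpha> \<rho> y = (\<Sum>x\<in>UNIV. W x y powr (1 / (1 + \<rho>))) / real CARD('x)"

definition Z :: "real \<Rightarrow> real" where
  "Z \<rho> = (\<Sum>y\<in>UNIV. \<alpha> \<rho> y powr (1 + \<rho>))"

definition E0u :: "real \<Rightarrow> real" where
  "E0u \<rho> = - ln (Z \<rho>)"

definition V :: "real \<Rightarrow> 'x \<Rightarrow> 'y \<Rightarrow> real" where
  "V \<rho> x y = W x y powr (1 / (1 + \<rho>)) * \<alpha> \<rho> y powr \<rho> / Z \<rho>"

definition q :: "real \<Rightarrow> 'y \<Rightarrow> real" where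
  "q \<rho> y = \<alpha> \<rho> y powr (1 + \<rho>) / Z \<rho>"

text \<open>Where \<open>W\<close> is positive, ln (V / q) = ln W / (1+\<rho>) - ln \<alpha>, so
  this is the mutual information of the tilted channel (\<open>mutual_info_unif_V\<close>). In this
  form its continuity in \<rho> can be checked term by term.\<close>

definition J :: "real \<Rightarrow> real" where
  "J \<rho> = (\<Sum>x\<in>UNIV. \<Sum>y\<in>UNIV. V \<rho> x y * (1 / (1 + \<rho>) * ln (W x y) - ln (\<alpha> \<rho> y))) / real CARD('x)"

lemma W_nonneg: "0 \<le> W x y"
  using channel by (auto simp: is_channel_def is_dist_def)

lemma W_eq_0: "\<not> 0 < W x y \<Longrightarrow> W x y = 0"
  using W_nonneg[of x y] by linarith

lemma W_sum: "(\<Sum>y\<in>UNIV. W x y) = 1"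
  using channel by (auto simp: is_channel_def is_dist_def)

lemma \<alpha>_nonneg: "0 \<le> \<alpha> \<rho> y"
  unfolding \<alpha>_def by (intro divide_nonneg_nonneg sum_nonneg) auto

lemma \<alpha>_pos:
  assumes "W x y > 0"
  shows "0 < \<alpha> \<rho> y"
proof -
  have "0 < W x y powr (1 / (1 + \<rho>))" using assms by simp
  also have "\<dots> \<le> (\<Sum>x\<in>UNIV. W x y powr (1 / (1 + \<rho>)))"
    by (intro member_le_sum) auto
  finally show ?thesis unfolding \<alpha>_def by simp
qed

lemma \<alpha>_eq_0: "(\<And>x. W x y = 0) \<Longrightarrow> \<alpha> \<rho> y = 0"
  by (simp add: \<alpha>_def)

lemma \<alpha>_mult_powr: "\<alpha> \<rho> y powr \<rho> * \<alpha> \<rho> y = \<alpha> \<rho> y powr (1 + \<rho>)"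
  using \<alpha>_nonneg[of \<rho> y] by (cases "\<alpha> \<rho> y = 0") (auto simp: powr_add)

lemma ex_W_pos: "\<exists>y. W x y > 0"
proof (rule ccontr)
  assume "\<not> ?thesis"
  then have "W x y = 0" for y using W_nonneg[of x y] by (auto simp: not_less intro: antisym)
  then show False using W_sum[of x] by simp
qed

lemma Z_pos: "0 < Z \<rho>"
proof -
  obtain y where "W undefined y > 0" using ex_W_pos by blast
  then have "0 < \<alpha> \<rho> y powr (1 + \<rho>)" using \<alpha>_pos[of _ y \<rho>] by auto
  also have "\<dots> \<le> Z \<rho>" unfolding Z_def by (intro member_le_sum) auto
  finally show ?thesis .
qed

text \<open>Column permutations make \<open>\<alpha> \<rho>\<close> constant on each block of the
  partition, and row permutations rearrange the entries within a block. So the pairs of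
  \<open>\<alpha> \<rho> y\<close> and \<open>W x y\<close> form the same multiset in every row; all
  later uses of symmetry go through this.\<close>

lemma row_invariant:
  fixes G :: "real \<Rightarrow> real \<Rightarrow> real"
  shows "(\<Sum>y\<in>UNIV. G (\<alpha> \<rho> y) (W x y)) = (\<Sum>y\<in>UNIV. G (\<alpha> \<rho> y) (W x' y))"
proof -
  obtain P where P: "is_partition P"
    and row: "\<And>A x x'. A \<in> P \<Longrightarrow> \<exists>\<pi>. bij_betw \<pi> A A \<and> (\<forall>y\<in>A. W x' y = W x (\<pi> y))"
    and col: "\<And>A y y'. A \<in> P \<Longrightarrow> y \<in> A \<Longrightarrow> y' \<in> A \<Longrightarrow> \<exists>\<sigma>. bij \<sigma> \<and> (\<forall>x. W x y' = W (\<sigma> x) y)"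
    using symmetric unfolding gallager_symmetric_def by metis
  have const: "\<alpha> \<rho> y = \<alpha> \<rho> y'" if A: "A \<in> P" "y \<in> A" "y' \<in> A" for A y y'
  proof -
    obtain \<sigma> where "bij \<sigma>" "\<forall>x. W x y' = W (\<sigma> x) y" using col[OF A] by blast
    then show ?thesis
      using sum.reindex_bij_betw[of \<sigma> UNIV UNIV "\<lambda>x. W x y powr (1 / (1 + \<rho>))"]
      by (simp add: \<alpha>_def)
  qed
  have U: "(\<Sum>y\<in>UNIV. f y) = (\<Sum>A\<in>P. \<Sum>y\<in>A. f y)" for f :: "'y \<Rightarrow> real"
    using P sum.Union_disjoint[of P f] unfolding is_partition_def by auto
  have "(\<Sum>y\<in>A. G (\<alpha> \<rho> y) (W x y)) = (\<Sum>y\<in>A. G (\<alpha> \<rho> y) (W x' y))" if A: "A \<in> P" for A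
  proof -
    obtain \<pi> where \<pi>: "bij_betw \<pi> A A" "\<forall>y\<in>A. W x' y = W x (\<pi> y)" using row[OF A] by blast
    have "(\<Sum>y\<in>A. G (\<alpha> \<rho> y) (W x' y)) = (\<Sum>y\<in>A. G (\<alpha> \<rho> (\<pi> y)) (W x (\<pi> y)))"
    proof (intro sum.cong refl)
      fix y assume "y \<in> A"
      then have "\<pi> y \<in> A" using \<pi> by (auto simp: bij_betw_def)
      then show "G (\<alpha> \<rho> y) (W x' y) = G (\<alpha> \<rho> (\<pi> y)) (W x (\<pi> y))"
        using \<pi> const[OF A \<open>y \<in> A\<close>] \<open>y \<in> A\<close> by auto
    qed
    also have "\<dots> = (\<Sum>y\<in>A. G (\<alpha> \<rho> y) (W x y))"
      by (rule sum.reindex_bij_betw[OF \<pi>(1)])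
    finally show ?thesis by simp
  qed
  then show ?thesis unfolding U by (rule sum.cong[OF refl])
qed

lemma row_average:
  fixes G :: "real \<Rightarrow> real \<Rightarrow> real"
  shows "(\<Sum>y\<in>UNIV. G (\<alpha> \<rho> y) (W x y)) = (\<Sum>x\<in>UNIV. \<Sum>y\<in>UNIV. G (\<alpha> \<rho> y) (W x y)) / real CARD('x)"
proof -
  have "(\<Sum>x'\<in>UNIV. \<Sum>y\<in>UNIV. G (\<alpha> \<rho> y) (W x' y)) = (\<Sum>x'\<in>(UNIV::'x set). \<Sum>y\<in>UNIV. G (\<alpha> \<rho> y) (W x y))"
    by (intro sum.cong refl row_invariant)
  then show ?thesis by simp
qed

lemma V_nonneg: "0 \<le> V \<rho> x y"
  unfolding V_def using Z_pos[of \<rho>] by simp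

lemma V_pos_iff: "0 < V \<rho> x y \<longleftrightarrow> 0 < W x y"
  using Z_pos[of \<rho>] \<alpha>_pos[of x y \<rho>] W_nonneg[of x y]
  by (cases "W x y = 0") (auto simp: V_def)

lemma V_eq_0_iff: "V \<rho> x y = 0 \<longleftrightarrow> W x y = 0"
  using V_pos_iff[of \<rho> x y] V_nonneg[of \<rho> x y] W_nonneg[of x y] by linarith

text \<open>By symmetry every row sum equals the average over the rows, and averaging turns W powr
  (1/(1+\<rho>)) into \<open>\<alpha> \<rho> y\<close>. The common value makes
  \<open>V \<rho>\<close> stochastic and the uniform input optimal.\<close>

lemma tilted_row_sum: "(\<Sum>y\<in>UNIV. W x y powr (1 / (1 + \<rho>)) * \<alpha> \<rho> y powr \<rho>) = Z \<rho>"
proof -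
  have "(\<Sum>y\<in>UNIV. W x y powr (1 / (1 + \<rho>)) * \<alpha> \<rho> y powr \<rho>)
      = (\<Sum>x\<in>UNIV. \<Sum>y\<in>UNIV. W x y powr (1 / (1 + \<rho>)) * \<alpha> \<rho> y powr \<rho>) / real CARD('x)"
    by (rule row_average[where G = "\<lambda>a w. w powr (1 / (1 + \<rho>)) * a powr \<rho>"])
  also have "\<dots> = (\<Sum>y\<in>UNIV. \<alpha> \<rho> y powr \<rho> * \<alpha> \<rho> y)"
    by (subst sum.swap)
      (simp add: \<alpha>_def[of \<rho>] sum_divide_distrib sum_distrib_left sum_distrib_right mult.commute)
  also have "\<dots> = Z \<rho>" by (simp add: \<alpha>_mult_powr Z_def)
  finally show ?thesis .
qed

lemma V_sum: "(\<Sum>y\<in>UNIV. V \<rho> x y) = 1"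
  using tilted_row_sum[of x \<rho>] Z_pos[of \<rho>] by (simp add: V_def sum_divide_distrib[symmetric])

lemma V_channel: "is_channel (V \<rho>)"
  by (simp add: is_channel_def is_dist_def V_nonneg V_sum)

lemma q_nonneg: "0 \<le> q \<rho> y"
  unfolding q_def using Z_pos[of \<rho>] by simp

lemma q_pos: "W x y > 0 \<Longrightarrow> 0 < q \<rho> y"
  unfolding q_def using Z_pos[of \<rho>] \<alpha>_pos[of x y \<rho>] by simp

lemma q_sum: "(\<Sum>y\<in>UNIV. q \<rho> y) = 1"
  using Z_pos[of \<rho>] by (simp add: q_def sum_divide_distrib[symmetric] Z_def[symmetric])

definition unif :: "'x \<Rightarrow> real" where
  "unif x = 1 / real CARD('x)"

lemma is_dist_unif: "is_dist unif"
  by (simp add: is_dist_def unif_def)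

lemma out_dist_V: "out_dist unif (V \<rho>) y = q \<rho> y"
proof -
  have "out_dist unif (V \<rho>) y = \<alpha> \<rho> y powr \<rho> * ((\<Sum>x\<in>UNIV. W x y powr (1 / (1 + \<rho>))) / real CARD('x)) / Z \<rho>"
    by (simp add: out_dist_def unif_def V_def sum_distrib_left sum_divide_distrib field_simps)
  also have "\<dots> = \<alpha> \<rho> y powr \<rho> * \<alpha> \<rho> y / Z \<rho>" by (simp add: \<alpha>_def)
  finally show ?thesis by (simp add: \<alpha>_mult_powr q_def)
qed

lemma ln_V:
  assumes "W x y > 0"
  shows "ln (V \<rho> x y) = 1 / (1 + \<rho>) * ln (W x y) + \<rho> * ln (\<alpha> \<rho> y) + E0u \<rho>"
  using assms Z_pos[of \<rho>] \<alpha>_pos[OF assms, of \<rho>]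
  by (simp add: V_def E0u_def ln_div ln_mult ln_powr)

lemma ln_q:
  assumes "W x y > 0"
  shows "ln (q \<rho> y) = (1 + \<rho>) * ln (\<alpha> \<rho> y) + E0u \<rho>"
  using assms Z_pos[of \<rho>] \<alpha>_pos[OF assms, of \<rho>]
  by (simp add: q_def E0u_def ln_div ln_powr)

lemma J_row: "(\<Sum>y\<in>UNIV. V \<rho> x y * (1 / (1 + \<rho>) * ln (W x y) - ln (\<alpha> \<rho> y))) = J \<rho>"
  unfolding J_def V_def
  by (rule row_average[where G = "\<lambda>a w. w powr (1 / (1 + \<rho>)) * a powr \<rho> / Z \<rho> * (1 / (1 + \<rho>) * ln w - ln a)"])

lemma div_q_row: "(\<Sum>y\<in>UNIV. V \<rho> x y * ln (V \<rho> x y / q \<rho> y)) = J \<rho>"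
  unfolding J_row[of \<rho> x, symmetric]
proof (intro sum.cong refl)
  fix y
  show "V \<rho> x y * ln (V \<rho> x y / q \<rho> y) = V \<rho> x y * (1 / (1 + \<rho>) * ln (W x y) - ln (\<alpha> \<rho> y))"
  proof (cases "W x y > 0")
    case True
    then have "0 < V \<rho> x y" "0 < q \<rho> y" by (simp_all add: V_pos_iff q_pos)
    then show ?thesis using True by (simp add: ln_div ln_V ln_q algebra_simps)
  next
    case False
    then have "V \<rho> x y = 0" using W_nonneg[of x y] by (simp add: V_eq_0_iff)
    then show ?thesis by simp
  qed
qed

text \<open>On the support, ln (V / W) = E0u - \<rho> ln (V / q), so the value follows from
  \<open>div_q_row\<close> in each row separately. This is why the divergence will not depend on the
  input law.\<close>

lemma div_W_row:
  assumes "\<rho> \<ge> 0"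
  shows "(\<Sum>y\<in>UNIV. V \<rho> x y * ln (V \<rho> x y / W x y)) = E0u \<rho> - \<rho> * J \<rho>"
proof -
  have "(\<Sum>y\<in>UNIV. V \<rho> x y * ln (V \<rho> x y / W x y))
     = (\<Sum>y\<in>UNIV. V \<rho> x y * E0u \<rho> - \<rho> * (V \<rho> x y * (1 / (1 + \<rho>) * ln (W x y) - ln (\<alpha> \<rho> y))))"
  proof (intro sum.cong refl)
    fix y
    show "V \<rho> x y * ln (V \<rho> x y / W x y)
      = V \<rho> x y * E0u \<rho> - \<rho> * (V \<rho> x y * (1 / (1 + \<rho>) * ln (W x y) - ln (\<alpha> \<rho> y)))"
    proof (cases "W x y > 0")
      case True
      then have "0 < V \<rho> x y" by (simp add: V_pos_iff)
      then have "ln (V \<rho> x y / W x y) = 1 / (1 + \<rho>) * ln (W x y) + \<rho> * ln (\<alpha> \<rho> y) + E0u \<rho> - ln (W x y)"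
        using True by (simp add: ln_div ln_V)
      also have "\<dots> = E0u \<rho> - \<rho> * (1 / (1 + \<rho>) * ln (W x y) - ln (\<alpha> \<rho> y))"
        using assms by (simp add: field_simps)
      finally have "V \<rho> x y * ln (V \<rho> x y / W x y)
        = V \<rho> x y * (E0u \<rho> - \<rho> * (1 / (1 + \<rho>) * ln (W x y) - ln (\<alpha> \<rho> y)))" by simp
      also have "v * (E0u \<rho> - \<rho> * t) = v * E0u \<rho> - \<rho> * (v * t)" for v t
        by (simp add: algebra_simps)
      finally show ?thesis .
    next
      case False
      then have "V \<rho> x y = 0" using W_nonneg[of x y] by (simp add: V_eq_0_iff)
      then show ?thesis by simp
    qed
  qed
  also have "\<dots> = E0u \<rho> - \<rho> * J \<rho>"
    by (simp only: sum_subtractf sum_distrib_left[symmetric] sum_distrib_right[symmetric] J_row V_sum mult_1)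
  finally show ?thesis .
qed

lemma mutual_info_eq:
  "mutual_info Q V' = (\<Sum>x\<in>UNIV. \<Sum>y\<in>UNIV. Q x * V' x y * ln (V' x y / out_dist Q V' y))"
  for Q :: "'x \<Rightarrow> real" and V' :: "'x \<Rightarrow> 'y \<Rightarrow> real"
  unfolding mutual_info_def by (intro sum.cong) auto

lemma mutual_info_unif_V: "mutual_info unif (V \<rho>) = J \<rho>"
proof -
  have "mutual_info unif (V \<rho>) = (\<Sum>x\<in>UNIV. unif x * (\<Sum>y\<in>UNIV. V \<rho> x y * ln (V \<rho> x y / q \<rho> y)))"
    by (simp add: mutual_info_eq out_dist_V sum_distrib_left mult.assoc)
  then show ?thesis by (simp add: div_q_row unif_def)
qed

text \<open>Since the divergence of each row from \<open>q \<rho>\<close> is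
  \<open>J \<rho>\<close>, the deficit J - I(Q;V) is the divergence of the output law of
  \<open>Q\<close> from \<open>q \<rho>\<close>.\<close>

lemma mutual_info_V_le:
  assumes Q: "is_dist Q"
  shows "mutual_info Q (V \<rho>) \<le> J \<rho>"
proof -
  let ?o = "out_dist Q (V \<rho>)"
  have Q0: "0 \<le> Q x" for x using Q by (simp add: is_dist_def)
  have Q1: "(\<Sum>x\<in>UNIV. Q x) = 1" using Q by (simp add: is_dist_def)
  have o0: "0 \<le> ?o y" for y
    unfolding out_dist_def by (intro sum_nonneg mult_nonneg_nonneg Q0 V_nonneg)
  have o1: "(\<Sum>y\<in>UNIV. ?o y) = 1"
    unfolding out_dist_def by (subst sum.swap) (simp add: sum_distrib_left[symmetric] V_sum Q1)
  have opos: "0 < ?o y" if "0 < Q x * V \<rho> x y" for x y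
  proof -
    have "Q x * V \<rho> x y \<le> ?o y" unfolding out_dist_def
      by (intro member_le_sum) (auto intro: mult_nonneg_nonneg Q0 V_nonneg)
    with that show ?thesis by linarith
  qed
  have oq: "?o y = 0" if "q \<rho> y = 0" for y
  proof -
    have "\<not> W x y > 0" for x using q_pos[of x y \<rho>] that by auto
    then have "V \<rho> x y = 0" for x by (simp add: V_eq_0_iff W_eq_0)
    then show ?thesis by (simp add: out_dist_def)
  qed
  have "J \<rho> - mutual_info Q (V \<rho>)
     = (\<Sum>x\<in>UNIV. Q x * (\<Sum>y\<in>UNIV. V \<rho> x y * ln (V \<rho> x y / q \<rho> y))) - mutual_info Q (V \<rho>)"
    by (simp add: div_q_row sum_distrib_right[symmetric] Q1)
  also have "\<dots> = (\<Sum>x\<in>UNIV. \<Sum>y\<in>UNIV. Q x * V \<rho> x y * ln (V \<rho> x y / q \<rho> y) - Q x * V \<rho> x y * ln (V \<rho> x y / ?o y))"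
    unfolding mutual_info_eq by (simp add: sum_subtractf sum_distrib_left mult.assoc)
  also have "\<dots> = (\<Sum>x\<in>UNIV. \<Sum>y\<in>UNIV. Q x * V \<rho> x y * ln (?o y / q \<rho> y))"
  proof (intro sum.cong refl)
    fix x y
    show "Q x * V \<rho> x y * ln (V \<rho> x y / q \<rho> y) - Q x * V \<rho> x y * ln (V \<rho> x y / ?o y)
       = Q x * V \<rho> x y * ln (?o y / q \<rho> y)"
    proof (cases "Q x * V \<rho> x y = 0")
      case False
      then have "0 < Q x * V \<rho> x y" using Q0[of x] V_nonneg[of \<rho> x y] by (simp add: less_le)
      moreover from False have "0 < V \<rho> x y" using V_nonneg[of \<rho> x y] by (auto simp: less_le)
      moreover from this have "0 < q \<rho> y" by (auto simp: V_pos_iff intro: q_pos)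
      ultimately show ?thesis using opos[of x y] by (simp add: ln_div algebra_simps)
    qed auto
  qed
  also have "\<dots> = (\<Sum>y\<in>UNIV. ?o y * ln (?o y / q \<rho> y))"
    by (subst sum.swap) (simp add: out_dist_def sum_distrib_right)
  also have "\<dots> \<ge> (\<Sum>y\<in>UNIV. ?o y - q \<rho> y)"
    by (intro sum_mono mult_ln_ratio_ge o0 q_nonneg oq)
  finally show ?thesis by (simp add: sum_subtractf o1 q_sum)
qed

text \<open>The excess over \<open>E0u \<rho>\<close> is \<open>D(V'\<parallel>V\<^sub>\<rho>|U)\<close> plus \<open>\<rho>\<close> times the data-processing deficit
  \<open>D(V'\<parallel>V\<^sub>\<rho>|U) - D(UV'\<parallel>q\<^sub>\<rho>)\<close>.\<close>

lemma divergence_gap: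
  assumes ch: "is_channel V'" and ac: "\<And>x y. W x y = 0 \<Longrightarrow> V' x y = 0" and "\<rho> \<ge> 0"
  shows "E0u \<rho> + (\<Sum>x\<in>UNIV. \<Sum>y\<in>UNIV. V' x y * ln (V' x y / V \<rho> x y)) / real CARD('x)
    \<le> (\<Sum>x\<in>UNIV. \<Sum>y\<in>UNIV. V' x y * ln (V' x y / W x y)) / real CARD('x) + \<rho> * mutual_info unif V'"
proof -
  let ?o = "out_dist unif V'"
  have V'0: "0 \<le> V' x y" for x y using ch by (simp add: is_channel_def is_dist_def)
  have V'1: "(\<Sum>y\<in>UNIV. V' x y) = 1" for x using ch by (simp add: is_channel_def is_dist_def)
  have o0: "0 \<le> ?o y" for y
    unfolding out_dist_def unif_def by (intro sum_nonneg mult_nonneg_nonneg V'0) auto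
  have o1: "(\<Sum>y\<in>UNIV. ?o y) = 1"
    unfolding out_dist_def by (subst sum.swap) (simp add: sum_divide_distrib[symmetric] V'1 unif_def)
  have opos: "0 < ?o y" if "0 < V' x y" for x y
  proof -
    have "0 < unif x * V' x y" using that by (simp add: unif_def)
    also have "\<dots> \<le> ?o y" unfolding out_dist_def
      by (intro member_le_sum) (auto simp: V'0 unif_def)
    finally show ?thesis .
  qed
  let ?d = "\<lambda>x y. V' x y * (ln (V' x y / V \<rho> x y) - ln (?o y / q \<rho> y))"
  have eq: "V' x y * ln (V' x y / W x y) + \<rho> * (V' x y * ln (V' x y / ?o y))
     = V' x y * E0u \<rho> + V' x y * ln (V' x y / V \<rho> x y) + \<rho> * ?d x y" for x y
  proof (cases "V' x y = 0")
    case False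
    then have v: "0 < V' x y" using V'0[of x y] by simp
    then have w: "0 < W x y" using ac[of x y] W_nonneg[of x y] by (cases "W x y = 0") auto
    have "ln (V' x y / W x y) + \<rho> * ln (V' x y / ?o y)
      = E0u \<rho> + ln (V' x y / V \<rho> x y) + \<rho> * (ln (V' x y / V \<rho> x y) - ln (?o y / q \<rho> y))"
    proof -
      have "(1 + \<rho>) * ln (V \<rho> x y) = ln (W x y) + \<rho> * ln (q \<rho> y) + E0u \<rho>"
        using \<open>\<rho> \<ge> 0\<close> unfolding ln_V[OF w] ln_q[OF w] by (simp add: field_simps)
      moreover have "0 < V \<rho> x y" "0 < q \<rho> y" using w by (simp_all add: V_pos_iff q_pos)
      ultimately show ?thesis using v w opos[OF v] by (simp add: ln_div algebra_simps)
    qed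
    then have "V' x y * (ln (V' x y / W x y) + \<rho> * ln (V' x y / ?o y))
      = V' x y * (E0u \<rho> + ln (V' x y / V \<rho> x y) + \<rho> * (ln (V' x y / V \<rho> x y) - ln (?o y / q \<rho> y)))"
      by simp
    then show ?thesis by (simp add: algebra_simps)
  qed auto
  \<comment> \<open>Compare termwise with V * o / q, the joint weight with output marginal
    \<open>o\<close> and the backward channel of \<open>V \<rho>\<close>. Its total mass is at most
    that of V', so the sum of \<open>?d\<close> is nonnegative: this is the data-processing
    inequality.\<close>
  have d: "V' x y - V \<rho> x y * (?o y / q \<rho> y) \<le> ?d x y" for x y
  proof (cases "V' x y = 0")
    case True
    then show ?thesis using V_nonneg[of \<rho> x y] o0[of y] q_nonneg[of \<rho> y] by simp
  next
    case False
    then have v: "0 < V' x y" using V'0[of x y] by simp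
    then have w: "0 < W x y" using ac[of x y] W_nonneg[of x y] by (cases "W x y = 0") auto
    then have p: "0 < V \<rho> x y" "0 < q \<rho> y" "0 < ?o y" using opos[OF v] by (simp_all add: V_pos_iff q_pos)
    then have "V' x y - V \<rho> x y * (?o y / q \<rho> y) \<le> V' x y * ln (V' x y / (V \<rho> x y * (?o y / q \<rho> y)))"
      using v by (intro mult_ln_ratio_ge) auto
    also have "ln (V' x y / (V \<rho> x y * (?o y / q \<rho> y))) = ln (V' x y / V \<rho> x y) - ln (?o y / q \<rho> y)"
      using p v by (simp add: ln_div ln_mult)
    finally show ?thesis .
  qed
  have col: "(\<Sum>x\<in>UNIV. V \<rho> x y) = real CARD('x) * q \<rho> y" for y
    using out_dist_V[of \<rho> y] by (simp add: out_dist_def unif_def sum_divide_distrib[symmetric] field_simps)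
  have "(\<Sum>x\<in>UNIV. \<Sum>y\<in>UNIV. V \<rho> x y * (?o y / q \<rho> y)) = (\<Sum>y\<in>UNIV. real CARD('x) * q \<rho> y * (?o y / q \<rho> y))"
    by (subst sum.swap) (simp only: sum_distrib_right[symmetric] col)
  also have "\<dots> \<le> (\<Sum>y\<in>UNIV. real CARD('x) * ?o y)"
    using o0 by (intro sum_mono) simp
  also have "\<dots> = real CARD('x)" by (simp add: sum_distrib_left[symmetric] o1)
  finally have "0 \<le> (\<Sum>x\<in>UNIV. \<Sum>y\<in>UNIV. V' x y - V \<rho> x y * (?o y / q \<rho> y))"
    by (simp add: sum_subtractf V'1)
  also have "\<dots> \<le> (\<Sum>x\<in>UNIV. \<Sum>y\<in>UNIV. ?d x y)"
    by (intro sum_mono d)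
  finally have d0: "0 \<le> (\<Sum>x\<in>UNIV. \<Sum>y\<in>UNIV. ?d x y)" .
  have mi: "mutual_info unif V' = (\<Sum>x\<in>UNIV. \<Sum>y\<in>UNIV. V' x y * ln (V' x y / ?o y)) / real CARD('x)"
    unfolding mutual_info_eq by (simp add: unif_def sum_divide_distrib)
  have "(\<Sum>x\<in>UNIV. \<Sum>y\<in>UNIV. V' x y * ln (V' x y / W x y)) + \<rho> * (\<Sum>x\<in>UNIV. \<Sum>y\<in>UNIV. V' x y * ln (V' x y / ?o y))
     = (\<Sum>x\<in>UNIV. \<Sum>y\<in>UNIV. V' x y * ln (V' x y / W x y) + \<rho> * (V' x y * ln (V' x y / ?o y)))"
    by (simp only: sum.distrib sum_distrib_left)
  also have "\<dots> = (\<Sum>x\<in>UNIV. \<Sum>y\<in>UNIV. V' x y * E0u \<rho> + V' x y * ln (V' x y / V \<rho> x y) + \<rho> * ?d x y)"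
    by (simp only: eq)
  also have "\<dots> = real CARD('x) * E0u \<rho> + (\<Sum>x\<in>UNIV. \<Sum>y\<in>UNIV. V' x y * ln (V' x y / V \<rho> x y))
      + \<rho> * (\<Sum>x\<in>UNIV. \<Sum>y\<in>UNIV. ?d x y)"
    by (simp only: sum.distrib sum_distrib_left[symmetric] sum_distrib_right[symmetric] V'1) simp
  finally have "real CARD('x) * E0u \<rho> + (\<Sum>x\<in>UNIV. \<Sum>y\<in>UNIV. V' x y * ln (V' x y / V \<rho> x y))
    \<le> (\<Sum>x\<in>UNIV. \<Sum>y\<in>UNIV. V' x y * ln (V' x y / W x y)) + \<rho> * (\<Sum>x\<in>UNIV. \<Sum>y\<in>UNIV. V' x y * ln (V' x y / ?o y))"
    using d0 \<open>\<rho> \<ge> 0\<close> by simp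
  then have "(real CARD('x) * E0u \<rho> + (\<Sum>x\<in>UNIV. \<Sum>y\<in>UNIV. V' x y * ln (V' x y / V \<rho> x y))) / real CARD('x)
    \<le> ((\<Sum>x\<in>UNIV. \<Sum>y\<in>UNIV. V' x y * ln (V' x y / W x y)) + \<rho> * (\<Sum>x\<in>UNIV. \<Sum>y\<in>UNIV. V' x y * ln (V' x y / ?o y))) / real CARD('x)"
    by (intro divide_right_mono) auto
  then show ?thesis unfolding mi by (simp add: add_divide_distrib)
qed

section \<open>Strict concavity from nonsingularity\<close>

lemma distinguishing_inputs:
  obtains x1 x2 y0 where "0 < W x1 y0" "0 < W x2 y0" "W x1 y0 \<noteq> W x2 y0"
proof -
  obtain x1 y0 x2 where *: "W x1 y0 * W x2 y0 > 0" "W x1 y0 \<noteq> W x2 y0"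
    using nonsingular unfolding singular_channel_def by blast
  then have "0 < W x1 y0" "0 < W x2 y0"
    using W_nonneg[of x1 y0] W_nonneg[of x2 y0] by (auto simp: zero_less_mult_iff)
  with * that show ?thesis by blast
qed

text \<open>In a column with two different positive entries, the \<open>\<alpha>\<close> term
  cancels from the difference of ln V at the two inputs, and what remains determines
  1/(1+\<rho>).\<close>

lemma V_distinct:
  assumes "\<rho> \<ge> 0" "\<rho>' \<ge> 0" "\<rho> \<noteq> \<rho>'"
  shows "\<exists>x y. 0 < W x y \<and> V \<rho> x y \<noteq> V \<rho>' x y"
proof (rule ccontr)
  assume *: "\<not> ?thesis"
  obtain x1 x2 y0 where x: "0 < W x1 y0" "0 < W x2 y0" "W x1 y0 \<noteq> W x2 y0"
    by (rule distinguishing_inputs)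
  then have "ln (V \<rho> x1 y0) = ln (V \<rho>' x1 y0)" "ln (V \<rho> x2 y0) = ln (V \<rho>' x2 y0)"
    using * by auto
  then have "1 / (1 + \<rho>) * (ln (W x1 y0) - ln (W x2 y0)) = 1 / (1 + \<rho>') * (ln (W x1 y0) - ln (W x2 y0))"
    using x by (simp add: ln_V algebra_simps)
  moreover have "ln (W x1 y0) - ln (W x2 y0) \<noteq> 0" using x by simp
  ultimately have "1 / (1 + \<rho>) = 1 / (1 + \<rho>')" by (metis mult_right_cancel)
  then show False using assms by (simp add: field_simps)
qed

text \<open>Put V' = \<open>V \<rho>'\<close> into \<open>divergence_gap\<close>: the right-hand
  side becomes the tangent value at \<rho>, and the excess on the left is the divergence of
  \<open>V \<rho>'\<close> from \<open>V \<rho>\<close>, positive because the two channels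
  differ.\<close>

lemma E0u_strict_supergradient:
  assumes "\<rho> \<ge> 0" "\<rho>' \<ge> 0" "\<rho> \<noteq> \<rho>'"
  shows "E0u \<rho> < E0u \<rho>' + (\<rho> - \<rho>') * J \<rho>'"
proof -
  have ch: "is_channel (V \<rho>')" by (rule V_channel)
  have ac: "W x y = 0 \<Longrightarrow> V \<rho>' x y = 0" for x y by (simp add: V_eq_0_iff)
  obtain x0 y0 where xy: "0 < W x0 y0" "V \<rho>' x0 y0 \<noteq> V \<rho> x0 y0"
    using V_distinct[OF assms] by metis
  have le: "V \<rho>' x y - V \<rho> x y \<le> V \<rho>' x y * ln (V \<rho>' x y / V \<rho> x y)" for x y
    by (intro mult_ln_ratio_ge V_nonneg) (simp add: V_eq_0_iff)
  have "0 = (\<Sum>x\<in>UNIV. \<Sum>y\<in>UNIV. V \<rho>' x y - V \<rho> x y)"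
    by (simp add: sum_subtractf V_sum)
  also have "\<dots> < (\<Sum>x\<in>UNIV. \<Sum>y\<in>UNIV. V \<rho>' x y * ln (V \<rho>' x y / V \<rho> x y))"
  proof (rule sum_strict_mono_ex1)
    have "(\<Sum>y\<in>UNIV. V \<rho>' x0 y - V \<rho> x0 y) < (\<Sum>y\<in>UNIV. V \<rho>' x0 y * ln (V \<rho>' x0 y / V \<rho> x0 y))"
    proof (rule sum_strict_mono_ex1)
      have "V \<rho>' x0 y0 - V \<rho> x0 y0 < V \<rho>' x0 y0 * ln (V \<rho>' x0 y0 / V \<rho> x0 y0)"
        using xy by (intro mult_ln_ratio_gt) (auto simp: V_pos_iff)
      then show "\<exists>y\<in>UNIV. V \<rho>' x0 y - V \<rho> x0 y < V \<rho>' x0 y * ln (V \<rho>' x0 y / V \<rho> x0 y)"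
        by blast
    qed (auto intro: le)
    then show "\<exists>x\<in>UNIV. (\<Sum>y\<in>UNIV. V \<rho>' x y - V \<rho> x y) < (\<Sum>y\<in>UNIV. V \<rho>' x y * ln (V \<rho>' x y / V \<rho> x y))"
      by blast
  qed (auto intro!: sum_mono le)
  finally have "0 < (\<Sum>x\<in>UNIV. \<Sum>y\<in>UNIV. V \<rho>' x y * ln (V \<rho>' x y / V \<rho> x y)) / real CARD('x)"
    by simp
  then have "E0u \<rho> < (\<Sum>x\<in>UNIV. \<Sum>y\<in>UNIV. V \<rho>' x y * ln (V \<rho>' x y / W x y)) / real CARD('x) + \<rho> * mutual_info unif (V \<rho>')"
    using divergence_gap[OF ch ac assms(1)] by linarith
  also have "\<dots> = E0u \<rho>' - \<rho>' * J \<rho>' + \<rho> * J \<rho>'"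
    using assms by (simp add: div_W_row mutual_info_unif_V)
  finally show ?thesis by (simp add: algebra_simps)
qed

lemma E0u_supergradient:
  assumes "\<rho> \<ge> 0" "\<rho>' \<ge> 0"
  shows "E0u \<rho> \<le> E0u \<rho>' + (\<rho> - \<rho>') * J \<rho>'"
  using E0u_strict_supergradient[OF assms] by (cases "\<rho> = \<rho>'") auto

lemma J_strict_antimono:
  assumes "0 \<le> \<rho>" "\<rho> < \<rho>'"
  shows "J \<rho>' < J \<rho>"
proof -
  have "E0u \<rho> < E0u \<rho>' + (\<rho> - \<rho>') * J \<rho>'" "E0u \<rho>' < E0u \<rho> + (\<rho>' - \<rho>) * J \<rho>"
    using assms by (auto intro: E0u_strict_supergradient)
  then have "0 < (\<rho>' - \<rho>) * (J \<rho> - J \<rho>')" by (simp add: algebra_simps)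
  then show ?thesis using assms by (simp add: zero_less_mult_iff)
qed

lemma J_nonneg: "0 \<le> J \<rho>"
proof -
  have "(\<Sum>y\<in>UNIV. V \<rho> undefined y - q \<rho> y) \<le> J \<rho>"
    unfolding div_q_row[of \<rho> undefined, symmetric]
    by (intro sum_mono mult_ln_ratio_ge V_nonneg q_nonneg) (use q_pos in \<open>force simp: V_eq_0_iff W_nonneg less_le\<close>)
  then show ?thesis by (simp add: sum_subtractf V_sum q_sum)
qed

lemma continuous_\<alpha>: "continuous_on {0..} (\<lambda>\<rho>. \<alpha> \<rho> y)"
proof -
  have "continuous_on {0..} (\<lambda>\<rho>. W x y powr (1 / (1 + \<rho>)))" for x
  proof (cases "W x y = 0")
    case False
    then show ?thesis by (intro continuous_intros) auto
  qed simp
  then show ?thesis unfolding \<alpha>_def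
    by (intro continuous_on_divide continuous_on_sum continuous_on_const) auto
qed

lemma continuous_\<alpha>_powr:
  assumes "continuous_on {0..} f"
  shows "continuous_on {0..} (\<lambda>\<rho>. \<alpha> \<rho> y powr f \<rho>)"
proof (cases "\<exists>x. W x y > 0")
  case True
  then have "\<alpha> \<rho> y \<noteq> 0" for \<rho> using \<alpha>_pos[of _ y \<rho>] by force
  then show ?thesis by (intro continuous_intros continuous_\<alpha> assms) auto
next
  case False
  then have "W x y = 0" for x using W_eq_0 by blast
  then have "\<alpha> \<rho> y = 0" for \<rho> by (rule \<alpha>_eq_0)
  then show ?thesis by simp
qed

lemma continuous_Z: "continuous_on {0..} Z"
  unfolding Z_def[abs_def] by (intro continuous_intros continuous_\<alpha>_powr)

lemma continuous_J: "continuous_on {0..} J"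
proof -
  have "continuous_on {0..} (\<lambda>\<rho>. V \<rho> x y * (1 / (1 + \<rho>) * ln (W x y) - ln (\<alpha> \<rho> y)))" for x y
  proof (cases "W x y = 0")
    case True
    then have "V \<rho> x y = 0" for \<rho> by (simp add: V_eq_0_iff)
    then show ?thesis by simp
  next
    case False
    then have "0 < W x y" using W_nonneg[of x y] by simp
    then have "\<alpha> \<rho> y \<noteq> 0" for \<rho> using \<alpha>_pos[of x y \<rho>] by force
    moreover have "Z \<rho> \<noteq> 0" for \<rho> using Z_pos[of \<rho>] by simp
    ultimately show ?thesis
      unfolding V_def using False
      by (intro continuous_intros continuous_\<alpha>_powr continuous_\<alpha> continuous_Z) auto
  qed
  then show ?thesis unfolding J_def[abs_def]
    by (intro continuous_on_divide continuous_on_sum continuous_on_const) auto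
qed

lemma Z_0: "Z 0 = 1"
proof -
  have "Z 0 = (\<Sum>y\<in>UNIV. \<alpha> 0 y)" by (simp add: Z_def \<alpha>_nonneg)
  also have "\<dots> = (\<Sum>x\<in>UNIV. \<Sum>y\<in>UNIV. W x y) / real CARD('x)"
    by (subst sum.swap) (simp add: \<alpha>_def W_nonneg sum_divide_distrib)
  finally show ?thesis by (simp add: W_sum)
qed

lemma V_0: "V 0 = W"
proof -
  have "V 0 x y = W x y" for x y
  proof (cases "W x y = 0")
    case False
    then have "0 < \<alpha> 0 y" using W_nonneg[of x y] by (intro \<alpha>_pos[of x]) auto
    then show ?thesis using W_nonneg[of x y] by (simp add: V_def Z_0)
  qed (simp add: V_eq_0_iff)
  then show ?thesis by blast
qed

lemma J_0: "J 0 = capacity W"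
proof -
  have "mutual_info Q W \<le> J 0" if "is_dist Q" for Q
    using mutual_info_V_le[OF that, of 0] by (simp add: V_0)
  moreover have "mutual_info unif W = J 0" using mutual_info_unif_V[of 0] by (simp add: V_0)
  ultimately have "(SUP Q\<in>{Q. is_dist Q}. mutual_info Q W) = J 0"
    using is_dist_unif by (intro cSup_eq_maximum) force+
  then show ?thesis by (simp add: capacity_def)
qed

lemma E0u_0: "E0u 0 = 0"
  by (simp add: E0u_def Z_0)

end

text \<open>The weighted Young inequality with weights 1/(1+\<rho>) and \<rho>/(1+\<rho>) is the
  tangent inequality at \<open>a\<close> for the convex function t powr (1+\<rho>).\<close>

lemma powr_tangent:
  fixes t a \<rho> :: real
  assumes "0 \<le> t" "0 \<le> a" "0 \<le> \<rho>"
  shows "a powr (1 + \<rho>) + (1 + \<rho>) * (a powr \<rho> * (t - a)) \<le> t powr (1 + \<rho>)"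
proof (cases "a = 0 \<or> t = 0")
  case True
  then show ?thesis
  proof
    assume "a = 0" then show ?thesis by simp
  next
    assume t: "t = 0"
    have "a powr (1 + \<rho>) = a powr \<rho> * a" using assms by (cases "a = 0") (auto simp: powr_add)
    moreover have "0 \<le> \<rho> * (a powr \<rho> * a)" using assms by simp
    ultimately show ?thesis using t assms by (simp add: algebra_simps)
  qed
next
  case False
  then have p: "0 < a" "0 < t" using assms by auto
  have "(t powr (1 + \<rho>)) powr (1 / (1 + \<rho>)) * (a powr (1 + \<rho>)) powr (\<rho> / (1 + \<rho>))
     \<le> 1 / (1 + \<rho>) * t powr (1 + \<rho>) + \<rho> / (1 + \<rho>) * a powr (1 + \<rho>)"
    using p assms by (intro Youngs_inequality_0) (auto simp: add_divide_distrib[symmetric])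
  then have "t * a powr \<rho> \<le> 1 / (1 + \<rho>) * t powr (1 + \<rho>) + \<rho> / (1 + \<rho>) * a powr (1 + \<rho>)"
    using p assms by (simp add: powr_powr)
  then have "(1 + \<rho>) * (t * a powr \<rho>) \<le> (1 + \<rho>) * (1 / (1 + \<rho>) * t powr (1 + \<rho>) + \<rho> / (1 + \<rho>) * a powr (1 + \<rho>))"
    using assms by (intro mult_left_mono) auto
  also have "\<dots> = t powr (1 + \<rho>) + \<rho> * a powr (1 + \<rho>)"
    using assms by (simp add: distrib_left)
  finally show ?thesis using p by (simp add: powr_add algebra_simps)
qed

section \<open>Both exponents along the family of tilts\<close>

context nonsingular_symmetric_channel
begin

lemma E0_unif: "E0 W \<rho> unif = E0u \<rho>"
  by (simp add: E0_def E0u_def Z_def \<alpha>_def unif_def sum_divide_distrib)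

text \<open>Gallager's optimality condition. The linearisation at the uniform law has coefficients
  \<open>\<alpha> \<rho> y powr \<rho>\<close>, and by \<open>tilted_row_sum\<close> this functional
  takes the value Z at every \<open>Q\<close>. So the tangent inequality bounds the sum belonging to
  \<open>Q\<close> from below by Z.\<close>

lemma E0_le:
  assumes Q: "is_dist Q" and "\<rho> \<ge> 0"
  shows "E0 W \<rho> Q \<le> E0u \<rho>"
proof -
  let ?a = "\<lambda>y. \<Sum>x\<in>UNIV. Q x * W x y powr (1 / (1 + \<rho>))"
  have Q0: "0 \<le> Q x" for x using Q by (simp add: is_dist_def)
  have Q1: "(\<Sum>x\<in>UNIV. Q x) = 1" using Q by (simp add: is_dist_def)
  have a0: "0 \<le> ?a y" for y by (intro sum_nonneg mult_nonneg_nonneg Q0) auto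
  have "(\<Sum>y\<in>UNIV. \<alpha> \<rho> y powr \<rho> * ?a y) = (\<Sum>x\<in>UNIV. Q x * (\<Sum>y\<in>UNIV. W x y powr (1 / (1 + \<rho>)) * \<alpha> \<rho> y powr \<rho>))"
    by (simp add: sum_distrib_left) (subst sum.swap, simp add: mult_ac)
  also have "\<dots> = Z \<rho>" by (simp add: tilted_row_sum sum_distrib_right[symmetric] Q1)
  finally have 1: "(\<Sum>y\<in>UNIV. \<alpha> \<rho> y powr \<rho> * ?a y) = Z \<rho>" .
  have "Z \<rho> = Z \<rho> + (1 + \<rho>) * (Z \<rho> - Z \<rho>)" by simp
  also have "\<dots> = (\<Sum>y\<in>UNIV. \<alpha> \<rho> y powr (1 + \<rho>)) + (1 + \<rho>) * ((\<Sum>y\<in>UNIV. \<alpha> \<rho> y powr \<rho> * ?a y) - (\<Sum>y\<in>UNIV. \<alpha> \<rho> y powr \<rho> * \<alpha> \<rho> y))"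
    unfolding 1 by (simp add: \<alpha>_mult_powr Z_def)
  also have "\<dots> = (\<Sum>y\<in>UNIV. \<alpha> \<rho> y powr (1 + \<rho>) + (1 + \<rho>) * (\<alpha> \<rho> y powr \<rho> * (?a y - \<alpha> \<rho> y)))"
    by (simp only: right_diff_distrib sum.distrib sum_subtractf sum_distrib_left[symmetric])
  also have "\<dots> \<le> (\<Sum>y\<in>UNIV. ?a y powr (1 + \<rho>))"
    by (intro sum_mono powr_tangent a0 \<alpha>_nonneg assms)
  finally show ?thesis using Z_pos[of \<rho>] by (simp add: E0_def E0u_def)
qed

lemma cond_div_V:
  assumes Q: "is_dist Q" and "\<rho> \<ge> 0"
  shows "cond_div (V \<rho>) W Q = ereal (E0u \<rho> - \<rho> * J \<rho>)"
proof -
  have "\<not> (\<exists>x y. Q x > 0 \<and> V \<rho> x y > 0 \<and> W x y = 0)" by (auto simp: V_pos_iff)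
  then have "cond_div (V \<rho>) W Q
     = ereal (\<Sum>x\<in>UNIV. Q x * (\<Sum>y\<in>UNIV. if V \<rho> x y = 0 then 0 else V \<rho> x y * ln (V \<rho> x y / W x y)))"
    unfolding cond_div_def by simp
  also have "(\<lambda>x. \<Sum>y\<in>UNIV. if V \<rho> x y = 0 then 0 else V \<rho> x y * ln (V \<rho> x y / W x y))
     = (\<lambda>x. \<Sum>y\<in>UNIV. V \<rho> x y * ln (V \<rho> x y / W x y))"
    by (intro ext sum.cong) auto
  also have "\<dots> = (\<lambda>x. E0u \<rho> - \<rho> * J \<rho>)" using assms by (simp add: div_W_row)
  finally show ?thesis using Q by (simp add: is_dist_def sum_distrib_right[symmetric])
qed

text \<open>Weak duality with multiplier \<rho> for the constraint I \<le> R, at the uniform input: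
  \<open>divergence_gap\<close> after dropping the divergence from \<open>V \<rho>\<close>. A
  channel that is not absolutely continuous costs \<infinity>.\<close>

lemma Esp_ge:
  assumes "\<rho> \<ge> 0"
  shows "ereal (E0u \<rho> - \<rho> * R) \<le> Esp W R"
proof -
  have "ereal (E0u \<rho> - \<rho> * R) \<le> cond_div V' W unif" if V': "is_channel V'" "mutual_info unif V' \<le> R" for V'
  proof (cases "\<exists>x y. unif x > 0 \<and> V' x y > 0 \<and> W x y = 0")
    case True
    then show ?thesis by (simp add: cond_div_def)
  next
    case False
    have V'0: "0 \<le> V' x y" for x y using V' by (simp add: is_channel_def is_dist_def)
    have V'1: "(\<Sum>y\<in>UNIV. V' x y) = 1" for x using V' by (simp add: is_channel_def is_dist_def)
    have ac: "V' x y = 0" if "W x y = 0" for x y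
      using False that V'0[of x y] by (force simp: unif_def less_le)
    have "(\<Sum>x\<in>UNIV. \<Sum>y\<in>UNIV. V' x y - V \<rho> x y) \<le> (\<Sum>x\<in>UNIV. \<Sum>y\<in>UNIV. V' x y * ln (V' x y / V \<rho> x y))"
      by (intro sum_mono mult_ln_ratio_ge V'0 V_nonneg) (simp add: V_eq_0_iff ac)
    then have "0 \<le> (\<Sum>x\<in>UNIV. \<Sum>y\<in>UNIV. V' x y * ln (V' x y / V \<rho> x y)) / real CARD('x)"
      by (simp add: sum_subtractf V'1 V_sum)
    then have "E0u \<rho> \<le> (\<Sum>x\<in>UNIV. \<Sum>y\<in>UNIV. V' x y * ln (V' x y / W x y)) / real CARD('x) + \<rho> * mutual_info unif V'"
      using divergence_gap[OF V'(1) ac assms] by linarith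
    also have "\<dots> \<le> (\<Sum>x\<in>UNIV. \<Sum>y\<in>UNIV. V' x y * ln (V' x y / W x y)) / real CARD('x) + \<rho> * R"
      using V' assms by (simp add: mult_left_mono)
    also have "(\<Sum>x\<in>UNIV. \<Sum>y\<in>UNIV. V' x y * ln (V' x y / W x y)) / real CARD('x)
       = (\<Sum>x\<in>UNIV. unif x * (\<Sum>y\<in>UNIV. V' x y * ln (V' x y / W x y)))"
      by (simp add: unif_def sum_divide_distrib)
    also have "\<dots> = (\<Sum>x\<in>UNIV. unif x * (\<Sum>y\<in>UNIV. if V' x y = 0 then 0 else V' x y * ln (V' x y / W x y)))"
      by (intro sum.cong refl arg_cong2[where f = "(*)"]) auto
    finally show ?thesis using False by (simp add: cond_div_def)
  qed
  then have "ereal (E0u \<rho> - \<rho> * R) \<le> (INF V'\<in>{V'. is_channel V' \<and> mutual_info unif V' \<le> R}. cond_div V' W unif)"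
    by (intro INF_greatest) auto
  also have "\<dots> \<le> Esp W R"
    unfolding Esp_def by (rule SUP_upper) (simp add: is_dist_unif)
  finally show ?thesis .
qed

text \<open>\<open>V \<rho>\<close> closes the duality gap: at rate \<open>J \<rho>\<close> it is
  feasible for every input law, and its cost is the same for all of them, so no \<open>Q\<close>
  achieves more than the dual value.\<close>

lemma Esp_J:
  assumes "\<rho> \<ge> 0"
  shows "Esp W (J \<rho>) = ereal (E0u \<rho> - \<rho> * J \<rho>)"
proof (rule antisym[OF _ Esp_ge[OF assms]])
  show "Esp W (J \<rho>) \<le> ereal (E0u \<rho> - \<rho> * J \<rho>)"
    unfolding Esp_def
  proof (rule SUP_least)
    fix Q :: "'x \<Rightarrow> real" assume Q: "Q \<in> {Q. is_dist Q}"
    have "(INF V'\<in>{V'. is_channel V' \<and> mutual_info Q V' \<le> J \<rho>}. cond_div V' W Q) \<le> cond_div (V \<rho>) W Q"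
      using Q by (intro INF_lower) (auto simp: V_channel mutual_info_V_le)
    then show "(INF V'\<in>{V'. is_channel V' \<and> mutual_info Q V' \<le> J \<rho>}. cond_div V' W Q) \<le> ereal (E0u \<rho> - \<rho> * J \<rho>)"
      using Q assms by (simp add: cond_div_V)
  qed
qed

lemma Er_le:
  assumes "\<And>\<rho>. 0 \<le> \<rho> \<Longrightarrow> \<rho> \<le> 1 \<Longrightarrow> E0u \<rho> - \<rho> * R \<le> b"
  shows "Er W R \<le> b"
  unfolding Er_def
proof (rule cSUP_least)
  show "{Q :: 'x \<Rightarrow> real. is_dist Q} \<times> {0..1::real} \<noteq> {}" using is_dist_unif by auto
next
  fix p :: "('x \<Rightarrow> real) \<times> real" assume p: "p \<in> {Q. is_dist Q} \<times> {0..1}"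
  then have "E0 W (snd p) (fst p) \<le> E0u (snd p)" by (intro E0_le) auto
  with p assms[of "snd p"] show "E0 W (snd p) (fst p) - snd p * R \<le> b" by force
qed

lemma Er_J:
  assumes "0 \<le> \<rho>" "\<rho> \<le> 1"
  shows "Er W (J \<rho>) = E0u \<rho> - \<rho> * J \<rho>"
proof (rule antisym)
  have le: "E0u \<rho>' - \<rho>' * J \<rho> \<le> E0u \<rho> - \<rho> * J \<rho>" if "0 \<le> \<rho>'" for \<rho>'
    using E0u_supergradient[OF that assms(1)] by (simp add: algebra_simps)
  then show "Er W (J \<rho>) \<le> E0u \<rho> - \<rho> * J \<rho>" by (intro Er_le)
  have "bdd_above ((\<lambda>p. E0 W (snd p) (fst p) - snd p * J \<rho>) ` ({Q. is_dist Q} \<times> {0..1}))"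
  proof (rule bdd_aboveI2)
    fix p :: "('x \<Rightarrow> real) \<times> real" assume p: "p \<in> {Q. is_dist Q} \<times> {0..1}"
    then have "E0 W (snd p) (fst p) \<le> E0u (snd p)" by (intro E0_le) auto
    with p le[of "snd p"] show "E0 W (snd p) (fst p) - snd p * J \<rho> \<le> E0u \<rho> - \<rho> * J \<rho>" by force
  qed
  then have "E0 W (snd (unif, \<rho>)) (fst (unif, \<rho>)) - snd (unif, \<rho>) * J \<rho> \<le> Er W (J \<rho>)"
    unfolding Er_def using assms is_dist_unif by (intro cSUP_upper) auto
  then show "E0u \<rho> - \<rho> * J \<rho> \<le> Er W (J \<rho>)" by (simp add: E0_unif)
qed

lemma exists_J_eq:
  assumes "0 \<le> a" "a \<le> b" "J b \<le> R" "R \<le> J a"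
  shows "\<exists>\<rho>. a \<le> \<rho> \<and> \<rho> \<le> b \<and> J \<rho> = R"
  using assms continuous_on_subset[OF continuous_J, of "{a..b}"]
  by (intro IVT2') auto

text \<open>If J stayed above R for all \<rho>, \<open>Esp_ge\<close> at the smaller rate R' would
  give the lower bounds \<rho> (R - R'), unbounded in \<rho>, against finiteness there. So J falls
  to R or below; as it starts at the capacity, the intermediate value theorem applies.\<close>

lemma exists_optimal_tilt:
  assumes "Esp W R' \<noteq> \<infinity>" "R' < R" "R < capacity W"
  shows "\<exists>\<rho>>0. J \<rho> = R"
proof -
  have "\<exists>\<rho>\<ge>0. J \<rho> \<le> R"
  proof (rule ccontr)
    assume "\<not> ?thesis"
    then have J: "R \<le> J \<rho>" if "\<rho> \<ge> 0" for \<rho> using that by force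
    have le: "ereal (\<rho> * (R - R')) \<le> Esp W R'" if "\<rho> \<ge> 0" for \<rho>
    proof -
      have "0 \<le> E0u \<rho> - \<rho> * J \<rho>" using E0u_supergradient[of 0 \<rho>] that by (simp add: E0u_0)
      then have "\<rho> * (R - R') \<le> E0u \<rho> - \<rho> * R'"
        using mult_left_mono[OF J[OF that] that] by (simp add: algebra_simps)
      then have "ereal (\<rho> * (R - R')) \<le> ereal (E0u \<rho> - \<rho> * R')" by simp
      then show ?thesis using Esp_ge[OF that, of R'] by (rule order_trans)
    qed
    then have "Esp W R' \<noteq> -\<infinity>" using le[of 0] by auto
    then obtain e where e: "Esp W R' = ereal e" using assms(1) by (cases "Esp W R'") auto
    have "(\<bar>e\<bar> + 1) / (R - R') * (R - R') \<le> e"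
      using le[of "(\<bar>e\<bar> + 1) / (R - R')"] assms e by simp
    then show False using assms by simp
  qed
  then obtain b where b: "b \<ge> 0" "J b \<le> R" by blast
  then obtain \<rho> where \<rho>: "0 \<le> \<rho>" "J \<rho> = R"
    using exists_J_eq[of 0 b R] assms J_0 by auto
  then have "\<rho> \<noteq> 0" using assms J_0 by auto
  with \<rho> show ?thesis by (intro exI[of _ \<rho>]) auto
qed

text \<open>An envelope argument. For R = J \<rho>', the supergradient inequalities at \<rho> and
  \<rho>' enclose f R - f (J \<rho>) + \<rho> (R - J \<rho>) between 0 and (\<rho> - \<rho>') (R - J
  \<rho>), and continuity with strict monotonicity of J forces \<rho>' close to \<rho> when R is
  close to J \<rho>. The conjugate form is assumed on an interval because for \<open>Er\<close> it
  is established only up to \<rho> = 1.\<close>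

lemma deriv_conjugate:
  assumes ab: "0 \<le> a" "a < \<rho>" "\<rho> < b"
    and f: "\<And>\<rho>'. a < \<rho>' \<Longrightarrow> \<rho>' < b \<Longrightarrow> f (J \<rho>') = E0u \<rho>' - \<rho>' * J \<rho>'"
  shows "deriv f (J \<rho>) = - \<rho>"
proof (rule DERIV_imp_deriv)
  show "(f has_field_derivative - \<rho>) (at (J \<rho>))"
    unfolding has_field_derivative_def has_derivative_at_alt
  proof (intro conjI allI impI)
    show "bounded_linear ((*) (- \<rho>))" by (rule bounded_linear_mult_right)
    fix e :: real assume e: "e > 0"
    define d where "d = min e (min ((\<rho> - a) / 2) ((b - \<rho>) / 2))"
    have d: "0 < d" "d \<le> e" "a < \<rho> - d" "\<rho> + d < b" using e ab unfolding d_def by (auto simp: min_def field_simps)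
    define D where "D = min (J \<rho> - J (\<rho> + d)) (J (\<rho> - d) - J \<rho>)"
    have D: "D > 0" unfolding D_def using d ab by (auto intro!: J_strict_antimono)
    show "\<exists>D>0. \<forall>R. norm (R - J \<rho>) < D \<longrightarrow> norm (f R - f (J \<rho>) - - \<rho> * (R - J \<rho>)) \<le> e * norm (R - J \<rho>)"
    proof (intro exI conjI allI impI)
      fix R assume "norm (R - J \<rho>) < D"
      then have "J (\<rho> + d) \<le> R" "R \<le> J (\<rho> - d)" unfolding D_def by (auto simp: abs_if split: if_splits)
      then obtain \<rho>' where \<rho>': "\<rho> - d \<le> \<rho>'" "\<rho>' \<le> \<rho> + d" "J \<rho>' = R"
        using exists_J_eq[of "\<rho> - d" "\<rho> + d" R] d ab by auto
      have pos: "0 \<le> \<rho>" "0 \<le> \<rho>'" using \<rho>' d ab by linarith+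
      have fR: "f R = E0u \<rho>' - \<rho>' * R" using f[of \<rho>'] \<rho>' d by auto
      have f0: "f (J \<rho>) = E0u \<rho> - \<rho> * J \<rho>" using f[of \<rho>] ab by auto
      have 1: "0 \<le> f R - f (J \<rho>) + \<rho> * (R - J \<rho>)"
        using E0u_supergradient[OF pos] unfolding fR f0 \<rho>'(3) by (simp add: algebra_simps)
      have "f R - f (J \<rho>) + \<rho> * (R - J \<rho>) \<le> (\<rho> - \<rho>') * (R - J \<rho>)"
        using E0u_supergradient[OF pos(2) pos(1)] unfolding fR f0 \<rho>'(3) by (simp add: algebra_simps)
      also have "\<dots> \<le> \<bar>\<rho> - \<rho>'\<bar> * \<bar>R - J \<rho>\<bar>" by (metis abs_ge_self abs_mult)
      also have "\<dots> \<le> e * \<bar>R - J \<rho>\<bar>" using \<rho>' d by (intro mult_right_mono) auto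
      finally show "norm (f R - f (J \<rho>) - - \<rho> * (R - J \<rho>)) \<le> e * norm (R - J \<rho>)"
        using 1 by simp
    qed (rule D)
  qed
qed

lemma Esp_real_J:
  assumes "\<rho> > 0"
  shows "Esp_real W (J \<rho>) = E0u \<rho> - \<rho> * J \<rho>" "deriv (Esp_real W) (J \<rho>) = - \<rho>"
proof -
  have *: "Esp_real W (J \<rho>) = E0u \<rho> - \<rho> * J \<rho>" if "\<rho> \<ge> 0" for \<rho>
    using that by (simp add: Esp_real_def Esp_J)
  show "Esp_real W (J \<rho>) = E0u \<rho> - \<rho> * J \<rho>" using * assms by simp
  show "deriv (Esp_real W) (J \<rho>) = - \<rho>"
    using assms by (intro deriv_conjugate[of 0 \<rho> "\<rho> + 1"] *) auto
qed

lemma deriv_Er_J: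
  assumes "0 < \<rho>" "\<rho> < 1"
  shows "deriv (Er W) (J \<rho>) = - \<rho>"
  using assms by (intro deriv_conjugate[of 0 \<rho> 1] Er_J) auto

lemma optimal_tilt_above_R_inf:
  assumes "R_inf W < R" "R < capacity W"
  shows "\<exists>\<rho>>0. J \<rho> = R"
proof -
  \<comment> \<open>A real \<open>Sup\<close> is informative only for a bounded set; the capacity
    \<open>J 0\<close> is a bound because \<open>Esp\<close> is finite there.\<close>
  have bdd: "bdd_above {r. \<forall>R<r. Esp W R = \<infinity>}"
  proof (rule bdd_aboveI)
    fix r assume "r \<in> {r. \<forall>R<r. Esp W R = \<infinity>}"
    then show "r \<le> J 0" using Esp_J[of 0] by (force simp: not_less[symmetric])
  qed
  have "\<not> (\<forall>R'<R. Esp W R' = \<infinity>)"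
  proof
    assume "\<forall>R'<R. Esp W R' = \<infinity>"
    then have "R \<le> R_inf W" unfolding R_inf_def by (intro cSup_upper bdd) auto
    with assms show False by simp
  qed
  then show ?thesis using exists_optimal_tilt assms by blast
qed

text \<open>Some rate R0 < R satisfies Er = Esp. If R were J \<rho> with \<rho> \<ge> 1, a still
  larger \<rho>' with J \<rho>' > R0 would make E0u \<rho>' - \<rho>' R0 exceed everything
  attainable with parameters in [0,1], so Er would be strictly below Esp at R0.\<close>

lemma optimal_tilt_above_R_cr:
  assumes "R_cr W < R" "R < capacity W"
  shows "\<exists>\<rho>>0. \<rho> < 1 \<and> J \<rho> = R"
proof -
  have "ereal (Er W (J 0)) = Esp W (J 0)" by (simp add: Esp_J Er_J)
  then have "{R. ereal (Er W R) = Esp W R} \<noteq> {}" by blast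
  then obtain R0 where R0: "ereal (Er W R0) = Esp W R0" "R0 < R"
    using assms(1) unfolding R_cr_def by (metis (mono_tags, lifting) cInf_lessD mem_Collect_eq)
  then have "Esp W R0 \<noteq> \<infinity>" by (metis PInfty_neq_ereal(1))
  then obtain \<rho> where \<rho>: "\<rho> > 0" "J \<rho> = R" using exists_optimal_tilt R0 assms by blast
  moreover have "\<rho> < 1"
  proof (rule ccontr)
    assume "\<not> \<rho> < 1"
    \<comment> \<open>If J (\<rho>+1) is still at least R0, half a step suffices by strict
      monotonicity; otherwise the rate midway between R0 and R is attained on the way.\<close>
    have "\<exists>\<rho>'>\<rho>. R0 < J \<rho>'"
    proof (cases "R0 \<le> J (\<rho> + 1)")
      case True
      define \<rho>' where "\<rho>' = \<rho> + 1 / 2"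
      have "J (\<rho> + 1) < J \<rho>'" using \<rho> by (intro J_strict_antimono) (auto simp: \<rho>'_def)
      with True show ?thesis by (intro exI[of _ \<rho>']) (auto simp: \<rho>'_def)
    next
      case False
      then obtain \<rho>' where \<rho>': "\<rho> \<le> \<rho>'" "J \<rho>' = (R0 + R) / 2"
        using exists_J_eq[of \<rho> "\<rho> + 1" "(R0 + R) / 2"] \<rho> R0 by auto
      then have "\<rho> \<noteq> \<rho>'" using \<rho> R0 by auto
      with \<rho>' R0 show ?thesis by (intro exI[of _ \<rho>']) auto
    qed
    then obtain \<rho>' where \<rho>': "\<rho>' > 1" "R0 < J \<rho>'" using \<open>\<not> \<rho> < 1\<close> by force
    let ?R = "J \<rho>'"
    have "Er W R0 \<le> E0u \<rho>' - \<rho>' * ?R + (?R - R0)"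
    proof (rule Er_le)
      fix t :: real assume t: "0 \<le> t" "t \<le> 1"
      have "t * (?R - R0) \<le> 1 * (?R - R0)" using t \<rho>' by (intro mult_right_mono) auto
      with E0u_supergradient[of t \<rho>'] t \<rho>' show "E0u t - t * R0 \<le> E0u \<rho>' - \<rho>' * ?R + (?R - R0)"
        by (simp add: algebra_simps)
    qed
    moreover have "(?R - R0) < \<rho>' * (?R - R0)" using \<rho>' by simp
    ultimately have "Er W R0 < E0u \<rho>' - \<rho>' * R0" by (simp add: algebra_simps)
    moreover have "ereal (E0u \<rho>' - \<rho>' * R0) \<le> ereal (Er W R0)"
      unfolding R0(1) using \<rho>' by (intro Esp_ge) auto
    ultimately show False by simp
  qed
  ultimately show ?thesis by blast
qed

end

section \<open>Converse with feedback\<close>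

text \<open>A feedback input depends on the past outputs, so the converse has to peel off the last
  letter.\<close>

lemma wsum_snoc: "wsum p (Suc N) F = wsum p N (\<lambda>xs. \<Sum>x\<in>UNIV. p x * F (xs @ [x]))"
  by (simp add: wsum_def sum_words_Suc_snoc sum_distrib_left mult.assoc)

lemma wsum_prod_list:
  "wsum p N (\<lambda>xs. prod_list (map b xs)) = (\<Sum>x\<in>UNIV. p x * b x) ^ N"
proof (induction N)
  case (Suc N)
  have "wsum p (Suc N) (\<lambda>xs. prod_list (map b xs))
     = (\<Sum>x\<in>UNIV. p x * wsum p N (\<lambda>xs. b x * prod_list (map b xs)))"
    by (simp add: wsum_Suc)
  also have "\<dots> = (\<Sum>x\<in>UNIV. p x * b x * (\<Sum>x\<in>UNIV. p x * b x) ^ N)"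
    by (simp only: wsum_cmult Suc mult.assoc)
  finally show ?case by (simp add: sum_distrib_right)
qed simp

lemma fb_law_snoc:
  assumes "length ys = N"
  shows "fb_law W (Suc N) enc m (ys @ [y]) = fb_law W N enc m ys * W (enc (Suc N) m ys) y"
proof -
  have "(\<Prod>n\<in>{1..N}. W (enc n m (take (n - 1) (ys @ [y]))) ((ys @ [y]) ! (n - 1)))
     = (\<Prod>n\<in>{1..N}. W (enc n m (take (n - 1) ys)) (ys ! (n - 1)))"
    using assms by (intro prod.cong) (auto simp: nth_append)
  moreover have "(ys @ [y]) ! N = y" using assms by auto
  ultimately show ?thesis
    using assms by (simp add: fb_law_def)
qed

lemma card_messages_ge: "exp (real N * R) \<le> real (card (messages N R))"
  unfolding messages_def by simp

lemma sum_over_decoder: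
  fixes f :: "'y::finite list \<Rightarrow> real"
  assumes "\<And>ys. ys \<in> words N \<Longrightarrow> dec ys \<in> messages N R"
  shows "(\<Sum>m\<in>messages N R. \<Sum>ys\<in>words N. if dec ys = m then f ys else 0) = (\<Sum>ys\<in>words N. f ys)"
proof -
  have fin: "finite (messages N R)" by (simp add: messages_def)
  have "(\<Sum>m\<in>messages N R. \<Sum>ys\<in>words N. if dec ys = m then f ys else 0)
     = (\<Sum>ys\<in>words N. \<Sum>m\<in>messages N R. if dec ys = m then f ys else 0)"
    by (rule sum.swap)
  also have "\<dots> = (\<Sum>ys\<in>words N. f ys)"
    using assms fin by (intro sum.cong) auto
  finally show ?thesis .
qed

text \<open>The finitely many short lengths are covered by the least of their ratios f N / g N. This
  is why the converse must also show that the error probability is positive at every length.\<close>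

lemma lower_bound_all_lengths:
  fixes f g :: "nat \<Rightarrow> real"
  assumes "\<And>N. N \<ge> 1 \<Longrightarrow> 0 < f N" "\<And>N. N \<ge> 1 \<Longrightarrow> 0 < g N"
    and "c > 0" "\<And>N. N \<ge> N0 \<Longrightarrow> c * g N \<le> f N"
  shows "\<exists>K>0. \<forall>N\<ge>1. K * g N \<le> f N"
proof -
  let ?S = "insert c ((\<lambda>N. f N / g N) ` {1..<N0})"
  have "0 < Min ?S" using assms by (subst Min_gr_iff) auto
  moreover have "Min ?S * g N \<le> f N" if N: "N \<ge> 1" for N
  proof (cases "N < N0")
    case True
    then have "Min ?S \<le> f N / g N" using N by (intro Min_le) auto
    then show ?thesis using assms(2)[OF N] by (simp add: field_simps)
  next
    case False
    have "Min ?S * g N \<le> c * g N"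
      using assms(2)[OF N] by (intro mult_right_mono) auto
    with False assms(4)[of N] show ?thesis by simp
  qed
  ultimately show ?thesis by blast
qed

context nonsingular_symmetric_channel
begin

section \<open>The likelihood-ratio test against \<open>q\<close>\<close>

definition lr :: "real \<Rightarrow> 'x \<Rightarrow> 'y \<Rightarrow> real" where
  "lr \<rho> x y = W x y / q \<rho> y"

lemma lr_nonneg: "0 \<le> lr \<rho> x y"
  unfolding lr_def by (intro divide_nonneg_nonneg W_nonneg q_nonneg)

lemma lr_pos_iff: "0 < lr \<rho> x y \<longleftrightarrow> 0 < W x y"
  using q_pos[of x y \<rho>] W_eq_0[of x y] unfolding lr_def by (cases "0 < W x y") auto

lemma sum_q_lr_invariant: "(\<Sum>y\<in>UNIV. q \<rho> y * F (lr \<rho> x y)) = (\<Sum>y\<in>UNIV. q \<rho> y * F (lr \<rho> x' y))"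
  unfolding lr_def q_def
  by (rule row_invariant[where G = "\<lambda>a w. a powr (1 + \<rho>) / Z \<rho> * F (w / (a powr (1 + \<rho>) / Z \<rho>))"])

text \<open>Feedback is useless here: under \<open>q\<^sub>\<rho>\<close> the likelihood ratio has the same law for every encoder.\<close>

lemma fb_likelihood_ratio_law:
  "wsum (q \<rho>) N (\<lambda>ys. F (fb_law W N enc m ys / prod_list (map (q \<rho>) ys)))
   = wsum (q \<rho>) N (\<lambda>ys. F (prod_list (map (lr \<rho> x0) ys)))"
proof (induction N arbitrary: F)
  case 0
  then show ?case by (simp add: fb_law_def)
next
  case (Suc N)
  let ?G = "\<lambda>t. \<Sum>y\<in>UNIV. q \<rho> y * F (t * lr \<rho> x0 y)"
  have "wsum (q \<rho>) (Suc N) (\<lambda>ys. F (fb_law W (Suc N) enc m ys / prod_list (map (q \<rho>) ys)))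
     = wsum (q \<rho>) N (\<lambda>ys. ?G (fb_law W N enc m ys / prod_list (map (q \<rho>) ys)))"
    unfolding wsum_snoc
  proof (rule wsum_cong)
    fix ys :: "'y list" assume len: "length ys = N"
    let ?x = "enc (Suc N) m ys" and ?t = "fb_law W N enc m ys / prod_list (map (q \<rho>) ys)"
    have "(\<Sum>y\<in>UNIV. q \<rho> y * F (fb_law W (Suc N) enc m (ys @ [y]) / prod_list (map (q \<rho>) (ys @ [y]))))
       = (\<Sum>y\<in>UNIV. q \<rho> y * F (?t * lr \<rho> ?x y))"
      by (simp add: fb_law_snoc[OF len] lr_def)
    also have "\<dots> = ?G ?t"
      by (rule sum_q_lr_invariant[where F = "\<lambda>z. F (?t * z)"])
    finally show "(\<Sum>y\<in>UNIV. q \<rho> y * F (fb_law W (Suc N) enc m (ys @ [y]) / prod_list (map (q \<rho>) (ys @ [y])))) = ?G ?t" .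
  qed
  also have "\<dots> = wsum (q \<rho>) N (\<lambda>ys. ?G (prod_list (map (lr \<rho> x0) ys)))"
    by (rule Suc)
  also have "\<dots> = wsum (q \<rho>) (Suc N) (\<lambda>ys. F (prod_list (map (lr \<rho> x0) ys)))"
    by (simp add: wsum_snoc)
  finally show ?case .
qed

definition lr_tail :: "real \<Rightarrow> 'x \<Rightarrow> nat \<Rightarrow> real \<Rightarrow> real" where
  "lr_tail \<rho> x0 N l = wsum (q \<rho>) N (\<lambda>ys. if l \<le> prod_list (map (lr \<rho> x0) ys) then 1 else 0)"

lemma fb_law_nonneg: "0 \<le> fb_law W N enc m ys"
  unfolding fb_law_def by (intro prod_nonneg) (simp add: W_nonneg)

text \<open>For message \<open>m\<close>, the errors made where P \<ge> l q already have probability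
  at least l times the \<open>q\<close>-mass of that event minus the \<open>q\<close>-mass of the
  decoding region of \<open>m\<close>. The regions have total \<open>q\<close>-mass 1, so on average
  one takes 1/|M| \<le> exp (- N R).\<close>

lemma fb_avg_err_ge:
  assumes dec: "\<And>ys. ys \<in> words N \<Longrightarrow> dec ys \<in> messages N R" and l: "l > 0"
  shows "l * (lr_tail \<rho> x0 N l - exp (- real N * R)) \<le> fb_avg_err W N R enc dec"
proof -
  let ?M = "messages N R" and ?q = "\<lambda>ys. prod_list (map (q \<rho>) ys)"
  let ?P = "fb_law W N enc"
  have q0: "0 \<le> ?q ys" for ys by (intro prod_list_map_nonneg q_nonneg)
  have cM: "0 < real (card ?M)" using card_messages_ge[of N R] exp_gt_zero[of "real N * R"] by linarith
  have each: "l * lr_tail \<rho> x0 N l - l * (\<Sum>ys\<in>words N. if dec ys = m then ?q ys else 0)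
      \<le> (\<Sum>ys\<in>words N. if dec ys \<noteq> m then ?P m ys else 0)" for m
  proof -
    have "lr_tail \<rho> x0 N l = wsum (q \<rho>) N (\<lambda>ys. if l \<le> ?P m ys / ?q ys then 1 else 0)"
      unfolding lr_tail_def by (rule fb_likelihood_ratio_law[where F = "\<lambda>t. if l \<le> t then 1 else 0", symmetric])
    then have "l * lr_tail \<rho> x0 N l - l * (\<Sum>ys\<in>words N. if dec ys = m then ?q ys else 0)
       = (\<Sum>ys\<in>words N. l * (?q ys * (if l \<le> ?P m ys / ?q ys then 1 else 0)) - l * (if dec ys = m then ?q ys else 0))"
      by (simp only: wsum_def sum_subtractf sum_distrib_left)
    also have "\<dots> \<le> (\<Sum>ys\<in>words N. if dec ys \<noteq> m then ?P m ys else 0)"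
    proof (rule sum_mono)
      fix ys
      \<comment> \<open>Where the denominator vanishes, the quotient is 0 by convention and hence
        below \<open>l\<close>.\<close>
      have "l * ?q ys \<le> ?P m ys" if "l \<le> ?P m ys / ?q ys"
      proof -
        have "0 < ?P m ys / ?q ys" using that l by linarith
        then have "0 < ?q ys" using q0[of ys] by (cases "?q ys = 0") auto
        then show ?thesis using that by (simp add: field_simps)
      qed
      then show "l * (?q ys * (if l \<le> ?P m ys / ?q ys then 1 else 0)) - l * (if dec ys = m then ?q ys else 0)
         \<le> (if dec ys \<noteq> m then ?P m ys else 0)"
        using fb_law_nonneg[of N enc m ys] q0[of ys] l by auto
    qed
    finally show ?thesis .
  qed
  have "real (card ?M) * (l * lr_tail \<rho> x0 N l) - l * 1
     = (\<Sum>m\<in>?M. l * lr_tail \<rho> x0 N l - l * (\<Sum>ys\<in>words N. if dec ys = m then ?q ys else 0))"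
  proof -
    have "(\<Sum>ys\<in>words N. ?q ys) = 1"
      using wsum_const[OF q_sum, of \<rho> N 1] by (simp add: wsum_def)
    then show ?thesis
      using sum_over_decoder[OF dec, where f = ?q] by (simp add: sum_subtractf sum_distrib_left[symmetric])
  qed
  also have "\<dots> \<le> (\<Sum>m\<in>?M. \<Sum>ys\<in>words N. if dec ys \<noteq> m then ?P m ys else 0)"
    by (intro sum_mono each)
  finally have "(real (card ?M) * (l * lr_tail \<rho> x0 N l) - l * 1) / real (card ?M) \<le> fb_avg_err W N R enc dec"
    unfolding fb_avg_err_def using cM by (simp add: divide_right_mono)
  then have "l * (lr_tail \<rho> x0 N l - 1 / real (card ?M)) \<le> fb_avg_err W N R enc dec"
    using cM by (simp add: field_simps)
  moreover have "1 / real (card ?M) \<le> exp (- real N * R)"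
    using card_messages_ge[of N R] cM by (simp add: exp_minus field_simps)
  then have "l * (lr_tail \<rho> x0 N l - exp (- real N * R)) \<le> l * (lr_tail \<rho> x0 N l - 1 / real (card ?M))"
    using l by (intro mult_left_mono) auto
  ultimately show ?thesis by linarith
qed

lemma Pe_fb_avg_ge:
  assumes "l > 0"
  shows "l * (lr_tail \<rho> x0 N l - exp (- real N * R)) \<le> Pe_fb_avg W N R"
  unfolding Pe_fb_avg_def
proof (rule cInf_greatest)
  have "1 \<in> messages N R"
    by (simp add: messages_def Suc_le_eq)
  then show "{fb_avg_err W N R enc dec |enc dec. \<forall>ys\<in>words N. dec ys \<in> messages N R} \<noteq> {}"
    by (auto intro: exI[of _ "\<lambda>_. 1"])
qed (use fb_avg_err_ge[OF _ assms] in blast)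

text \<open>Where \<open>W\<close> vanishes the logarithm has a default value; later uses either
  assume \<open>W\<close> positive or weight the letter by \<open>V \<rho>\<close>, which is 0
  there.\<close>

definition llr :: "real \<Rightarrow> 'x \<Rightarrow> 'y \<Rightarrow> real" where
  "llr \<rho> x y = ln (lr \<rho> x y)"

lemma llr_eq:
  assumes "W x y > 0"
  shows "llr \<rho> x y = ln (W x y) - (1 + \<rho>) * ln (\<alpha> \<rho> y) - E0u \<rho>"
  using assms q_pos[OF assms, of \<rho>] by (simp add: llr_def lr_def ln_div ln_q)

lemma llr_mean:
  assumes "\<rho> \<ge> 0"
  shows "(\<Sum>y\<in>UNIV. V \<rho> x y * llr \<rho> x y) = (1 + \<rho>) * J \<rho> - E0u \<rho>"
proof -
  have "(\<Sum>y\<in>UNIV. V \<rho> x y * llr \<rho> x y)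
     = (\<Sum>y\<in>UNIV. (1 + \<rho>) * (V \<rho> x y * (1 / (1 + \<rho>) * ln (W x y) - ln (\<alpha> \<rho> y))) - V \<rho> x y * E0u \<rho>)"
  proof (intro sum.cong refl)
    fix y
    show "V \<rho> x y * llr \<rho> x y
      = (1 + \<rho>) * (V \<rho> x y * (1 / (1 + \<rho>) * ln (W x y) - ln (\<alpha> \<rho> y))) - V \<rho> x y * E0u \<rho>"
    proof (cases "W x y > 0")
      case True
      have "llr \<rho> x y = (1 + \<rho>) * (1 / (1 + \<rho>) * ln (W x y) - ln (\<alpha> \<rho> y)) - E0u \<rho>"
        unfolding llr_eq[OF True] using assms by (simp add: right_diff_distrib)
      then have "V \<rho> x y * llr \<rho> x y
        = V \<rho> x y * ((1 + \<rho>) * (1 / (1 + \<rho>) * ln (W x y) - ln (\<alpha> \<rho> y)) - E0u \<rho>)" by simp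
      also have "v * ((1 + \<rho>) * t - E0u \<rho>) = (1 + \<rho>) * (v * t) - v * E0u \<rho>" for v t
        by (simp add: algebra_simps)
      finally show ?thesis .
    next
      case False
      then have "V \<rho> x y = 0" by (simp add: V_eq_0_iff W_eq_0)
      then show ?thesis by simp
    qed
  qed
  also have "\<dots> = (1 + \<rho>) * J \<rho> - E0u \<rho>"
    by (simp only: sum_subtractf sum_distrib_left[symmetric] sum_distrib_right[symmetric] J_row V_sum mult_1)
  finally show ?thesis .
qed

text \<open>If \<open>lr\<close> had a single positive value \<open>c\<close> in row x, a
  nonnegative test function vanishing just at 0 and c would have \<open>q\<close>-mean 0 in that
  row, hence by symmetry in every row. Then W = c q on the whole support, so positive entries of a
  column would agree, which nonsingularity forbids.\<close>

lemma llr_nonconstant: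
  assumes "\<rho> \<ge> 0"
  shows "\<exists>u v. 0 < W x u \<and> 0 < W x v \<and> llr \<rho> x u \<noteq> llr \<rho> x v"
proof (rule ccontr)
  assume *: "\<not> ?thesis"
  obtain u where u: "0 < W x u" using ex_W_pos by blast
  define c where "c = lr \<rho> x u"
  have pos: "0 < lr \<rho> x y" if "0 < W x y" for y using that by (simp add: lr_pos_iff)
  have "lr \<rho> x y = c" if "0 < W x y" for y
    using * u that pos[OF u] pos[OF that] unfolding c_def llr_def by (metis ln_inj_iff)
  then have x0: "q \<rho> y * (if lr \<rho> x y = 0 then 0 else (lr \<rho> x y - c)\<^sup>2) = 0" for y
    using lr_pos_iff[of \<rho> x y] lr_nonneg[of \<rho> x y] by auto
  have 0: "(\<Sum>y\<in>UNIV. q \<rho> y * (if lr \<rho> x' y = 0 then 0 else (lr \<rho> x' y - c)\<^sup>2)) = 0" for x'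
    by (subst sum_q_lr_invariant[of _ "\<lambda>t. if t = 0 then 0 else (t - c)\<^sup>2" _ x]) (intro sum.neutral ballI x0)
  have "lr \<rho> x' y = c" if w: "0 < W x' y" for x' y
  proof -
    have "q \<rho> y * (if lr \<rho> x' y = 0 then 0 else (lr \<rho> x' y - c)\<^sup>2) = 0"
      using 0[of x'] by (subst (asm) sum_nonneg_eq_0_iff) (auto simp: q_nonneg)
    moreover have "0 < lr \<rho> x' y" "0 < q \<rho> y" using w by (simp_all add: lr_pos_iff q_pos)
    ultimately show ?thesis by simp
  qed
  then have W_eq: "W x' y = c * q \<rho> y" if "0 < W x' y" for x' y
    using that q_pos[OF that, of \<rho>] by (force simp: lr_def field_simps)
  obtain x1 x2 y0 where "0 < W x1 y0" "0 < W x2 y0" "W x1 y0 \<noteq> W x2 y0"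
    by (rule distinguishing_inputs)
  then show False using W_eq by metis
qed

text \<open>The change of measure between \<open>q \<rho>\<close> and \<open>V \<rho> x\<close>. On
  the support of row x the density is a power of the likelihood ratio up to a constant, and equality
  holds; off the support the left-hand side is 0.\<close>

lemma q_ge_tilted:
  assumes "\<rho> \<ge> 0"
  shows "V \<rho> x y * exp (- (llr \<rho> x y + E0u \<rho>) / (1 + \<rho>)) \<le> q \<rho> y"
proof (cases "0 < W x y")
  case True
  then have pos: "0 < V \<rho> x y" "0 < q \<rho> y" by (simp_all add: V_pos_iff q_pos)
  have "- (llr \<rho> x y + E0u \<rho>) / (1 + \<rho>) = ln (\<alpha> \<rho> y) - 1 / (1 + \<rho>) * ln (W x y)"
    unfolding llr_eq[OF True] using assms by (simp add: diff_divide_distrib)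
  then have "ln (V \<rho> x y) + - (llr \<rho> x y + E0u \<rho>) / (1 + \<rho>) = ln (q \<rho> y)"
    unfolding ln_V[OF True] ln_q[OF True] by (simp add: algebra_simps)
  then have "exp (ln (V \<rho> x y)) * exp (- (llr \<rho> x y + E0u \<rho>) / (1 + \<rho>)) = exp (ln (q \<rho> y))"
    by (metis exp_add)
  then show ?thesis using pos by simp
next
  case False
  then have "V \<rho> x y = 0" by (simp add: V_eq_0_iff W_eq_0)
  then show ?thesis by (simp add: q_nonneg)
qed

text \<open>Change the measure to \<open>V \<rho> x\<close>, under which windows near the mean of
  \<open>llr\<close> are not exponentially rare; inside the window the density factor is at least
  its value at the right end a + K.\<close>

lemma lr_tail_ge:
  assumes "\<rho> \<ge> 0"
  shows "exp (- (a + K + real N * E0u \<rho>) / (1 + \<rho>)) * wsum (V \<rho> x) N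
      (\<lambda>ys. if a \<le> sum_list (map (llr \<rho> x) ys) \<and> sum_list (map (llr \<rho> x) ys) < a + K then 1 else 0)
    \<le> lr_tail \<rho> x N (exp a)"
proof -
  let ?S = "\<lambda>ys. sum_list (map (llr \<rho> x) ys)" and ?v = "\<lambda>ys. prod_list (map (V \<rho> x) ys)"
    and ?q = "\<lambda>ys. prod_list (map (q \<rho>) ys)"
  have v0: "0 \<le> ?v ys" for ys by (intro prod_list_map_nonneg V_nonneg)
  have q0: "0 \<le> ?q ys" for ys by (intro prod_list_map_nonneg q_nonneg)
  have 1: "?v ys * exp (- (?S ys + real (length ys) * E0u \<rho>) / (1 + \<rho>)) \<le> ?q ys" for ys
  proof (induction ys)
    case (Cons y ys)
    have "?v (y # ys) * exp (- (?S (y # ys) + real (length (y # ys)) * E0u \<rho>) / (1 + \<rho>))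
       = (V \<rho> x y * exp (- (llr \<rho> x y + E0u \<rho>) / (1 + \<rho>))) * (?v ys * exp (- (?S ys + real (length ys) * E0u \<rho>) / (1 + \<rho>)))"
      by (simp add: exp_add[symmetric] add_divide_distrib[symmetric] algebra_simps)
    also have "\<dots> \<le> q \<rho> y * ?q ys"
      using Cons v0[of ys] by (intro mult_mono q_ge_tilted assms q_nonneg) auto
    finally show ?case by simp
  qed simp
  have 2: "?v ys > 0 \<Longrightarrow> prod_list (map (lr \<rho> x) ys) = exp (?S ys)" for ys
  proof (induction ys)
    case (Cons y ys)
    then have "0 < V \<rho> x y" "0 < ?v ys"
      using V_nonneg[of \<rho> x y] v0[of ys] by (auto simp: zero_less_mult_iff)
    moreover from this have "0 < lr \<rho> x y" by (simp add: lr_pos_iff V_pos_iff)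
    ultimately show ?case using Cons.IH by (simp add: llr_def exp_add)
  qed simp
  have "exp (- (a + K + real N * E0u \<rho>) / (1 + \<rho>)) * wsum (V \<rho> x) N (\<lambda>ys. if a \<le> ?S ys \<and> ?S ys < a + K then 1 else 0)
     = (\<Sum>ys\<in>words N. ?v ys * (exp (- (a + K + real N * E0u \<rho>) / (1 + \<rho>)) * (if a \<le> ?S ys \<and> ?S ys < a + K then 1 else 0)))"
    by (simp add: wsum_def sum_distrib_left mult.left_commute)
  also have "\<dots> \<le> (\<Sum>ys\<in>words N. ?q ys * (if exp a \<le> prod_list (map (lr \<rho> x) ys) then 1 else 0))"
  proof (rule sum_mono)
    fix ys :: "'y list" assume "ys \<in> words N"
    then have len: "length ys = N" by (simp add: words_def)
    show "?v ys * (exp (- (a + K + real N * E0u \<rho>) / (1 + \<rho>)) * (if a \<le> ?S ys \<and> ?S ys < a + K then 1 else 0))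
      \<le> ?q ys * (if exp a \<le> prod_list (map (lr \<rho> x) ys) then 1 else 0)"
    proof (cases "?v ys > 0 \<and> a \<le> ?S ys \<and> ?S ys < a + K")
      case True
      then have "exp a \<le> prod_list (map (lr \<rho> x) ys)" by (simp add: 2)
      have 3: "?v ys * exp (- (a + K + real N * E0u \<rho>) / (1 + \<rho>)) \<le> ?v ys * exp (- (?S ys + real (length ys) * E0u \<rho>) / (1 + \<rho>))"
        using True assms len by (intro mult_left_mono) (auto intro!: divide_right_mono)
      from order_trans[OF 3 1[of ys]]
      have "?v ys * exp (- (a + K + real N * E0u \<rho>) / (1 + \<rho>)) \<le> ?q ys" .
      with \<open>exp a \<le> prod_list (map (lr \<rho> x) ys)\<close> show ?thesis using True by simp
    next
      case False
      then have "?v ys * (exp (- (a + K + real N * E0u \<rho>) / (1 + \<rho>)) * (if a \<le> ?S ys \<and> ?S ys < a + K then 1 else 0)) = 0"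
        using v0[of ys] by (auto simp: less_le)
      also have "0 \<le> ?q ys * (if exp a \<le> prod_list (map (lr \<rho> x) ys) then 1 else 0)"
        using q0[of ys] by simp
      finally show ?thesis .
    qed
  qed
  finally show ?thesis unfolding lr_tail_def wsum_def .
qed

text \<open>With R = J \<rho>, the 2 leaves exp (- N R) over once \<open>Pe_fb_avg_ge\<close> has
  subtracted it. The term (1+\<rho>)/2 * ln N, divided by 1+\<rho> in the change of measure,
  compensates the 1 / sqrt N of the window probability.\<close>

lemma lr_tail_large_N:
  assumes \<rho>: "\<rho> > 0"
  shows "\<exists>b N0. \<forall>N\<ge>N0. 2 * exp (- real N * J \<rho>)
    \<le> lr_tail \<rho> x N (exp (real N * ((1 + \<rho>) * J \<rho> - E0u \<rho>) + b - (1 + \<rho>) / 2 * ln (real N)))"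
proof -
  obtain u v where uv: "0 < W x u" "0 < W x v" "llr \<rho> x u \<noteq> llr \<rho> x v"
    using llr_nonconstant[of \<rho> x] \<rho> by auto
  define K where "K = \<bar>llr \<rho> x v - llr \<rho> x u\<bar>"
  define \<mu> where "\<mu> = (1 + \<rho>) * J \<rho> - E0u \<rho>"
  have "\<exists>c>0. \<exists>N0. \<forall>N\<ge>N0. \<forall>a. \<bar>a - real N * (\<Sum>y\<in>UNIV. V \<rho> x y * llr \<rho> x y)\<bar> \<le> (\<rho> + 2) * sqrt (real N) \<longrightarrow>
    c / sqrt (real N) \<le> wsum (V \<rho> x) N (\<lambda>ys. if a \<le> sum_list (map (llr \<rho> x) ys)
       \<and> sum_list (map (llr \<rho> x) ys) < a + \<bar>llr \<rho> x v - llr \<rho> x u\<bar> then 1 else 0)"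
    using uv \<rho> by (intro concentration_lower V_sum V_nonneg) (auto simp: V_pos_iff)
  then obtain c N0 where c: "c > 0" and N0: "\<And>N a. N \<ge> N0 \<Longrightarrow> \<bar>a - real N * \<mu>\<bar> \<le> (\<rho> + 2) * sqrt (real N) \<Longrightarrow>
    c / sqrt (real N) \<le> wsum (V \<rho> x) N (\<lambda>ys. if a \<le> sum_list (map (llr \<rho> x) ys)
       \<and> sum_list (map (llr \<rho> x) ys) < a + K then 1 else 0)"
    using \<rho> unfolding K_def \<mu>_def by (auto simp: llr_mean)
  \<comment> \<open>The constant part of the threshold \<open>a\<close> that solves exp (- (a + K +
    N E0u) / (1+\<rho>)) * c / sqrt N = 2 exp (- N J).\<close>
  define b where "b = (1 + \<rho>) * ln (c / 2) - K"
  \<comment> \<open>From here on |b| \<le> sqrt N; together with ln N \<le> 2 sqrt N this keeps the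
    threshold within the distance (\<rho>+2) sqrt N of the mean allowed above.\<close>
  define N1 where "N1 = max N0 (max 1 (nat \<lceil>b\<^sup>2\<rceil>))"
  have "2 * exp (- real N * J \<rho>) \<le> lr_tail \<rho> x N (exp (real N * \<mu> + b - (1 + \<rho>) / 2 * ln (real N)))" if "N \<ge> N1" for N
  proof -
    have N: "N \<ge> N0" "real N \<ge> 1" "b\<^sup>2 \<le> real N"
      using that unfolding N1_def by (simp_all add: nat_le_iff ceiling_le_iff)
    define a where "a = real N * \<mu> + b - (1 + \<rho>) / 2 * ln (real N)"
    have lnN: "ln (real N) = 2 * ln (sqrt (real N))" using N by (simp add: ln_sqrt)
    also have "ln (sqrt (real N)) \<le> sqrt (real N)" using N by (intro ln_bound) auto
    finally have "(1 + \<rho>) / 2 * ln (real N) \<le> (1 + \<rho>) / 2 * (2 * sqrt (real N))"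
      using \<rho> by (intro mult_left_mono) auto
    then have 1: "(1 + \<rho>) / 2 * ln (real N) \<le> (1 + \<rho>) * sqrt (real N)" by simp
    have 2: "0 \<le> (1 + \<rho>) / 2 * ln (real N)" using \<rho> N by simp
    have 3: "\<bar>b\<bar> \<le> sqrt (real N)" using real_sqrt_le_mono[OF N(3)] by simp
    have "\<bar>a - real N * \<mu>\<bar> \<le> (1 + \<rho>) * sqrt (real N) + sqrt (real N)"
      unfolding a_def using 1 2 3 by linarith
    then have "\<bar>a - real N * \<mu>\<bar> \<le> (\<rho> + 2) * sqrt (real N)" by (simp add: algebra_simps)
    note w = N0[OF N(1) this]
    have "exp (- (a + K + real N * E0u \<rho>) / (1 + \<rho>)) * (c / sqrt (real N)) = 2 * exp (- real N * J \<rho>)"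
    proof -
      have "- (a + K + real N * E0u \<rho>) / (1 + \<rho>) = - (real N * J \<rho>) - ln (c / 2) + ln (real N) / 2"
        using \<rho> unfolding a_def b_def \<mu>_def by (simp add: field_simps)
      then have "exp (- (a + K + real N * E0u \<rho>) / (1 + \<rho>)) = exp (- (real N * J \<rho>)) * exp (- ln (c / 2)) * exp (ln (real N) / 2)"
        by (simp add: exp_add[symmetric])
      also have "exp (ln (real N) / 2) = sqrt (real N)" unfolding lnN using N by simp
      also have "exp (- ln (c / 2)) = 2 / c" using c by (simp add: exp_minus)
      finally show ?thesis using c N by simp
    qed
    then have "2 * exp (- real N * J \<rho>) \<le> exp (- (a + K + real N * E0u \<rho>) / (1 + \<rho>)) * wsum (V \<rho> x) N
        (\<lambda>ys. if a \<le> sum_list (map (llr \<rho> x) ys) \<and> sum_list (map (llr \<rho> x) ys) < a + K then 1 else 0)"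
      using mult_left_mono[OF w, of "exp (- (a + K + real N * E0u \<rho>) / (1 + \<rho>))"] by simp
    also have "\<dots> \<le> lr_tail \<rho> x N (exp a)" using \<rho> by (intro lr_tail_ge) auto
    finally show ?thesis unfolding a_def .
  qed
  then show ?thesis unfolding \<mu>_def by blast
qed

text \<open>A positive likelihood ratio forces every letter into the support of row x.
  \<open>lr_tail_support\<close> shows that a small positive threshold attains this bound; the two
  serve to prove positivity of the error probability at short lengths.\<close>

lemma lr_tail_le_support:
  assumes "l > 0"
  shows "lr_tail \<rho> x N l \<le> (\<Sum>y\<in>UNIV. q \<rho> y * (if 0 < W x y then 1 else 0)) ^ N"
proof -
  let ?b = "\<lambda>y. if 0 < W x y then 1 else (0::real)"
  have *: "(if 0 < prod_list (map (lr \<rho> x) ys) then 1 else 0) \<le> prod_list (map ?b ys)" for ys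
  proof (induction ys)
    case (Cons y ys)
    show ?case
    proof (cases "0 < W x y")
      case True
      then show ?thesis using Cons by (simp add: zero_less_mult_iff lr_pos_iff lr_nonneg not_less[symmetric]) (use lr_pos_iff[of \<rho> x y] in force)
    next
      case False
      then have "lr \<rho> x y = 0" using lr_pos_iff[of \<rho> x y] lr_nonneg[of \<rho> x y] by linarith
      then show ?thesis using False by simp
    qed
  qed simp
  have "lr_tail \<rho> x N l \<le> wsum (q \<rho>) N (\<lambda>ys. prod_list (map ?b ys))"
    unfolding lr_tail_def
  proof (intro wsum_mono q_nonneg)
    fix ys :: "'y list"
    have "(if l \<le> prod_list (map (lr \<rho> x) ys) then 1 else 0)
      \<le> (if 0 < prod_list (map (lr \<rho> x) ys) then 1 else (0::real))"
      using assms by auto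
    with *[of ys] show "(if l \<le> prod_list (map (lr \<rho> x) ys) then 1 else 0) \<le> prod_list (map ?b ys)"
      by linarith
  qed
  then show ?thesis by (simp only: wsum_prod_list)
qed

lemma lr_tail_support:
  "\<exists>l>0. (\<Sum>y\<in>UNIV. q \<rho> y * (if 0 < W x y then 1 else 0)) ^ N \<le> lr_tail \<rho> x N l"
proof -
  let ?b = "\<lambda>y. if 0 < W x y then 1 else (0::real)"
  define l where "l = Min (lr \<rho> x ` {y. 0 < W x y})"
  have ne: "lr \<rho> x ` {y. 0 < W x y} \<noteq> {}" using ex_W_pos[of x] by auto
  then have l: "l > 0" unfolding l_def by (subst Min_gr_iff) (auto simp: lr_pos_iff)
  have le: "l \<le> lr \<rho> x y" if "0 < W x y" for y
    unfolding l_def using that by (intro Min_le) auto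
  have *: "prod_list (map ?b ys) \<le> (if l ^ length ys \<le> prod_list (map (lr \<rho> x) ys) then 1 else 0)" for ys
  proof (induction ys)
    case (Cons y ys)
    show ?case
    proof (cases "0 < W x y")
      case True
      have "l * l ^ length ys \<le> lr \<rho> x y * prod_list (map (lr \<rho> x) ys)" if "l ^ length ys \<le> prod_list (map (lr \<rho> x) ys)"
        using le[OF True] that l by (intro mult_mono lr_nonneg) auto
      then show ?thesis using True Cons by (auto split: if_splits)
    qed simp
  qed simp
  have "wsum (q \<rho>) N (\<lambda>ys. prod_list (map ?b ys)) \<le> lr_tail \<rho> x N (l ^ N)"
    unfolding lr_tail_def
  proof (intro wsum_mono q_nonneg)
    fix ys :: "'y list" assume "length ys = N"
    with *[of ys] show "prod_list (map ?b ys) \<le> (if l ^ N \<le> prod_list (map (lr \<rho> x) ys) then 1 else 0)"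
      by simp
  qed
  then show ?thesis using l unfolding wsum_prod_list by (intro exI[of _ "l ^ N"]) auto
qed

proposition feedback_converse:
  assumes \<rho>: "\<rho> > 0"
  shows "\<exists>K>0. \<forall>N\<ge>1. K * (exp (- real N * (E0u \<rho> - \<rho> * J \<rho>)) / real N powr ((1 + \<rho>) / 2)) \<le> Pe_fb_avg W N (J \<rho>)"
proof -
  define R where "R = J \<rho>"
  define x :: 'x where "x = undefined"
  obtain b N0 where N0: "\<And>N. N \<ge> N0 \<Longrightarrow> 2 * exp (- real N * R)
    \<le> lr_tail \<rho> x N (exp (real N * ((1 + \<rho>) * R - E0u \<rho>) + b - (1 + \<rho>) / 2 * ln (real N)))"
    using lr_tail_large_N[OF \<rho>, of x] unfolding R_def by blast
  let ?s = "\<Sum>y\<in>UNIV. q \<rho> y * (if 0 < W x y then 1 else 0)"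
  have s0: "0 \<le> ?s" by (intro sum_nonneg) (auto simp: q_nonneg)
  \<comment> \<open>The tail estimate at the single length N0 already compares the two bases, and
    then their powers compare at every positive length.\<close>
  have s: "exp (- R) < ?s"
  proof (rule ccontr)
    assume "\<not> ?thesis"
    then have "?s ^ N0 \<le> exp (- R) ^ N0" using s0 by (intro power_mono) auto
    also have "\<dots> = exp (- real N0 * R)" by (simp add: exp_of_nat_mult[symmetric])
    finally have "?s ^ N0 \<le> exp (- real N0 * R)" .
    moreover have "2 * exp (- real N0 * R) \<le> ?s ^ N0"
      using N0[of N0] lr_tail_le_support by (meson exp_gt_zero order_refl order_trans)
    ultimately show False using exp_gt_zero[of "- real N0 * R"] by linarith
  qed
  let ?g = "\<lambda>N. exp (- real N * (E0u \<rho> - \<rho> * R)) / real N powr ((1 + \<rho>) / 2)"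
  have "\<exists>K>0. \<forall>N\<ge>1. K * ?g N \<le> Pe_fb_avg W N R"
  proof (rule lower_bound_all_lengths)
    fix N :: nat assume "N \<ge> 1"
    then show "0 < ?g N" by simp
    obtain l where l: "l > 0" "?s ^ N \<le> lr_tail \<rho> x N l" using lr_tail_support by blast
    have "exp (- R) ^ N < ?s ^ N" using s \<open>N \<ge> 1\<close> by (intro power_strict_mono) auto
    then have "exp (- real N * R) < lr_tail \<rho> x N l" using l by (simp add: exp_of_nat_mult[symmetric])
    then have "0 < l * (lr_tail \<rho> x N l - exp (- real N * R))" using l by simp
    also have "\<dots> \<le> Pe_fb_avg W N R" using l by (intro Pe_fb_avg_ge)
    finally show "0 < Pe_fb_avg W N R" .
  next
    fix N assume N: "N \<ge> max 1 N0"
    define a where "a = real N * ((1 + \<rho>) * R - E0u \<rho>) + b - (1 + \<rho>) / 2 * ln (real N)"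
    have "exp b * ?g N = exp a * exp (- real N * R)"
      using N by (simp add: powr_def a_def exp_add[symmetric] exp_diff[symmetric] algebra_simps)
    also have "\<dots> \<le> exp a * (lr_tail \<rho> x N (exp a) - exp (- real N * R))"
      using N0[of N] N unfolding a_def by (intro mult_left_mono) auto
    also have "\<dots> \<le> Pe_fb_avg W N R" by (intro Pe_fb_avg_ge) auto
    finally show "exp b * ?g N \<le> Pe_fb_avg W N R" .
  qed auto
  then show ?thesis unfolding R_def .
qed

end

section \<open>Random coding\<close>

text \<open>\<open>b x\<close> is the cost of the word \<open>x\<close> alone and \<open>a x x'\<close> the cost that \<open>x'\<close> inflicts on \<open>x\<close>.\<close>

fun pair_cost :: "('w \<Rightarrow> real) \<Rightarrow> ('w \<Rightarrow> 'w \<Rightarrow> real) \<Rightarrow> 'w list \<Rightarrow> real" where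
  "pair_cost b a [] = 0"
| "pair_cost b a (x # c) = b x + pair_cost (\<lambda>x'. b x' + a x x' + a x' x) a c"

definition word_cost :: "('w \<Rightarrow> real) \<Rightarrow> ('w \<Rightarrow> 'w \<Rightarrow> real) \<Rightarrow> 'w list \<Rightarrow> nat \<Rightarrow> real" where
  "word_cost b a c i = b (c ! i) + (\<Sum>j<length c. if j = i then 0 else a (c ! i) (c ! j))"

lemma pair_cost_eq: "pair_cost b a c = (\<Sum>i<length c. word_cost b a c i)"
proof (induction c arbitrary: b)
  case (Cons x c)
  have 1: "word_cost b a (x # c) 0 = b x + (\<Sum>j<length c. a x (c ! j))"
    by (simp add: word_cost_def sum.lessThan_Suc_shift del: sum.lessThan_Suc cong: if_cong)
  have 2: "word_cost b a (x # c) (Suc i) = word_cost b a c i + a (c ! i) x" for i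
    by (simp add: word_cost_def sum.lessThan_Suc_shift del: sum.lessThan_Suc cong: if_cong)
  have 3: "word_cost (\<lambda>x'. b x' + a x x' + a x' x) a c i = word_cost b a c i + a x (c ! i) + a (c ! i) x" for i
    by (simp add: word_cost_def)
  have "(\<Sum>i<length (x # c). word_cost b a (x # c) i)
    = b x + (\<Sum>j<length c. a x (c ! j)) + (\<Sum>i<length c. word_cost b a c i + a (c ! i) x)"
    by (simp only: list.size(4) add_Suc_right add_0_right sum.lessThan_Suc_shift 1 2)
  then show ?case by (simp add: Cons.IH 3 sum.distrib)
qed simp

lemma ex_le_average:
  fixes f :: "'a \<Rightarrow> real"
  assumes "finite S" "S \<noteq> {}"
  shows "\<exists>x\<in>S. f x \<le> (\<Sum>x\<in>S. f x) / real (card S)"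
proof (rule ccontr)
  assume "\<not> ?thesis"
  then have "(\<Sum>x\<in>S. (\<Sum>x\<in>S. f x) / real (card S)) < (\<Sum>x\<in>S. f x)"
    using assms by (intro sum_strict_mono) (auto simp: not_le)
  then show False using assms by simp
qed

text \<open>Random coding without probability: the words are chosen one by one, each not worse than average
  given the remaining ones; the already chosen words are absorbed into \<open>b\<close>.\<close>

lemma ex_low_pair_cost:
  fixes a :: "'w \<Rightarrow> 'w \<Rightarrow> real"
  assumes S: "finite S" "S \<noteq> {}"
  shows "\<exists>c. length c = k \<and> set c \<subseteq> S \<and> pair_cost b a c
    \<le> real k * ((\<Sum>x\<in>S. b x) / real (card S)) + real k * (real k - 1) * ((\<Sum>x\<in>S. \<Sum>x'\<in>S. a x x') / (real (card S))\<^sup>2)"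
proof (induction k arbitrary: b)
  case 0
  show ?case by (intro exI[of _ "[]"]) simp
next
  case (Suc k)
  let ?n = "real (card S)" and ?k = "real k"
  have n: "?n > 0" using S by (simp add: card_gt_0_iff)
  define A where "A = (\<Sum>x\<in>S. \<Sum>x'\<in>S. a x x')"
  define B where "B = (\<Sum>x\<in>S. b x)"
  have A': "(\<Sum>x\<in>S. \<Sum>x'\<in>S. a x' x) = A" unfolding A_def by (rule sum.swap)
  define g where "g = (\<lambda>x. b x + ?k * ((\<Sum>x'\<in>S. b x' + a x x' + a x' x) / ?n) + ?k * (?k - 1) * (A / ?n\<^sup>2))"
  have "(\<Sum>x\<in>S. \<Sum>x'\<in>S. b x' + a x x' + a x' x) = ?n * B + 2 * A"
    by (simp add: sum.distrib A' A_def[symmetric] B_def)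
  moreover have "(\<Sum>x\<in>S. ?k * ((\<Sum>x'\<in>S. b x' + a x x' + a x' x) / ?n))
      = ?k * ((\<Sum>x\<in>S. \<Sum>x'\<in>S. b x' + a x x' + a x' x) / ?n)"
    by (simp only: sum_distrib_left sum_divide_distrib)
  ultimately have sum_g: "(\<Sum>x\<in>S. g x) = B + ?k * ((?n * B + 2 * A) / ?n) + ?n * (?k * (?k - 1) * (A / ?n\<^sup>2))"
    by (simp add: g_def sum.distrib B_def)
  have "(B + t * ((n * B + 2 * A) / n) + n * (t * (t - 1) * (A / n\<^sup>2))) / n
      = (t + 1) * (B / n) + (t + 1) * t * (A / n\<^sup>2)" if "0 < n" for n t
    using that by (simp add: field_simps power2_eq_square)
  from this[OF n, of ?k]
  have avg: "(\<Sum>x\<in>S. g x) / ?n = real (Suc k) * (B / ?n) + real (Suc k) * (real (Suc k) - 1) * (A / ?n\<^sup>2)"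
    unfolding sum_g by (simp add: add.commute)
  obtain x where x: "x \<in> S" "g x \<le> (\<Sum>x\<in>S. g x) / ?n" using ex_le_average[OF S] by blast
  obtain c where c: "length c = k" "set c \<subseteq> S"
    "pair_cost (\<lambda>x'. b x' + a x x' + a x' x) a c
      \<le> ?k * ((\<Sum>x'\<in>S. b x' + a x x' + a x' x) / ?n) + ?k * (?k - 1) * (A / ?n\<^sup>2)"
    using Suc[of "\<lambda>x'. b x' + a x x' + a x' x"] unfolding A_def by blast
  have "pair_cost b a (x # c) \<le> g x" using c by (simp add: g_def)
  with x(2) have "pair_cost b a (x # c) \<le> real (Suc k) * (B / ?n) + real (Suc k) * (real (Suc k) - 1) * (A / ?n\<^sup>2)"
    unfolding avg by linarith
  with c x show ?case unfolding A_def B_def by (intro exI[of _ "x # c"]) auto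
qed

section \<open>Expurgation and the union bound\<close>

lemma ex_maximizer:
  fixes h :: "'a \<Rightarrow> real"
  assumes "finite S" "S \<noteq> {}"
  shows "\<exists>m\<in>S. \<forall>m'\<in>S. h m' \<le> h m"
proof -
  have "Max (h ` S) \<in> h ` S" using assms by (intro Max_in) auto
  then obtain m where "m \<in> S" "Max (h ` S) = h m" by blast
  moreover have "h m' \<le> Max (h ` S)" if "m' \<in> S" for m' using assms that by (intro Max_ge) auto
  ultimately show ?thesis by auto
qed

text \<open>Expurgation by Markov's inequality: more than M values above 2e would exceed the total.
  It turns average into maximal error at the price of a factor 2 in the error and in the code
  size.\<close>

lemma many_below_twice_average:
  fixes f :: "nat \<Rightarrow> real"
  assumes f: "\<And>i. i < 2 * M \<Longrightarrow> 0 \<le> f i" and s: "(\<Sum>i<2 * M. f i) \<le> 2 * real M * e"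
  shows "\<exists>I\<subseteq>{..<2 * M}. card I = M \<and> (\<forall>i\<in>I. f i \<le> 2 * e)"
proof -
  let ?G = "{i. i < 2 * M \<and> f i \<le> 2 * e}" and ?H = "{i. i < 2 * M \<and> \<not> f i \<le> 2 * e}"
  have "M \<le> card ?G"
  proof (rule ccontr)
    assume "\<not> M \<le> card ?G"
    moreover have "card ?G + card ?H = 2 * M"
    proof -
      have "card ?G + card ?H = card (?G \<union> ?H)" by (intro card_Un_disjoint[symmetric]) auto
      also have "?G \<union> ?H = {..<2 * M}" by auto
      finally show ?thesis by simp
    qed
    ultimately have H: "M < card ?H" by linarith
    then have ne: "?H \<noteq> {}" by (metis card.empty not_less_zero)
    then obtain i where i: "i \<in> ?H" by blast
    have e0: "0 \<le> e"
    proof -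
      have "0 \<le> (\<Sum>i<2 * M. f i)" using f by (intro sum_nonneg) auto
      then have "0 \<le> 2 * real M * e" using s by linarith
      moreover have "0 < 2 * real M" using i by auto
      ultimately show ?thesis by (simp add: zero_le_mult_iff)
    qed
    have "2 * real M * e \<le> real (card ?H) * (2 * e)"
      using mult_right_mono[of "real M" "real (card ?H)" "2 * e"] H e0 by simp
    also have "\<dots> = (\<Sum>i\<in>?H. 2 * e)" by simp
    also have "\<dots> < (\<Sum>i\<in>?H. f i)" using ne by (intro sum_strict_mono) auto
    also have "\<dots> \<le> (\<Sum>i<2 * M. f i)" using f by (intro sum_mono2) auto
    finally show False using s by linarith
  qed
  then obtain I where "I \<subseteq> ?G" "card I = M" by (rule obtain_subset_with_card_n)
  then show ?thesis by (intro exI[of _ I]) auto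
qed

lemma prodW_nonneg: "(\<And>x y. 0 \<le> W x y) \<Longrightarrow> 0 \<le> prodW W xs ys" for W :: "'x \<Rightarrow> 'y \<Rightarrow> real"
  unfolding prodW_def by (intro prod_nonneg) auto

lemma finite_messages: "finite (messages N R)"
  by (simp add: messages_def)

lemma messages_nonempty: "messages N R \<noteq> {}"
  by (simp add: messages_def Suc_le_eq)

lemma Pe_le:
  fixes W :: "'x::finite \<Rightarrow> 'y::finite \<Rightarrow> real"
  assumes W: "\<And>x y. 0 \<le> W x y" and code: "is_code N R f dec"
    and err: "\<And>m. m \<in> messages N R \<Longrightarrow> err_msg W N f dec m \<le> e"
  shows "Pe W N R \<le> e"
proof -
  have nn: "0 \<le> err_msg W N f dec m" for f :: "nat \<Rightarrow> 'x list" and dec m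
    unfolding err_msg_def by (intro sum_nonneg) (auto intro: prodW_nonneg W)
  have "bdd_below {Max ((err_msg W N f dec) ` messages N R) | f dec. is_code N R f dec}"
  proof (rule bdd_belowI)
    fix t assume "t \<in> {Max ((err_msg W N f dec) ` messages N R) | f dec. is_code N R f dec}"
    then obtain f dec where t: "t = Max ((err_msg W N f dec) ` messages N R)" by blast
    obtain m where "m \<in> messages N R" using messages_nonempty by blast
    then have "err_msg W N f dec m \<le> t" unfolding t by (intro Max_ge) (auto simp: finite_messages)
    then show "0 \<le> t" using nn[of f dec m] by linarith
  qed
  then have "Pe W N R \<le> Max ((err_msg W N f dec) ` messages N R)"
    unfolding Pe_def using code by (intro cInf_lower) auto
  also have "\<dots> \<le> e"
    using err messages_nonempty by (intro Max.boundedI) (auto simp: finite_messages)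
  finally show ?thesis .
qed

text \<open>Ties count against the transmitted word, so the decoder may pick any maximiser of the
  likelihood.\<close>

definition beat_prob :: "('x::finite \<Rightarrow> 'y::finite \<Rightarrow> real) \<Rightarrow> nat \<Rightarrow> 'x list \<Rightarrow> 'y list \<Rightarrow> real" where
  "beat_prob W N xs ys = (\<Sum>xs'\<in>words N. if prodW W xs ys \<le> prodW W xs' ys then 1 else 0) / real (card (words N :: 'x list set))"

lemma words_nonempty: "(words N :: 'a list set) \<noteq> {}"
proof -
  have "replicate N (undefined :: 'a) \<in> words N" by (simp add: words_def)
  then show ?thesis by blast
qed

text \<open>The truncation at 1 is built into the costs: an output that is not \<open>good\<close>
  for xs is charged in full to xs alone, through \<open>b\<close>, and the others are charged by
  pairs, through \<open>a\<close>. Mean single cost plus M times mean pair cost is then exactly the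
  expectation of the minimum. \<open>M\<close> is twice the number of messages because half of the
  words are expurgated.\<close>

proposition random_coding_union_bound:
  fixes W :: "'x::finite \<Rightarrow> 'y::finite \<Rightarrow> real" and N :: nat and R :: real
  assumes W: "\<And>x y. 0 \<le> W x y"
  defines "M \<equiv> 2 * real (card (messages N R))"
  shows "Pe W N R \<le> 2 * ((\<Sum>xs\<in>words N. \<Sum>ys\<in>words N. prodW W xs ys * min 1 (M * beat_prob W N xs ys))
     / real (card (words N :: 'x list set)))"
proof -
  let ?S = "words N :: 'x list set" and ?n = "real (card (words N :: 'x list set))"
  let ?P = "prodW W" and ?m = "card (messages N R)"
  have n: "?n > 0" using words_nonempty[of N] by (simp add: card_gt_0_iff)
  have P0: "0 \<le> ?P xs ys" for xs ys by (rule prodW_nonneg[OF W])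
  define good where "good xs ys \<longleftrightarrow> M * beat_prob W N xs ys \<le> 1" for xs ys
  define b where "b xs = (\<Sum>ys\<in>words N. if good xs ys then 0 else ?P xs ys)" for xs
  define a where "a xs xs' = (\<Sum>ys\<in>words N. if good xs ys \<and> ?P xs ys \<le> ?P xs' ys then ?P xs ys else 0)" for xs xs'
  have a0: "0 \<le> a xs xs'" for xs xs' unfolding a_def using P0 by (intro sum_nonneg) auto
  have b0: "0 \<le> b xs" for xs unfolding b_def using P0 by (intro sum_nonneg) auto
  define e where "e = (\<Sum>xs\<in>words N. \<Sum>ys\<in>words N. ?P xs ys * min 1 (M * beat_prob W N xs ys)) / ?n"
  have e: "(\<Sum>xs\<in>?S. b xs) / ?n + M * ((\<Sum>xs\<in>?S. \<Sum>xs'\<in>?S. a xs xs') / ?n\<^sup>2) = e"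
  proof -
    have beat: "(\<Sum>xs'\<in>?S. a xs xs') / ?n = (\<Sum>ys\<in>words N. if good xs ys then ?P xs ys * beat_prob W N xs ys else 0)" for xs
    proof -
      have "(\<Sum>xs'\<in>?S. a xs xs') = (\<Sum>ys\<in>words N. \<Sum>xs'\<in>?S. if good xs ys \<and> ?P xs ys \<le> ?P xs' ys then ?P xs ys else 0)"
        unfolding a_def by (rule sum.swap)
      also have "\<dots> = (\<Sum>ys\<in>words N. ?n * (if good xs ys then ?P xs ys * beat_prob W N xs ys else 0))"
      proof (intro sum.cong refl)
        fix ys
        have "(\<Sum>xs'\<in>?S. if ?P xs ys \<le> ?P xs' ys then ?P xs ys else 0)
          = ?P xs ys * (\<Sum>xs'\<in>?S. if ?P xs ys \<le> ?P xs' ys then 1 else 0)"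
          unfolding sum_distrib_left by (intro sum.cong) auto
        then show "(\<Sum>xs'\<in>?S. if good xs ys \<and> ?P xs ys \<le> ?P xs' ys then ?P xs ys else 0)
          = ?n * (if good xs ys then ?P xs ys * beat_prob W N xs ys else 0)"
          using n by (simp add: beat_prob_def)
      qed
      finally have *: "(\<Sum>xs'\<in>?S. a xs xs') = ?n * (\<Sum>ys\<in>words N. if good xs ys then ?P xs ys * beat_prob W N xs ys else 0)"
        by (simp only: sum_distrib_left)
      show ?thesis unfolding * using n by (intro nonzero_mult_div_cancel_left) linarith
    qed
    have "(\<Sum>xs\<in>?S. b xs) / ?n + M * ((\<Sum>xs\<in>?S. \<Sum>xs'\<in>?S. a xs xs') / ?n\<^sup>2)
       = ((\<Sum>xs\<in>?S. b xs) + M * (\<Sum>xs\<in>?S. (\<Sum>xs'\<in>?S. a xs xs') / ?n)) / ?n"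
    proof -
      have "X / ?n + M * (T / ?n\<^sup>2) = (X + M * (T / ?n)) / ?n" for X T
        by (simp add: add_divide_distrib power2_eq_square)
      then show ?thesis by (simp only: sum_divide_distrib[symmetric])
    qed
    also have "(\<Sum>xs\<in>?S. b xs) + M * (\<Sum>xs\<in>?S. (\<Sum>xs'\<in>?S. a xs xs') / ?n)
       = (\<Sum>xs\<in>?S. \<Sum>ys\<in>words N. (if good xs ys then 0 else ?P xs ys) + M * (if good xs ys then ?P xs ys * beat_prob W N xs ys else 0))"
      unfolding beat b_def by (simp only: sum.distrib sum_distrib_left)
    also have "\<dots> = (\<Sum>xs\<in>?S. \<Sum>ys\<in>words N. ?P xs ys * min 1 (M * beat_prob W N xs ys))"
      by (intro sum.cong refl) (auto simp: good_def min_def)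
    finally show ?thesis unfolding e_def .
  qed
  obtain c where c: "length c = 2 * ?m" "set c \<subseteq> ?S"
    "pair_cost b a c \<le> real (2 * ?m) * ((\<Sum>x\<in>?S. b x) / ?n) + real (2 * ?m) * (real (2 * ?m) - 1) * ((\<Sum>x\<in>?S. \<Sum>x'\<in>?S. a x x') / ?n\<^sup>2)"
    using ex_low_pair_cost[OF finite_words words_nonempty, where k = "2 * ?m" and a = a and b = b] by blast
  have "real (2 * ?m) * (real (2 * ?m) - 1) * ((\<Sum>x\<in>?S. \<Sum>x'\<in>?S. a x x') / ?n\<^sup>2)
     \<le> real (2 * ?m) * M * ((\<Sum>x\<in>?S. \<Sum>x'\<in>?S. a x x') / ?n\<^sup>2)"
    using a0 by (intro mult_right_mono mult_left_mono divide_nonneg_nonneg sum_nonneg) (auto simp: M_def)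
  with c(3) have "pair_cost b a c \<le> real (2 * ?m) * ((\<Sum>x\<in>?S. b x) / ?n + M * ((\<Sum>x\<in>?S. \<Sum>x'\<in>?S. a x x') / ?n\<^sup>2))"
    by (simp add: distrib_left)
  then have "(\<Sum>i<2 * ?m. word_cost b a c i) \<le> 2 * real ?m * e"
    unfolding e pair_cost_eq c(1) by simp
  moreover have "0 \<le> word_cost b a c i" for i
    unfolding word_cost_def using a0 b0 by (intro add_nonneg_nonneg sum_nonneg) auto
  ultimately obtain I where I: "I \<subseteq> {..<2 * ?m}" "card I = ?m" "\<And>i. i \<in> I \<Longrightarrow> word_cost b a c i \<le> 2 * e"
    using many_below_twice_average[of ?m "word_cost b a c" e] by blast
  have finI: "finite I" using I(1) finite_subset by blast
  then obtain g where g: "bij_betw g (messages N R) I"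
    using I(2) finite_messages by (metis finite_same_card_bij)
  define f where "f m = c ! g m" for m
  have gI: "g m \<in> I" if "m \<in> messages N R" for m using g that by (auto simp: bij_betw_def)
  have "\<forall>ys. \<exists>m. m \<in> messages N R \<and> (\<forall>m'\<in>messages N R. ?P (f m') ys \<le> ?P (f m) ys)"
  proof
    fix ys
    show "\<exists>m. m \<in> messages N R \<and> (\<forall>m'\<in>messages N R. ?P (f m') ys \<le> ?P (f m) ys)"
      using ex_maximizer[OF finite_messages messages_nonempty, where h = "\<lambda>m. ?P (f m) ys"] by blast
  qed
  from choice[OF this] obtain dec
    where "\<forall>ys. dec ys \<in> messages N R \<and> (\<forall>m'\<in>messages N R. ?P (f m') ys \<le> ?P (f (dec ys)) ys)" ..
  then have dec: "\<And>ys. dec ys \<in> messages N R"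
    "\<And>ys m'. m' \<in> messages N R \<Longrightarrow> ?P (f m') ys \<le> ?P (f (dec ys)) ys"
    by simp_all
  have "Pe W N R \<le> 2 * e"
  proof (rule Pe_le[OF W])
    have "length (f m) = N" if "m \<in> messages N R" for m
    proof -
      have "f m \<in> set c" unfolding f_def using gI[OF that] I(1) c(1) by (intro nth_mem) auto
      then show ?thesis using c(2) by (auto simp: words_def)
    qed
    then show "is_code N R f dec" using dec(1) by (simp add: is_code_def)
  next
    fix m assume m: "m \<in> messages N R"
    have "err_msg W N f dec m \<le> (\<Sum>ys\<in>words N. (if good (f m) ys then 0 else ?P (f m) ys)
        + (\<Sum>m'\<in>messages N R - {m}. if good (f m) ys \<and> ?P (f m) ys \<le> ?P (f m') ys then ?P (f m) ys else 0))"
      unfolding err_msg_def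
    proof (rule sum_mono)
      fix ys :: "'y list"
      let ?t = "\<lambda>m'. if good (f m) ys \<and> ?P (f m) ys \<le> ?P (f m') ys then ?P (f m) ys else 0"
      have t0: "0 \<le> (\<Sum>m'\<in>messages N R - {m}. ?t m')" using P0 by (intro sum_nonneg) auto
      show "(if dec ys \<noteq> m then ?P (f m) ys else 0) \<le> (if good (f m) ys then 0 else ?P (f m) ys)
        + (\<Sum>m'\<in>messages N R - {m}. ?t m')"
      proof (cases "dec ys \<noteq> m \<and> good (f m) ys")
        case True
        then have "?P (f m) ys = ?t (dec ys)" using dec(2)[OF m] by simp
        also have "\<dots> \<le> (\<Sum>m'\<in>messages N R - {m}. ?t m')"
          using True dec(1) P0 by (intro member_le_sum) (auto simp: finite_messages)
        finally show ?thesis using True by simp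
      next
        case False
        then show ?thesis using t0 P0[of "f m" ys] by auto
      qed
    qed
    also have "\<dots> = b (f m) + (\<Sum>m'\<in>messages N R - {m}. a (f m) (f m'))"
      unfolding a_def b_def by (simp only: sum.distrib) (subst sum.swap, rule refl)
    also have "(\<Sum>m'\<in>messages N R - {m}. a (f m) (f m')) = (\<Sum>j\<in>I - {g m}. a (f m) (c ! j))"
    proof -
      have "bij_betw g (messages N R - {m}) (I - {g m})"
        using g m unfolding bij_betw_def inj_on_def by auto
      then show ?thesis using sum.reindex_bij_betw[of g _ _ "\<lambda>j. a (f m) (c ! j)"]
        by (simp add: f_def)
    qed
    also have "\<dots> = (\<Sum>j\<in>I - {g m}. if j = g m then 0 else a (f m) (c ! j))" by (intro sum.cong) auto
    also have "\<dots> \<le> (\<Sum>j<length c. if j = g m then 0 else a (f m) (c ! j))"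
      using I(1) c(1) a0 by (intro sum_mono2) auto
    finally have "err_msg W N f dec m \<le> word_cost b a c (g m)"
      by (simp add: word_cost_def f_def[symmetric] cong: if_cong)
    also have "\<dots> \<le> 2 * e" by (rule I(3)[OF gI[OF m]])
    finally show "err_msg W N f dec m \<le> 2 * e" .
  qed
  then show ?thesis unfolding e_def .
qed

section \<open>The pairwise error probability and its anti-concentration\<close>

lemma prodW_Nil [simp]: "prodW W [] ys = 1"
  by (simp add: prodW_def)

lemma prodW_Cons [simp]: "prodW W (x # xs) (y # ys) = W x y * prodW W xs ys"
  by (simp add: prodW_def prod.lessThan_Suc_shift del: prod.lessThan_Suc)

lemma card_words: "card (words N :: 'a::finite list set) = CARD('a) ^ N"
proof -
  have "words N = {xs :: 'a list. set xs \<subseteq> UNIV \<and> length xs = N}"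
    by (auto simp: words_def)
  then show ?thesis
    using card_lists_length_eq[of "UNIV :: 'a set" N] by simp
qed

text \<open>The expectation over a competing word when the output \<open>ys\<close> is given: unlike
  in \<open>wsum\<close>, the letter weights and the increments follow the output letter.\<close>

fun cond_sum :: "('y \<Rightarrow> 'x::finite \<Rightarrow> real) \<Rightarrow> ('y \<Rightarrow> 'x \<Rightarrow> real) \<Rightarrow> 'y list \<Rightarrow> (real \<Rightarrow> real) \<Rightarrow> real \<Rightarrow> real" where
  "cond_sum w h [] F t = F t"
| "cond_sum w h (y # ys) F t = (\<Sum>x\<in>UNIV. w y x * cond_sum w h ys F (t + h y x))"

lemma cond_sum_linear:
  "cond_sum w h ys (\<lambda>s. \<Sum>x\<in>A. c x * F x s) t = (\<Sum>x\<in>A. c x * cond_sum w h ys (F x) t)"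
proof (induction ys arbitrary: t)
  case (Cons y ys)
  show ?case
    by (simp add: Cons sum_distrib_left mult.left_commute) (rule sum.swap)
qed simp

lemma cond_sum_shift: "cond_sum w h ys (\<lambda>s. F (s + c)) t = cond_sum w h ys F (t + c)"
  by (induction ys arbitrary: t) (simp_all add: ac_simps)

text \<open>Only the coordinates carrying the letter \<open>y0\<close> are used; averaging over the others cannot
  increase a supremum over shifts.\<close>

lemma cond_sum_le:
  fixes w :: "'y \<Rightarrow> 'x::finite \<Rightarrow> real"
  assumes w: "\<And>y x. 0 \<le> w y x" and \<alpha>: "\<And>y. (\<Sum>x\<in>UNIV. w y x) = \<alpha> y" and "\<alpha> y0 > 0"
    and B: "\<And>t. wsum (\<lambda>x. w y0 x / \<alpha> y0) (count_list ys y0) (\<lambda>xs. F (t + sum_list (map (h y0) xs))) \<le> B"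
  shows "cond_sum w h ys F t \<le> prod_list (map \<alpha> ys) * B"
  using B
proof (induction ys arbitrary: F t)
  case Nil
  then show ?case using Nil[of t] by simp
next
  case (Cons y ys)
  show ?case
  proof (cases "y = y0")
    case False
    have "cond_sum w h (y # ys) F t \<le> (\<Sum>x\<in>UNIV. w y x * (prod_list (map \<alpha> ys) * B))"
      unfolding cond_sum.simps using Cons.prems False
      by (intro sum_mono mult_left_mono w Cons.IH) simp
    also have "\<dots> = prod_list (map \<alpha> (y # ys)) * B"
      by (simp only: sum_distrib_right[symmetric] \<alpha>) simp
    finally show ?thesis .
  next
    case True
    \<comment> \<open>A position carrying \<open>y0\<close> is postponed: its average goes into the
      test function, where \<open>wsum_snoc\<close> picks it up as one more letter.\<close>
    let ?T = "\<lambda>s. \<Sum>x\<in>UNIV. w y0 x / \<alpha> y0 * F (s + h y0 x)"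
    have "cond_sum w h ys ?T t \<le> prod_list (map \<alpha> ys) * B"
    proof (rule Cons.IH)
      fix t
      have "wsum (\<lambda>x. w y0 x / \<alpha> y0) (count_list ys y0) (\<lambda>xs. ?T (t + sum_list (map (h y0) xs)))
        = wsum (\<lambda>x. w y0 x / \<alpha> y0) (Suc (count_list ys y0)) (\<lambda>xs. F (t + sum_list (map (h y0) xs)))"
        by (simp add: wsum_snoc add.assoc)
      then show "wsum (\<lambda>x. w y0 x / \<alpha> y0) (count_list ys y0) (\<lambda>xs. ?T (t + sum_list (map (h y0) xs))) \<le> B"
        using Cons.prems[of t] True by simp
    qed
    moreover have "\<alpha> y0 * cond_sum w h ys ?T t = cond_sum w h (y # ys) F t"
      using True \<open>\<alpha> y0 > 0\<close>
      by (simp only: cond_sum_linear cond_sum_shift[of w h ys F] sum_distrib_left cond_sum.simps) simp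
    ultimately show ?thesis
      using True \<open>\<alpha> y0 > 0\<close> mult_left_mono[of "cond_sum w h ys ?T t" "prod_list (map \<alpha> ys) * B" "\<alpha> y0"]
      by (simp add: mult.assoc)
  qed
qed

lemma sum_words_pairs:
  fixes G :: "'x::finite list \<Rightarrow> 'y::finite list \<Rightarrow> real"
  shows "(\<Sum>xs\<in>words N. \<Sum>ys\<in>words N. G xs ys) = (\<Sum>zs\<in>words N. G (map fst zs) (map snd zs))"
proof (induction N arbitrary: G)
  case (Suc N)
  have "(\<Sum>xs\<in>words (Suc N). \<Sum>ys\<in>words (Suc N). G xs ys)
     = (\<Sum>x\<in>UNIV. \<Sum>xs\<in>words N. \<Sum>y\<in>UNIV. \<Sum>ys\<in>words N. G (x # xs) (y # ys))"
    by (simp add: sum_words_Suc)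
  also have "\<dots> = (\<Sum>x\<in>UNIV. \<Sum>y\<in>UNIV. \<Sum>xs\<in>words N. \<Sum>ys\<in>words N. G (x # xs) (y # ys))"
    by (intro sum.cong refl sum.swap)
  also have "\<dots> = (\<Sum>x\<in>UNIV. \<Sum>y\<in>UNIV. \<Sum>zs\<in>words N. G (x # map fst zs) (y # map snd zs))"
    by (simp only: Suc)
  also have "\<dots> = (\<Sum>p\<in>UNIV. \<Sum>zs\<in>words N. G (fst p # map fst zs) (snd p # map snd zs))"
    by (subst sum.cartesian_product) (simp add: split_def)
  also have "\<dots> = (\<Sum>zs\<in>words (Suc N). G (map fst zs) (map snd zs))"
    by (simp add: sum_words_Suc)
  finally show ?case .
qed simp

text \<open>The bound min 1 (exp T) \<le> exp (\<rho> T) is tight only near T = 0; strictly between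
  0 and 1 the exponent leaves room for a factor decaying on both sides. This is the kernel that
  \<open>concentration_upper\<close> integrates.\<close>

lemma min_one_exp_le:
  fixes \<rho> T :: real
  assumes "0 < \<rho>" "\<rho> < 1"
  shows "min 1 (exp T) \<le> exp (\<rho> * T) * exp (- min \<rho> (1 - \<rho>) * \<bar>T\<bar>)"
proof -
  let ?k = "min \<rho> (1 - \<rho>)"
  have k: "?k \<le> \<rho>" "?k \<le> 1 - \<rho>" by auto
  show ?thesis
  proof (cases "0 \<le> T")
    case True
    have "0 \<le> (\<rho> - ?k) * T" using True k by (intro mult_nonneg_nonneg) auto
    then have "1 \<le> exp (\<rho> * T + - ?k * T)" by (simp add: algebra_simps)
    then show ?thesis using True by (simp add: exp_add[symmetric] min_le_iff_disj)
  next
    case False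
    have "0 \<le> (1 - \<rho> - ?k) * (- T)" using False k by (intro mult_nonneg_nonneg) auto
    then have "T \<le> \<rho> * T + ?k * T" by (simp add: algebra_simps)
    then show ?thesis using False by (simp add: exp_add[symmetric] min_le_iff_disj)
  qed
qed

lemma card_messages_le:
  assumes "R \<ge> 0"
  shows "real (card (messages N R)) \<le> 2 * exp (real N * R)"
proof -
  have "1 \<le> exp (real N * R)" using assms by simp
  moreover have "real (card (messages N R)) \<le> exp (real N * R) + 1"
    unfolding messages_def by simp
  ultimately show ?thesis by linarith
qed

context nonsingular_symmetric_channel
begin

text \<open>A Chernoff bound with s = 1/(1+\<rho>) that keeps the overshoot: for P \<le> P', (P'/P)
  powr s * exp (- s |ln P' - ln P|) is exactly 1. The second factor localises P' near P, so that
  anti-concentration can act.\<close>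

lemma beat_prob_le:
  assumes \<rho>: "0 < \<rho>" and len: "length xs = N" "length ys = N" and pos: "0 < prodW W xs ys"
  shows "beat_prob W N xs ys \<le> prodW W xs ys powr (- 1 / (1 + \<rho>)) *
    cond_sum (\<lambda>y x. W x y powr (1 / (1 + \<rho>)) / real CARD('x)) (\<lambda>y x. ln (W x y)) ys
      (\<lambda>t. exp (- (1 / (1 + \<rho>)) * \<bar>t - ln (prodW W xs ys)\<bar>)) 0"
proof -
  let ?s = "1 / (1 + \<rho>)" and ?P = "prodW W xs ys" and ?n = "real CARD('x)"
  let ?F = "\<lambda>t. exp (- ?s * \<bar>t - ln ?P\<bar>)"
  have cs: "cond_sum (\<lambda>y x. W x y powr ?s / ?n) (\<lambda>y x. ln (W x y)) ys F t
    = (\<Sum>xs'\<in>words (length ys). prodW W xs' ys powr ?s / ?n ^ length ys * F (t + ln (prodW W xs' ys)))" for F t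
  proof (induction ys arbitrary: t)
    case (Cons y ys)
    have "cond_sum (\<lambda>y x. W x y powr ?s / ?n) (\<lambda>y x. ln (W x y)) (y # ys) F t
      = (\<Sum>x\<in>UNIV. \<Sum>xs'\<in>words (length ys). W x y powr ?s / ?n *
          (prodW W xs' ys powr ?s / ?n ^ length ys * F (t + ln (W x y) + ln (prodW W xs' ys))))"
      by (simp add: Cons sum_distrib_left)
    also have "\<dots> = (\<Sum>x\<in>UNIV. \<Sum>xs'\<in>words (length ys). prodW W (x # xs') (y # ys) powr ?s / ?n ^ length (y # ys) *
          F (t + ln (prodW W (x # xs') (y # ys))))"
    proof (intro sum.cong refl)
      fix x xs'
      have "0 \<le> W x y" "0 \<le> prodW W xs' ys" by (auto intro: W_nonneg prodW_nonneg)
      \<comment> \<open>If a likelihood is 0, the logarithm of the product does not split, but then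
        both powers in front vanish.\<close>
      then show "W x y powr ?s / ?n * (prodW W xs' ys powr ?s / ?n ^ length ys * F (t + ln (W x y) + ln (prodW W xs' ys)))
        = prodW W (x # xs') (y # ys) powr ?s / ?n ^ length (y # ys) * F (t + ln (prodW W (x # xs') (y # ys)))"
        by (cases "W x y = 0 \<or> prodW W xs' ys = 0") (auto simp: powr_mult ln_mult add.assoc)
    qed
    finally show ?case by (simp add: sum_words_Suc)
  qed (simp add: words_def)
  have "beat_prob W N xs ys = (\<Sum>xs'\<in>words N. (if ?P \<le> prodW W xs' ys then 1 else 0) / ?n ^ N)"
    by (simp add: beat_prob_def card_words sum_divide_distrib)
  also have "\<dots> \<le> (\<Sum>xs'\<in>words N. ?P powr (- ?s) * (prodW W xs' ys powr ?s / ?n ^ N * ?F (0 + ln (prodW W xs' ys))))"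
  proof (rule sum_mono)
    fix xs'
    show "(if ?P \<le> prodW W xs' ys then 1 else 0) / ?n ^ N
      \<le> ?P powr (- ?s) * (prodW W xs' ys powr ?s / ?n ^ N * ?F (0 + ln (prodW W xs' ys)))"
    proof (cases "?P \<le> prodW W xs' ys")
      case True
      let ?P' = "prodW W xs' ys"
      have P': "0 < ?P'" "ln ?P \<le> ln ?P'" using True pos by auto
      have "?P powr (- ?s) * ?P' powr ?s * ?F (0 + ln ?P') = exp (- ?s * ln ?P + ?s * ln ?P' + - ?s * (ln ?P' - ln ?P))"
      proof -
        have "?F (0 + ln ?P') = exp (- ?s * (ln ?P' - ln ?P))" using P' by simp
        moreover have "?P powr (- ?s) = exp (- ?s * ln ?P)" "?P' powr ?s = exp (?s * ln ?P')"
          using P' pos by (simp_all add: powr_def)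
        ultimately show ?thesis by (simp only: exp_add)
      qed
      also have "\<dots> = 1" by (simp add: algebra_simps)
      finally show ?thesis using True by (simp add: mult.assoc[symmetric])
    qed simp
  qed
  also have "\<dots> = ?P powr (- ?s) * cond_sum (\<lambda>y x. W x y powr ?s / ?n) (\<lambda>y x. ln (W x y)) ys ?F 0"
    unfolding cs by (simp only: len sum_distrib_left)
  finally show ?thesis by simp
qed

text \<open>Given the output, the positions showing \<open>y0\<close> carry independent inputs
  weighted by W powr (1/(1+\<rho>)), and ln W takes two different values there with positive weight.
  \<open>cond_sum_le\<close> retains these positions, so the gain is governed by their
  number.\<close>

lemma beat_prob_concentration:
  assumes \<rho>: "0 < \<rho>" and x: "0 < W x1 y0" "0 < W x2 y0" "W x1 y0 \<noteq> W x2 y0"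
  shows "\<exists>C>0. \<forall>N xs ys. length xs = N \<longrightarrow> length ys = N \<longrightarrow> 0 < prodW W xs ys \<longrightarrow>
    beat_prob W N xs ys \<le> C / sqrt (real (count_list ys y0) + 1)
      * (prodW W xs ys powr (- 1 / (1 + \<rho>)) * prod_list (map (\<alpha> \<rho>) ys))"
proof -
  let ?s = "1 / (1 + \<rho>)" and ?n = "real CARD('x)"
  let ?w = "\<lambda>y x. W x y powr ?s / ?n" and ?h = "\<lambda>y x. ln (W x y)"
  have a0: "0 < \<alpha> \<rho> y0" using x(1) by (rule \<alpha>_pos)
  have w: "(\<Sum>x\<in>UNIV. ?w y x) = \<alpha> \<rho> y" for y by (simp add: \<alpha>_def sum_divide_distrib)
  have "\<exists>C>0. \<forall>N t. wsum (\<lambda>x. ?w y0 x / \<alpha> \<rho> y0) N (\<lambda>xs. exp (- ?s * \<bar>sum_list (map (?h y0) xs) - t\<bar>)) \<le> C / sqrt (real N + 1)"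
  proof (rule concentration_upper[where u = x1 and v = x2])
    show "(\<Sum>x\<in>UNIV. ?w y0 x / \<alpha> \<rho> y0) = 1"
      unfolding sum_divide_distrib[of _ _ "\<alpha> \<rho> y0", symmetric] w using a0 by simp
  qed (use a0 x \<rho> in auto)
  then obtain C where C: "C > 0" "\<And>N t. wsum (\<lambda>x. ?w y0 x / \<alpha> \<rho> y0) N (\<lambda>xs. exp (- ?s * \<bar>sum_list (map (?h y0) xs) - t\<bar>)) \<le> C / sqrt (real N + 1)"
    by blast
  have "beat_prob W N xs ys \<le> C / sqrt (real (count_list ys y0) + 1)
      * (prodW W xs ys powr (- 1 / (1 + \<rho>)) * prod_list (map (\<alpha> \<rho>) ys))"
    if len: "length xs = N" "length ys = N" and pos: "0 < prodW W xs ys" for N xs ys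
  proof -
    let ?F = "\<lambda>t. exp (- ?s * \<bar>t - ln (prodW W xs ys)\<bar>)"
    have "cond_sum ?w ?h ys ?F 0 \<le> prod_list (map (\<alpha> \<rho>) ys) * (C / sqrt (real (count_list ys y0) + 1))"
    proof (rule cond_sum_le[where w = ?w, OF _ w a0])
      fix t
      have e: "\<bar>t + v - ln (prodW W xs ys)\<bar> = \<bar>v - (ln (prodW W xs ys) - t)\<bar>" for v by (simp add: algebra_simps)
      show "wsum (\<lambda>x. ?w y0 x / \<alpha> \<rho> y0) (count_list ys y0) (\<lambda>xs. ?F (t + sum_list (map (?h y0) xs)))
        \<le> C / sqrt (real (count_list ys y0) + 1)"
        unfolding e by (rule C(2))
    qed auto
    then have "prodW W xs ys powr (- 1 / (1 + \<rho>)) * cond_sum ?w ?h ys ?F 0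
      \<le> prodW W xs ys powr (- 1 / (1 + \<rho>)) * (prod_list (map (\<alpha> \<rho>) ys) * (C / sqrt (real (count_list ys y0) + 1)))"
      by (intro mult_left_mono) auto
    with beat_prob_le[OF \<rho> len pos] show ?thesis by (simp add: mult_ac)
  qed
  with C(1) show ?thesis by blast
qed

end

section \<open>Achievability and conclusion\<close>

lemma count_list_pair_le: "count_list zs (x, y) \<le> count_list (map snd zs) y"
  by (induction zs) auto

context nonsingular_symmetric_channel
begin

definition tilted_joint :: "real \<Rightarrow> 'x \<times> 'y \<Rightarrow> real" where
  "tilted_joint \<rho> p = V \<rho> (fst p) (snd p) / real CARD('x)"

text \<open>Minus the information density ln (V / q) of the tilted channel; its exponential is the
  per-letter factor in the bound of \<open>beat_prob_concentration\<close>.\<close>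

definition log_score :: "real \<Rightarrow> 'x \<times> 'y \<Rightarrow> real" where
  "log_score \<rho> p = ln (\<alpha> \<rho> (snd p)) - 1 / (1 + \<rho>) * ln (W (fst p) (snd p))"

lemma tilted_joint_nonneg: "0 \<le> tilted_joint \<rho> p"
  unfolding tilted_joint_def by (intro divide_nonneg_nonneg V_nonneg) auto

lemma tilted_joint_sum: "(\<Sum>p\<in>UNIV. tilted_joint \<rho> p) = 1"
proof -
  have "(\<Sum>p\<in>UNIV. tilted_joint \<rho> p) = (\<Sum>x\<in>UNIV. \<Sum>y\<in>UNIV. V \<rho> x y / real CARD('x))"
    by (subst sum.cartesian_product) (simp add: split_def tilted_joint_def)
  also have "\<dots> = 1" by (simp only: sum_divide_distrib[symmetric] V_sum) simp
  finally show ?thesis .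
qed

lemma prodW_pairs_pos:
  assumes "0 < prodW W (map fst (z # zs)) (map snd (z # zs))"
  shows "0 < W (fst z) (snd z)" "0 < prodW W (map fst zs) (map snd zs)"
proof -
  have "0 \<le> W (fst z) (snd z)" "0 \<le> prodW W (map fst zs) (map snd zs)"
    by (auto intro: W_nonneg prodW_nonneg)
  with assms show "0 < W (fst z) (snd z)" "0 < prodW W (map fst zs) (map snd zs)"
    by (auto simp: zero_less_mult_iff)
qed

lemma score_eq:
  assumes "0 < prodW W (map fst zs) (map snd zs)"
  shows "prodW W (map fst zs) (map snd zs) powr (- 1 / (1 + \<rho>)) * prod_list (map (\<alpha> \<rho>) (map snd zs))
    = exp (sum_list (map (log_score \<rho>) zs))"
  using assms
proof (induction zs)
  case (Cons z zs)
  note pos = prodW_pairs_pos[OF Cons.prems]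
  let ?r = "- 1 / (1 + \<rho>)" and ?P = "prodW W (map fst zs) (map snd zs)" and ?A = "prod_list (map (\<alpha> \<rho>) (map snd zs))"
  have "exp (log_score \<rho> z) = \<alpha> \<rho> (snd z) * W (fst z) (snd z) powr ?r"
  proof -
    have "exp (log_score \<rho> z) = exp (ln (\<alpha> \<rho> (snd z)) + ?r * ln (W (fst z) (snd z)))"
      by (simp add: log_score_def)
    also have "\<dots> = exp (ln (\<alpha> \<rho> (snd z))) * exp (?r * ln (W (fst z) (snd z)))" by (rule exp_add)
    finally show ?thesis using pos(1) \<alpha>_pos[OF pos(1), of \<rho>] by (simp add: powr_def)
  qed
  moreover have "exp (sum_list (map (log_score \<rho>) (z # zs))) = exp (log_score \<rho> z) * exp (sum_list (map (log_score \<rho>) zs))"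
    by (simp add: exp_add)
  moreover have "prodW W (map fst (z # zs)) (map snd (z # zs)) powr ?r = W (fst z) (snd z) powr ?r * ?P powr ?r"
    using pos by (simp add: powr_mult)
  ultimately show ?case using Cons.IH[OF pos(2)] by (simp only: list.map prod_list.Cons) (simp only: mult_ac)
qed simp

text \<open>Tilting the joint law of uniform input and output by exp (\<rho> * score) gives Z times
  the joint law of the tilted channel, letter by letter. The power of Z is the source of exp (- N
  E0u).\<close>

lemma tilt_eq:
  assumes "\<rho> \<ge> 0" "0 < prodW W (map fst zs) (map snd zs)"
  shows "prodW W (map fst zs) (map snd zs) / real CARD('x) ^ length zs * exp (\<rho> * sum_list (map (log_score \<rho>) zs))
    = Z \<rho> ^ length zs * prod_list (map (tilted_joint \<rho>) zs)"
  using assms(2)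
proof (induction zs)
  case (Cons z zs)
  note pos = prodW_pairs_pos[OF Cons.prems]
  let ?w = "W (fst z) (snd z)" and ?a = "\<alpha> \<rho> (snd z)" and ?n = "real CARD('x)"
  have "?w * exp (\<rho> * log_score \<rho> z) = Z \<rho> * V \<rho> (fst z) (snd z)"
  proof -
    have "ln ?w + \<rho> * log_score \<rho> z = 1 / (1 + \<rho>) * ln ?w + \<rho> * ln ?a"
      using assms(1) unfolding log_score_def by (simp add: field_simps)
    then have "exp (ln ?w) * exp (\<rho> * log_score \<rho> z) = exp (1 / (1 + \<rho>) * ln ?w) * exp (\<rho> * ln ?a)"
      by (simp only: exp_add[symmetric])
    then have "?w * exp (\<rho> * log_score \<rho> z) = ?w powr (1 / (1 + \<rho>)) * ?a powr \<rho>"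
      using pos(1) \<alpha>_pos[OF pos(1), of \<rho>] by (simp add: powr_def)
    then show ?thesis using Z_pos[of \<rho>] by (simp add: V_def)
  qed
  then have z: "?w / ?n * exp (\<rho> * log_score \<rho> z) = Z \<rho> * tilted_joint \<rho> z"
    by (simp add: tilted_joint_def)
  have "prodW W (map fst (z # zs)) (map snd (z # zs)) / ?n ^ length (z # zs) * exp (\<rho> * sum_list (map (log_score \<rho>) (z # zs)))
    = (?w / ?n * exp (\<rho> * log_score \<rho> z)) *
      (prodW W (map fst zs) (map snd zs) / ?n ^ length zs * exp (\<rho> * sum_list (map (log_score \<rho>) zs)))"
    by (simp add: distrib_left exp_add)
  also have "\<dots> = Z \<rho> ^ length (z # zs) * prod_list (map (tilted_joint \<rho>) (z # zs))"
    unfolding z Cons.IH[OF pos(2)] by simp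
  finally show ?case .
qed simp

text \<open>On the exceptional event that the letter \<open>(x1, y0)\<close> is rare the exponential bound alone is used;
  Chebyshev makes this event \<open>O(1/N)\<close>, which suffices because \<open>(1 + \<rho>) / 2 \<le> 1\<close>.\<close>

proposition random_coding_achievability:
  assumes \<rho>: "0 < \<rho>" "\<rho> < 1"
  shows "\<exists>K>0. \<forall>N\<ge>1. Pe W N (J \<rho>) \<le> K / real N powr ((1 + \<rho>) / 2) * exp (- real N * (E0u \<rho> - \<rho> * J \<rho>))"
proof -
  define R where "R = J \<rho>"
  have R0: "R \<ge> 0" unfolding R_def by (rule J_nonneg)
  obtain x1 x2 y0 where x: "0 < W x1 y0" "0 < W x2 y0" "W x1 y0 \<noteq> W x2 y0"
    by (rule distinguishing_inputs)
  obtain C where C: "C > 0" and beat: "\<And>N xs ys. length xs = N \<Longrightarrow> length ys = N \<Longrightarrow> 0 < prodW W xs ys \<Longrightarrow>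
    beat_prob W N xs ys \<le> C / sqrt (real (count_list ys y0) + 1)
      * (prodW W xs ys powr (- 1 / (1 + \<rho>)) * prod_list (map (\<alpha> \<rho>) ys))"
    using beat_prob_concentration[OF \<rho>(1) x] by blast
  define \<kappa> where "\<kappa> = min \<rho> (1 - \<rho>)"
  have \<kappa>: "\<kappa> > 0" using \<rho> by (simp add: \<kappa>_def)
  let ?p = "tilted_joint \<rho>" and ?h = "log_score \<rho>"
  have px: "0 < ?p (x1, y0)" "0 < ?p (x2, y0)" using x by (simp_all add: tilted_joint_def V_pos_iff)
  \<comment> \<open>The factor \<open>\<alpha>\<close> is common to both pairs, so the different
    likelihoods separate the scores; this yields the outer factor 1 / sqrt N.\<close>
  have "?h (x1, y0) \<noteq> ?h (x2, y0)" using x \<rho> by (simp add: log_score_def)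
  from concentration_upper[OF tilted_joint_sum tilted_joint_nonneg px this \<kappa>]
  obtain C' where C': "C' > 0" "\<And>N t. wsum ?p N (\<lambda>zs. exp (- \<kappa> * \<bar>sum_list (map ?h zs) - t\<bar>)) \<le> C' / sqrt (real N + 1)"
    by blast
  \<comment> \<open>Half of the expected frequency of the pair, so that Chebyshev makes smaller
    frequencies exceptional.\<close>
  define \<eta> where "\<eta> = ?p (x1, y0) / 2"
  have \<eta>: "\<eta> > 0" using px by (simp add: \<eta>_def)
  \<comment> \<open>First summand: what remains of (1 / sqrt (\<eta> N)) powr \<rho> times the outer
    anti-concentration. Second summand: the Chebyshev bound for the exceptional words.\<close>
  define G where "G = 1 / sqrt \<eta> powr \<rho> * C' + 4 / (?p (x1, y0))\<^sup>2"
  have G: "G > 0" unfolding G_def using C' px \<eta> by (intro add_pos_pos) auto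
  \<comment> \<open>The leading 2 comes from \<open>random_coding_union_bound\<close>, the 4 from M
    \<le> 4 exp (N R): one doubling for expurgation, one for rounding up the number of
    messages.\<close>
  define K where "K = 2 * (4 * C) powr \<rho> * G"
  have "Pe W N R \<le> K / real N powr ((1 + \<rho>) / 2) * exp (- real N * (E0u \<rho> - \<rho> * R))" if N: "N \<ge> 1" for N
  proof -
    define M where "M = 2 * real (card (messages N R))"
    have M: "0 < M" "M \<le> 4 * exp (real N * R)"
      using card_messages_le[OF R0, of N] finite_messages messages_nonempty[of N R]
      by (auto simp: M_def card_gt_0_iff)
    define X where "X = M * C"
    have X: "0 < X" using M C by (simp add: X_def)
    \<comment> \<open>The union factor X improved by at least \<eta> N positions with output
      \<open>y0\<close>.\<close>
    define X1 where "X1 = X / sqrt (\<eta> * real N)"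
    have X1: "0 < X1" using X \<eta> N by (simp add: X1_def)
    let ?n = "real CARD('x)"
    let ?bad = "\<lambda>zs. if real (count_list zs (x1, y0)) < \<eta> * real N then 1 else (0::real)"
    let ?S = "\<lambda>zs. sum_list (map ?h zs)"
    have min_le: "min 1 (b * exp t) \<le> b powr \<rho> * exp (\<rho> * t) * exp (- \<kappa> * \<bar>t - (- ln b)\<bar>)" if "b > 0" for b t
    proof -
      have "min 1 (b * exp t) = min 1 (exp (ln b + t))" using that by (simp add: exp_add)
      also have "\<dots> \<le> exp (\<rho> * (ln b + t)) * exp (- \<kappa> * \<bar>ln b + t\<bar>)"
        unfolding \<kappa>_def by (rule min_one_exp_le[OF \<rho>])
      also have "exp (\<rho> * (ln b + t)) = b powr \<rho> * exp (\<rho> * t)"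
        using that by (simp add: powr_def distrib_left exp_add)
      also have "ln b + t = t - (- ln b)" by simp
      finally show ?thesis .
    qed
    have pt: "prodW W (map fst zs) (map snd zs) * min 1 (M * beat_prob W N (map fst zs) (map snd zs)) / ?n ^ N
      \<le> prod_list (map ?p zs) * (Z \<rho> ^ N * (X1 powr \<rho> * exp (- \<kappa> * \<bar>?S zs - (- ln X1)\<bar>) + X powr \<rho> * ?bad zs))"
      if len: "length zs = N" for zs
    proof -
      let ?P = "prodW W (map fst zs) (map snd zs)" and ?Q = "prod_list (map ?p zs)"
      have Q0: "0 \<le> ?Q" by (intro prod_list_map_nonneg tilted_joint_nonneg)
      have Z0: "0 < Z \<rho> ^ N" using Z_pos[of \<rho>] by simp
      show ?thesis
      proof (cases "0 < ?P")
        case False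
        then have "?P = 0" using prodW_nonneg[of W] W_nonneg by (metis less_le)
        moreover have "0 \<le> ?Q * (Z \<rho> ^ N * (X1 powr \<rho> * exp (- \<kappa> * \<bar>?S zs - (- ln X1)\<bar>) + X powr \<rho> * ?bad zs))"
          using Q0 Z0 by (intro mult_nonneg_nonneg add_nonneg_nonneg) auto
        ultimately show ?thesis by simp
      next
        case True
        let ?k = "real (count_list (map snd zs) y0)"
        have k: "real (count_list zs (x1, y0)) \<le> ?k" using count_list_pair_le by simp
        have "beat_prob W N (map fst zs) (map snd zs) \<le> C / sqrt (?k + 1) * exp (?S zs)"
          using beat[of "map fst zs" N "map snd zs"] True len by (simp only: length_map score_eq[OF True])
        then have "M * beat_prob W N (map fst zs) (map snd zs) \<le> M * (C / sqrt (?k + 1) * exp (?S zs))"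
          using M by (intro mult_left_mono) auto
        then have mb: "M * beat_prob W N (map fst zs) (map snd zs) \<le> X / sqrt (?k + 1) * exp (?S zs)"
          by (simp add: X_def mult.assoc)
        have "min 1 (M * beat_prob W N (map fst zs) (map snd zs))
          \<le> exp (\<rho> * ?S zs) * (X1 powr \<rho> * exp (- \<kappa> * \<bar>?S zs - (- ln X1)\<bar>) + X powr \<rho> * ?bad zs)"
        proof (cases "real (count_list zs (x1, y0)) < \<eta> * real N")
          case rare: True
          have "X / sqrt (?k + 1) \<le> X / 1" using X by (intro divide_left_mono) auto
          then have "X / sqrt (?k + 1) \<le> X" by simp
          then have "X / sqrt (?k + 1) * exp (?S zs) \<le> X * exp (?S zs)"
            by (rule mult_right_mono) simp
          with mb have "min 1 (M * beat_prob W N (map fst zs) (map snd zs)) \<le> min 1 (X * exp (?S zs))"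
            by (intro min.mono) auto
          also have "\<dots> \<le> X powr \<rho> * exp (\<rho> * ?S zs) * exp (- \<kappa> * \<bar>?S zs - (- ln X)\<bar>)"
            by (rule min_le[OF X])
          also have "\<dots> \<le> X powr \<rho> * exp (\<rho> * ?S zs) * 1"
            using \<kappa> by (intro mult_left_mono) auto
          finally have "min 1 (M * beat_prob W N (map fst zs) (map snd zs)) \<le> exp (\<rho> * ?S zs) * (0 + X powr \<rho> * ?bad zs)"
            using rare by (simp add: mult.commute)
          also have "\<dots> \<le> exp (\<rho> * ?S zs) * (X1 powr \<rho> * exp (- \<kappa> * \<bar>?S zs - (- ln X1)\<bar>) + X powr \<rho> * ?bad zs)"
            by (intro mult_left_mono add_right_mono) auto
          finally show ?thesis .
        next
          case frequent: False
          then have "sqrt (\<eta> * real N) \<le> sqrt (?k + 1)" using k by simp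
          then have "X / sqrt (?k + 1) \<le> X1"
            unfolding X1_def using X \<eta> N by (intro divide_left_mono) (auto intro!: mult_pos_pos add_nonneg_pos)
          then have "X / sqrt (?k + 1) * exp (?S zs) \<le> X1 * exp (?S zs)" by (intro mult_right_mono) auto
          with mb have "min 1 (M * beat_prob W N (map fst zs) (map snd zs)) \<le> min 1 (X1 * exp (?S zs))"
            by (intro min.mono) auto
          also have "\<dots> \<le> X1 powr \<rho> * exp (\<rho> * ?S zs) * exp (- \<kappa> * \<bar>?S zs - (- ln X1)\<bar>)"
            by (rule min_le[OF X1])
          finally show ?thesis using frequent by (simp add: mult_ac)
        qed
        then have "?P / ?n ^ N * min 1 (M * beat_prob W N (map fst zs) (map snd zs))
          \<le> ?P / ?n ^ N * (exp (\<rho> * ?S zs) * (X1 powr \<rho> * exp (- \<kappa> * \<bar>?S zs - (- ln X1)\<bar>) + X powr \<rho> * ?bad zs))"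
          using True by (intro mult_left_mono) auto
        also have "\<dots> = (?P / ?n ^ N * exp (\<rho> * ?S zs)) * (X1 powr \<rho> * exp (- \<kappa> * \<bar>?S zs - (- ln X1)\<bar>) + X powr \<rho> * ?bad zs)"
          by (simp only: mult.assoc)
        also have "?P / ?n ^ N * exp (\<rho> * ?S zs) = Z \<rho> ^ N * ?Q"
          using tilt_eq[of \<rho> zs] \<rho> True len by simp
        finally show ?thesis by (simp add: mult_ac)
      qed
    qed
    have "(\<Sum>xs\<in>words N. \<Sum>ys\<in>words N. prodW W xs ys * min 1 (M * beat_prob W N xs ys)) / real (card (words N :: 'x list set))
      = (\<Sum>zs\<in>words N. prodW W (map fst zs) (map snd zs) * min 1 (M * beat_prob W N (map fst zs) (map snd zs)) / ?n ^ N)"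
      by (simp only: sum_words_pairs sum_divide_distrib card_words of_nat_power)
    also have "\<dots> \<le> wsum ?p N (\<lambda>zs. Z \<rho> ^ N * (X1 powr \<rho> * exp (- \<kappa> * \<bar>?S zs - (- ln X1)\<bar>) + X powr \<rho> * ?bad zs))"
      unfolding wsum_def by (intro sum_mono pt) (simp add: words_def)
    also have "\<dots> = Z \<rho> ^ N * (X1 powr \<rho> * wsum ?p N (\<lambda>zs. exp (- \<kappa> * \<bar>?S zs - (- ln X1)\<bar>)) + X powr \<rho> * wsum ?p N ?bad)"
      by (simp only: wsum_cmult wsum_add)
    also have "\<dots> \<le> Z \<rho> ^ N * (X powr \<rho> * (G / real N powr ((1 + \<rho>) / 2)))"
    proof (intro mult_left_mono)
      have "1 / sqrt (real N + 1) \<le> 1 / sqrt (real N)" using N by (intro divide_left_mono) auto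
      then have "C' * (1 / sqrt (real N + 1)) \<le> C' * (1 / sqrt (real N))" using C' by (intro mult_left_mono) auto
      with C'(2)[of N "- ln X1"] have 1: "wsum ?p N (\<lambda>zs. exp (- \<kappa> * \<bar>?S zs - (- ln X1)\<bar>)) \<le> C' / sqrt (real N)" by simp
      have sN: "sqrt (real N) powr \<rho> * sqrt (real N) = real N powr ((1 + \<rho>) / 2)"
        using N by (simp add: powr_half_sqrt[symmetric] powr_powr powr_add[symmetric] add_divide_distrib add.commute)
      have "X1 powr \<rho> = X powr \<rho> / (sqrt \<eta> powr \<rho> * sqrt (real N) powr \<rho>)"
        unfolding X1_def using X \<eta> by (simp add: powr_divide powr_mult real_sqrt_mult)
      then have "X1 powr \<rho> * wsum ?p N (\<lambda>zs. exp (- \<kappa> * \<bar>?S zs - (- ln X1)\<bar>))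
        \<le> X powr \<rho> / (sqrt \<eta> powr \<rho> * sqrt (real N) powr \<rho>) * (C' / sqrt (real N))"
        using 1 by (simp only:) (intro mult_left_mono, auto)
      also have "\<dots> = X powr \<rho> * (1 / sqrt \<eta> powr \<rho> * C' / real N powr ((1 + \<rho>) / 2))"
        unfolding sN[symmetric] by simp
      finally have 2: "X1 powr \<rho> * wsum ?p N (\<lambda>zs. exp (- \<kappa> * \<bar>?S zs - (- ln X1)\<bar>))
        \<le> X powr \<rho> * (1 / sqrt \<eta> powr \<rho> * C' / real N powr ((1 + \<rho>) / 2))" .
      have "wsum ?p N ?bad \<le> 4 / (?p (x1, y0))\<^sup>2 / real N"
        using wsum_count_lower_tail[OF tilted_joint_sum tilted_joint_nonneg px(1) N] by (simp add: \<eta>_def)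
      also have "\<dots> \<le> 4 / (?p (x1, y0))\<^sup>2 / real N powr ((1 + \<rho>) / 2)"
      proof -
        have "real N powr ((1 + \<rho>) / 2) \<le> real N powr 1" using N \<rho> by (intro powr_mono) auto
        then show ?thesis using N by (intro divide_left_mono) auto
      qed
      finally have "X powr \<rho> * wsum ?p N ?bad \<le> X powr \<rho> * (4 / (?p (x1, y0))\<^sup>2 / real N powr ((1 + \<rho>) / 2))"
        by (intro mult_left_mono) auto
      with 2 have "X1 powr \<rho> * wsum ?p N (\<lambda>zs. exp (- \<kappa> * \<bar>?S zs - (- ln X1)\<bar>)) + X powr \<rho> * wsum ?p N ?bad
        \<le> X powr \<rho> * (1 / sqrt \<eta> powr \<rho> * C' / real N powr ((1 + \<rho>) / 2)) + X powr \<rho> * (4 / (?p (x1, y0))\<^sup>2 / real N powr ((1 + \<rho>) / 2))"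
        by (rule add_mono)
      also have "\<dots> = X powr \<rho> * (G / real N powr ((1 + \<rho>) / 2))"
        unfolding G_def by (simp only: add_divide_distrib distrib_left)
      finally show "X1 powr \<rho> * wsum ?p N (\<lambda>zs. exp (- \<kappa> * \<bar>?S zs - (- ln X1)\<bar>)) + X powr \<rho> * wsum ?p N ?bad
        \<le> X powr \<rho> * (G / real N powr ((1 + \<rho>) / 2))" .
    qed (use Z_pos[of \<rho>] in auto)
    also have "\<dots> \<le> Z \<rho> ^ N * ((4 * C) powr \<rho> * exp (real N * (\<rho> * R)) * (G / real N powr ((1 + \<rho>) / 2)))"
    proof (intro mult_left_mono mult_right_mono)
      have "X \<le> 4 * C * exp (real N * R)" unfolding X_def using M(2) C by (simp add: mult.commute)
      then have "X powr \<rho> \<le> (4 * C * exp (real N * R)) powr \<rho>" using X \<rho> by (intro powr_mono2) auto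
      also have "\<dots> = (4 * C) powr \<rho> * exp (real N * (\<rho> * R))"
        using C by (simp add: powr_mult powr_def[of "exp _"] mult_ac)
      finally show "X powr \<rho> \<le> (4 * C) powr \<rho> * exp (real N * (\<rho> * R))" .
    qed (use Z_pos[of \<rho>] G in auto)
    also have "Z \<rho> ^ N = exp (- real N * E0u \<rho>)"
      using Z_pos[of \<rho>] by (simp add: E0u_def exp_of_nat_mult)
    also have "exp (- real N * E0u \<rho>) * ((4 * C) powr \<rho> * exp (real N * (\<rho> * R)) * (G / real N powr ((1 + \<rho>) / 2)))
      = (4 * C) powr \<rho> * G / real N powr ((1 + \<rho>) / 2) * (exp (- real N * E0u \<rho>) * exp (real N * (\<rho> * R)))"
      by simp
    also have "exp (- real N * E0u \<rho>) * exp (real N * (\<rho> * R)) = exp (- real N * (E0u \<rho> - \<rho> * R))"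
      by (simp only: exp_add[symmetric]) (simp add: algebra_simps)
    finally have "(\<Sum>xs\<in>words N. \<Sum>ys\<in>words N. prodW W xs ys * min 1 (M * beat_prob W N xs ys)) / real (card (words N :: 'x list set))
      \<le> (4 * C) powr \<rho> * G / real N powr ((1 + \<rho>) / 2) * exp (- real N * (E0u \<rho> - \<rho> * R))" .
    then have "2 * ((\<Sum>xs\<in>words N. \<Sum>ys\<in>words N. prodW W xs ys * min 1 (M * beat_prob W N xs ys)) / real (card (words N :: 'x list set)))
      \<le> 2 * ((4 * C) powr \<rho> * G / real N powr ((1 + \<rho>) / 2) * exp (- real N * (E0u \<rho> - \<rho> * R)))"
      by (rule mult_left_mono) simp
    also have "\<dots> = K / real N powr ((1 + \<rho>) / 2) * exp (- real N * (E0u \<rho> - \<rho> * R))"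
      by (simp add: K_def)
    finally show ?thesis
      using random_coding_union_bound[where W = W and N = N and R = R, OF W_nonneg] unfolding M_def by linarith
  qed
  moreover have "K > 0" using C G by (simp add: K_def)
  ultimately show ?thesis unfolding R_def by blast
qed

end

theorem theorem1:
  fixes W :: "'x::finite \<Rightarrow> 'y::finite \<Rightarrow> real"
  assumes "is_channel W"
    and "gallager_symmetric W"
    and "\<not> singular_channel W"
    and "R_cr W < capacity W"
  shows "(\<forall>R. R_cr W < R \<and> R < capacity W \<longrightarrow>
           (\<exists>K1>0. \<forall>N::nat. N \<ge> 1 \<longrightarrow>
              Pe W N R \<le> K1 / real N powr ((1 + \<bar>deriv (Er W) R\<bar>) / 2) * exp (- real N * Er W R)))
       \<and> (\<forall>R. R_inf W < R \<and> R < capacity W \<longrightarrow>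
           (\<exists>K1>0. \<forall>N::nat. N \<ge> 1 \<longrightarrow>
              Pe_fb_avg W N R \<ge> K1 / real N powr ((1 + \<bar>deriv (Esp_real W) R\<bar>) / 2) * exp (- real N * Esp_real W R)))"
proof -
  interpret nonsingular_symmetric_channel W
    by unfold_locales (fact assms)+
  show ?thesis
  proof (intro conjI allI impI)
    fix R assume "R_cr W < R \<and> R < capacity W"
    \<comment> \<open>Above the critical rate the optimal tilt is interior to [0,1], which both the
      derivative of \<open>Er\<close> and the kernel of \<open>min_one_exp_le\<close>
      require.\<close>
    then obtain \<rho> where \<rho>: "\<rho> > 0" "\<rho> < 1" and R: "J \<rho> = R"
      using optimal_tilt_above_R_cr by blast
    have "Er W R = E0u \<rho> - \<rho> * R" "deriv (Er W) R = - \<rho>"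
      using \<rho> Er_J[of \<rho>] deriv_Er_J[of \<rho>] by (simp_all add: R)
    then show "\<exists>K1>0. \<forall>N::nat. N \<ge> 1 \<longrightarrow>
        Pe W N R \<le> K1 / real N powr ((1 + \<bar>deriv (Er W) R\<bar>) / 2) * exp (- real N * Er W R)"
      using random_coding_achievability[OF \<rho>] \<rho> by (simp add: R)
  next
    fix R assume "R_inf W < R \<and> R < capacity W"
    then obtain \<rho> where \<rho>: "\<rho> > 0" and R: "J \<rho> = R"
      using optimal_tilt_above_R_inf by blast
    have "Esp_real W R = E0u \<rho> - \<rho> * R" "deriv (Esp_real W) R = - \<rho>"
      using Esp_real_J[OF \<rho>] by (simp_all add: R)
    then show "\<exists>K1>0. \<forall>N::nat. N \<ge> 1 \<longrightarrow>
        Pe_fb_avg W N R \<ge> K1 / real N powr ((1 + \<bar>deriv (Esp_real W) R\<bar>) / 2) * exp (- real N * Esp_real W R)"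
      using feedback_converse[OF \<rho>] \<rho> by (simp add: R)
  qed
qed

end
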